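(* Let $E$ and $H$ be reflexive Banach spaces, let $\mu\in M_b^{una}(\mathbb R,H)$ with hull $\mathcal H(\mu)$, and let $\{U_\nu(t,\tau),\ \nu\in\mathcal H(\mu)\}$, $U_\nu(t,\tau):E\to E$, $t\ge\tau$, be a family of dynamical processes satisfying the translation identity. Assume: (i) (uniform dissipativity) there are $\alpha>0$, $C_*\geq 0$ and a monotone increasing function $Q$ such that $\|U_\nu(t,\tau)\xi\|_E\le Q(\|\xi\|_E)e^{-\alpha(t-\tau)}+C_*$ for all $t\ge\tau$, $\nu\in\mathcal H(\mu)$, $\xi\in E$; (ii) for every fixed $t\ge\tau$ the map $(\xi,\nu)\mapsto U_\nu(t,\tau)\xi$ is continuous from $E^w\times\mathcal H(\mu)$ to $E^w$, where $E^w$ is $E$ with its weak topology and $\mathcal H(\mu)$ carries the local weak-star topology; (iii) $\mathcal B\subset E$ is a bounded uniformly absorbing ball for the family $\{U_\nu(t,\tau)\}$ and $s>0$ is such that $U_\nu(s,0)\mathcal B\subset\mathcal B$ for all $\nu\in\mathcal H(\mu)$; (iv) for every $\varepsilon>0$ there is a map $\Pr(\varepsilon):\mathcal H(\mu)\to M_b^{una}(\mathbb R,H)$ with $\Pr(\varepsilon)\circ T(h)=T(h)\circ\Pr(\varepsilon)$ for all $h\in\mathbb R$, such that $\Pr(\varepsilon)\mathcal H(\mu)$ is precompact in the strong local topology (i.e. for every bounded interval $[a,b]$ the set of restrictions $\Pr(\varepsilon)\mathcal H(\mu)|_{[a,b]}$ is precompact in the norm of $M([a,b],H)$), and such that for all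 $\xi_1,\xi_2\in\mathcal B$ and $\nu_1,\nu_2\in\mathcal H(\mu)$ $$\|U_{\nu_1}(s,0)\xi_1-U_{\nu_2}(s,0)\xi_2\|_E\le\tfrac1{16}\|\xi_1-\xi_2\|_E+L\|\xi_1-\xi_2\|_W+\varepsilon+C\|\Pr(\varepsilon)\nu_1-\Pr(\varepsilon)\nu_2\|_{M_b([0,s],H)},$$ where $W$ is a Banach space such that $E\subset W$ with compact embedding, and the constants $L$ and $C$ are independent of $\varepsilon,\xi_1,\xi_2,\nu_1,\nu_2$. Then the family $\{U_\nu(t,\tau),\nu\in\mathcal H(\mu)\}$ possesses a strong uniform attractor $\mathcal A_{un}^s$ in $E$, and there exist constants $C_1,K_1,L_1,R_0>0$ independent of $\varepsilon$ such that for all $0<\varepsilon\le R_0$ $$\mathbb H_\varepsilon(\mathcal A^s_{un},E)\le C_1\log_2\Big(\frac{2R_0}\varepsilon\Big)+\mathbb H_{\varepsilon/K_1}\Big(\Pr(\varepsilon/K_1)\mathcal H(\mu),\,M_b\big([0,L_1\log_2(\tfrac{2R_0}\varepsilon)],H\big)\Big).$$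
   Context: Measures. For a reflexive Banach space $H$, $M_{loc}(\mathbb R,H)$ is the space of $H$-valued Borel measures on $\mathbb R$ of locally finite total variation; $M([a,b],H)$ is the space of $H$-valued Borel measures of finite variation on $[a,b]$, with the total variation norm (equivalently, the dual norm of $C([a,b],H^* )^*$). $M_b(\mathbb R,H)$ is the space of $\mu\in M_{loc}(\mathbb R,H)$ with $\|\mu\|_{M_b(\mathbb R,H)}:=\sup_{t\in\mathbb R}\|\mu\|_{M([t,t+1],H)}<\infty$. For an interval $I$, $\|\mu\|_{M_b(I,H)}:=\sup_{t}\|\mu\|_{M([t,t+1]\cap I,H)}$. The local weak-star topology $M_{loc}^{w^*}(\mathbb R,H)$ is generated by the functionals $\mu\mapsto\int(\psi(s),\mu(ds))$ with $\psi\in C_c(\mathbb R,H^* )$. Shifts: $(T(h)\mu)(t):=\mu(t+h)$. A measure $\mu\in M_b(\mathbb R,H)$ is (weakly) uniformly non-atomic, $\mu\in M_b^{una}(\mathbb R,H)$, if for every $\psi\in H^*$ there is a monotone increasing $\omega_\psi:\mathbb R_+\to\mathbb R_+$ with $\lim_{\varepsilon\to0}\omega_\psi(\varepsilon)=0$ and $\sup_{t\in\mathbb R}|\int_{[t,t+\varepsilon]}(\mu(ds),\psi)|\le\omega_\psi(\varepsilon)$. The hull $\mathcal H(\mu)$ is the closure of $\{T(h)\mu: h\in\mathbb R\}$ in $M_{loc}^{w^*}(\mathbb R,H)$, endowed with this topology; it is compact and contained in $M_b^{una}(\mathbb R,H)$ when $\mu\in M_b^{una}(\mathbb R,H)$.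 Processes. A dynamical process satisfies $U_\nu(\tau,\tau)=\mathrm{Id}$ and $U_\nu(t,\tau)=U_\nu(t,s)\circ U_\nu(s,\tau)$ for $t\ge s\ge\tau$. The translation identity is $U_\nu(t+h,\tau+h)=U_{T(h)\nu}(t,\tau)$ for $t\ge\tau$, $h\in\mathbb R$. A set $\mathcal B$ is uniformly absorbing if for every bounded $B\subset E$ there is $T=T(B)$ with $U_\nu(t,0)B\subset\mathcal B$ for all $t\ge T$, $\nu\in\mathcal H(\mu)$. Strong uniform attractor. The extended semigroup on $\mathbb E=E\times\mathcal H(\mu)$ is $\mathbb S(t)(\xi,\nu)=(U_\nu(t,0)\xi,T(t)\nu)$, $t\ge0$. A strong global attractor $\mathbb A^s$ is a set which is compact in $E\times\mathcal H(\mu)$ (norm topology on $E$, local weak-star topology on $\mathcal H(\mu)$), satisfies $\mathbb S(t)\mathbb A^s=\mathbb A^s$ for $t\ge0$, and such that for every $\mathbb B$ with bounded projection to $E$ and every neighbourhood $\mathcal O(\mathbb A^s)$ in this topology there is $T$ with $\mathbb S(t)\mathbb B\subset\mathcal O(\mathbb A^s)$ for $t\ge T$. The strong uniform attractor is the projection $\mathcal A^s_{un}=\Pi_1\mathbb A^s$ to the first component. Entropy. For a precompact set $K$ in a metric space $X$, $\mathbb H_\varepsilon(K,X)=\log_2N_\varepsilon(K,X)$, where $N_\varepsilon(K,X)$ is the minimal number of $\varepsilon$-balls in $X$ covering $K$. For a set of measures on $\mathbb R$ and an interval $I$, the entropy in $M_b(I,H)$ is that of the set of restrictions to $I$. *)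

theory Defs
  imports "HOL-Analysis.Analysis"
begin

section \<open>Banach space notions\<close>

definition reflexive_space :: "'a::banach itself \<Rightarrow> bool" where
  "reflexive_space _ \<longleftrightarrow>
     (\<forall>\<Phi> :: ('a \<Rightarrow>\<^sub>L real) \<Rightarrow>\<^sub>L real. \<exists>x::'a. \<forall>\<phi>. blinfun_apply \<Phi> \<phi> = blinfun_apply \<phi> x)"

definition compact_embedding :: "('a::real_normed_vector \<Rightarrow>\<^sub>L 'b::real_normed_vector) \<Rightarrow> bool" where
  "compact_embedding J \<longleftrightarrow>
     inj (blinfun_apply J) \<and> (\<forall>S. bounded S \<longrightarrow> compact (closure (blinfun_apply J ` S)))"

text \<open>The coarsest topology on \<open>X\<close> that makes all functionals in \<open>F\<close> continuous.\<close>

definition initial_topology :: "'a set \<Rightarrow> ('a \<Rightarrow> real) set \<Rightarrow> 'a topology" where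
  "initial_topology X F = topology_generated_by {{x \<in> X. f x \<in> V} |f V. f \<in> F \<and> open V}"

definition weak_topology :: "'a::real_normed_vector topology" where
  "weak_topology = initial_topology UNIV (range (blinfun_apply :: ('a \<Rightarrow>\<^sub>L real) \<Rightarrow> 'a \<Rightarrow> real))"


section \<open>Vector measures on the real line\<close>

text \<open>
  A measure on \<open>I\<close> of locally finite variation is in general only defined on the bounded Borel
  subsets of \<open>I\<close>. It is a set function that is set to \<open>0\<close> on all other sets, so that
  equality of measures is equality of functions.
\<close>

definition total_variation :: "(real set \<Rightarrow> 'h::real_normed_vector) \<Rightarrow> real set \<Rightarrow> ennreal" where
  "total_variation m A =
     (SUP P \<in> {P. finite P \<and> disjoint P \<and> (\<forall>B\<in>P. B \<in> sets borel \<and> B \<subseteq> A)}.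
        \<Sum>B\<in>P. ennreal (norm (m B)))"

definition Mloc :: "real set \<Rightarrow> (real set \<Rightarrow> 'h::real_normed_vector) set" where
  "Mloc I = {m.
     (\<forall>A. \<not> (A \<in> sets borel \<and> bounded A \<and> A \<subseteq> I) \<longrightarrow> m A = 0) \<and>
     (\<forall>F :: nat \<Rightarrow> real set.
        range F \<subseteq> sets borel \<and> disjoint_family F \<and> bounded (\<Union>i. F i) \<and> (\<Union>i. F i) \<subseteq> I \<longrightarrow>
        (\<lambda>i. m (F i)) sums m (\<Union>i. F i)) \<and>
     (\<forall>a b. total_variation m ({a..b} \<inter> I) < \<infinity>)}"

definition mrestrict :: "real set \<Rightarrow> (real set \<Rightarrow> 'h::real_normed_vector) \<Rightarrow> real set \<Rightarrow> 'h" where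
  "mrestrict I m = (\<lambda>A. if A \<subseteq> I then m A else 0)"

definition Mfin :: "real set \<Rightarrow> (real set \<Rightarrow> 'h::real_normed_vector) set" where
  "Mfin I = {m \<in> Mloc I. total_variation m I < \<infinity>}"

definition Mfin_dist ::
    "real set \<Rightarrow> (real set \<Rightarrow> 'h::real_normed_vector) \<Rightarrow> (real set \<Rightarrow> 'h) \<Rightarrow> real" where
  "Mfin_dist I m1 m2 = enn2real (total_variation (\<lambda>A. m1 A - m2 A) I)"

definition Mb_norm :: "real set \<Rightarrow> (real set \<Rightarrow> 'h::real_normed_vector) \<Rightarrow> ennreal" where
  "Mb_norm I m = (SUP t. total_variation m ({t..t+1} \<inter> I))"

definition Mb :: "real set \<Rightarrow> (real set \<Rightarrow> 'h::real_normed_vector) set" where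
  "Mb I = {m \<in> Mloc I. Mb_norm I m < \<infinity>}"

text \<open>
  \<open>Mb_dist I m1 m2\<close> only evaluates \<open>m1\<close> and \<open>m2\<close> on subsets of \<open>I\<close>, so it can be used for
  measures on the whole line as well as for their restrictions to \<open>I\<close>.
\<close>

definition Mb_dist ::
    "real set \<Rightarrow> (real set \<Rightarrow> 'h::real_normed_vector) \<Rightarrow> (real set \<Rightarrow> 'h) \<Rightarrow> real" where
  "Mb_dist I m1 m2 = enn2real (Mb_norm I (\<lambda>A. m1 A - m2 A))"

text \<open>\<open>\<phi> (m {t..t+e})\<close> is the integral of the constant functional \<open>\<phi>\<close> over \<open>{t..t+e}\<close>.\<close>

definition Mb_una :: "(real set \<Rightarrow> 'h::real_normed_vector) set" where
  "Mb_una = {m \<in> Mb UNIV. \<forall>\<phi> :: 'h \<Rightarrow>\<^sub>L real. \<exists>\<omega> :: real \<Rightarrow> real.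
     mono_on {0..} \<omega> \<and> (\<forall>e\<ge>0. 0 \<le> \<omega> e) \<and> (\<omega> \<longlongrightarrow> 0) (at_right 0) \<and>
     (\<forall>e\<ge>0. \<forall>t. \<bar>blinfun_apply \<phi> (m {t..t+e})\<bar> \<le> \<omega> e)}"

definition mshift :: "real \<Rightarrow> (real set \<Rightarrow> 'h) \<Rightarrow> real set \<Rightarrow> 'h" where
  "mshift h m = (\<lambda>A. m ((+) h ` A))"

text \<open>
  The integral of a dual-space-valued function of compact support against a vector measure:
  the obvious sum for simple functions, extended by uniform limits of simple functions with a
  common bounded support. Lemma \<open>vm_integral_well_defined\<close> below shows that it is
  well defined for continuous integrands.
\<close>

definition simple_vm_integral ::
    "(real \<Rightarrow> 'h::real_normed_vector \<Rightarrow>\<^sub>L real) \<Rightarrow> (real set \<Rightarrow> 'h) \<Rightarrow> real" where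
  "simple_vm_integral f m = (\<Sum>y\<in>range f - {0}. blinfun_apply y (m {s. f s = y}))"

definition simple_approx ::
    "(nat \<Rightarrow> real \<Rightarrow> 'h::real_normed_vector \<Rightarrow>\<^sub>L real) \<Rightarrow> (real \<Rightarrow> 'h \<Rightarrow>\<^sub>L real) \<Rightarrow> bool" where
  "simple_approx f \<psi> \<longleftrightarrow>
     (\<forall>n. simple_function borel (f n)) \<and> (\<exists>R. \<forall>n s. R < \<bar>s\<bar> \<longrightarrow> f n s = 0) \<and>
     uniform_limit UNIV f \<psi> sequentially"

definition vm_integral ::
    "(real \<Rightarrow> 'h::real_normed_vector \<Rightarrow>\<^sub>L real) \<Rightarrow> (real set \<Rightarrow> 'h) \<Rightarrow> real" where
  "vm_integral \<psi> m =
     (THE J. \<forall>f. simple_approx f \<psi> \<longrightarrow> (\<lambda>n. simple_vm_integral (f n) m) \<longlonglongrightarrow> J)"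

definition Cc :: "(real \<Rightarrow> 'h::real_normed_vector \<Rightarrow>\<^sub>L real) set" where
  "Cc = {\<psi>. continuous_on UNIV \<psi> \<and> compact (closure {s. \<psi> s \<noteq> 0})}"

lemma Mloc_sums:
  assumes "m \<in> Mloc I" "range F \<subseteq> sets borel" "disjoint_family F"
    and "bounded (\<Union>i::nat. F i)" "(\<Union>i. F i) \<subseteq> I"
  shows "(\<lambda>i. m (F i)) sums m (\<Union>i. F i)"
  using assms unfolding Mloc_def by blast

lemma Mloc_empty:
  assumes "m \<in> Mloc I"
  shows "m {} = 0"
proof -
  have "(\<lambda>i::nat. m {}) sums m {}"
    using Mloc_sums[OF assms, of "\<lambda>_::nat. {}"] by (simp add: disjoint_family_on_def)
  then show ?thesis
    by (auto dest!: sums_summable simp: summable_const_iff)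
qed

lemma Mloc_Un:
  assumes m: "m \<in> Mloc I"
    and "A \<in> sets borel" "B \<in> sets borel" "bounded A" "bounded B" "A \<subseteq> I" "B \<subseteq> I" "A \<inter> B = {}"
  shows "m (A \<union> B) = m A + m B"
proof -
  define F where "F = (\<lambda>i::nat. if i = 0 then A else if i = 1 then B else {})"
  have U: "(\<Union>i. F i) = A \<union> B"
    unfolding F_def by (auto split: if_splits)
  have "disjoint_family F" "range F \<subseteq> sets borel"
    using assms by (auto simp: F_def disjoint_family_on_def)
  then have "(\<lambda>i. m (F i)) sums m (\<Union>i. F i)"
    using assms U by (intro Mloc_sums[OF m]) auto
  moreover have "(\<lambda>i. m (F i)) sums (\<Sum>i\<in>{0,1}. m (F i))"
    by (rule sums_finite) (auto simp: F_def Mloc_empty[OF m])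
  ultimately have "m (\<Union>i. F i) = (\<Sum>i\<in>{0,1}. m (F i))"
    by (rule sums_unique2)
  then show ?thesis
    unfolding U by (simp add: F_def)
qed

lemma Mloc_UN:
  assumes m: "m \<in> Mloc I" and "finite S"
    and "\<And>i. i \<in> S \<Longrightarrow> A i \<in> sets borel \<and> bounded (A i) \<and> A i \<subseteq> I"
    and "disjoint_family_on A S"
  shows "m (\<Union>i\<in>S. A i) = (\<Sum>i\<in>S. m (A i))"
  using assms(2,3,4)
proof (induction S rule: finite_induct)
  case empty
  then show ?case by (simp add: Mloc_empty[OF m])
next
  case (insert x S)
  have "m (A x \<union> (\<Union>i\<in>S. A i)) = m (A x) + m (\<Union>i\<in>S. A i)"
  proof (rule Mloc_Un[OF m])
    show "A x \<inter> (\<Union>i\<in>S. A i) = {}"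
      using insert.prems(2) insert.hyps by (fastforce simp: disjoint_family_on_def)
    show "(\<Union>i\<in>S. A i) \<in> sets borel"
      using insert by (intro sets.finite_UN) auto
  qed (use insert in auto)
  also have "m (\<Union>i\<in>S. A i) = (\<Sum>i\<in>S. m (A i))"
    using insert by (auto simp: disjoint_family_on_def)
  finally show ?case using insert.hyps by simp
qed

lemma sum_norm_le_total_variation:
  assumes "m {} = 0" "finite S" "disjoint_family_on A S"
    and "\<And>i. i \<in> S \<Longrightarrow> A i \<in> sets borel \<and> A i \<subseteq> K"
  shows "(\<Sum>i\<in>S. ennreal (norm (m (A i)))) \<le> total_variation m K"
proof -
  have "(\<Sum>i\<in>S. ennreal (norm (m (A i)))) = (\<Sum>B\<in>A ` S. ennreal (norm (m B)))"
  proof (subst sum.reindex_nontrivial)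
    fix x y assume "x \<in> S" "y \<in> S" "x \<noteq> y" "A x = A y"
    then have "A x = {}" using assms(3) by (auto simp: disjoint_family_on_def)
    then show "ennreal (norm (m (A x))) = 0" using assms(1) by simp
  qed (use assms in auto)
  also have "\<dots> \<le> total_variation m K"
    unfolding total_variation_def
    by (rule SUP_upper) (use assms in \<open>auto simp: disjoint_family_on_disjoint_image\<close>)
  finally show ?thesis .
qed

lemma simple_vm_integral_diff_le:
  assumes m: "m \<in> Mloc UNIV"
    and f: "simple_function borel f" "\<And>s. R < \<bar>s\<bar> \<Longrightarrow> f s = 0"
    and g: "simple_function borel g" "\<And>s. R < \<bar>s\<bar> \<Longrightarrow> g s = 0"
    and d: "\<And>s. norm (f s - g s) \<le> d"
  shows "\<bar>simple_vm_integral f m - simple_vm_integral g m\<bar>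
           \<le> d * enn2real (total_variation m {-R..R})"
proof -
  define K where "K = {-R..R}"
  define A where "A = (\<lambda>(y, z). {s. f s = y} \<inter> {s. g s = z} \<inter> K)"
  let ?F = "range f" and ?G = "range g"
  have fin: "finite ?F" "finite ?G"
    using f g by (auto simp: simple_function_def)
  have bf: "{s. f s = y} \<in> sets borel" for y
    using simple_functionD(2)[OF f(1), of "{y}"] by (simp add: vimage_def)
  have bg: "{s. g s = y} \<in> sets borel" for y
    using simple_functionD(2)[OF g(1), of "{y}"] by (simp add: vimage_def)
  have K: "K \<in> sets borel" "bounded K" unfolding K_def by auto
  have A: "A p \<in> sets borel \<and> bounded (A p) \<and> A p \<subseteq> K" for p
    using bf bg K unfolding A_def by (auto split: prod.splits intro: bounded_subset)
  have m0: "m {} = 0" by (rule Mloc_empty[OF m])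
  have eqf: "simple_vm_integral f m = (\<Sum>y\<in>?F. \<Sum>z\<in>?G. blinfun_apply y (m (A (y, z))))"
  proof -
    have "simple_vm_integral f m = (\<Sum>y\<in>?F - {0}. blinfun_apply y (m ({s. f s = y} \<inter> K)))"
      unfolding simple_vm_integral_def
    proof (rule sum.cong[OF refl])
      fix y assume "y \<in> ?F - {0}"
      then have "\<not> R < \<bar>s\<bar>" if "f s = y" for s
        using f(2)[of s] that by auto
      then have "{s. f s = y} \<inter> K = {s. f s = y}"
        unfolding K_def by force
      then show "blinfun_apply y (m {s. f s = y}) = blinfun_apply y (m ({s. f s = y} \<inter> K))"
        by simp
    qed
    also have "\<dots> = (\<Sum>y\<in>?F. blinfun_apply y (m ({s. f s = y} \<inter> K)))"
      by (rule sum.mono_neutral_left) (use fin in auto)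
    also have "\<dots> = (\<Sum>y\<in>?F. \<Sum>z\<in>?G. blinfun_apply y (m (A (y, z))))"
    proof (rule sum.cong[OF refl])
      fix y
      have "m ({s. f s = y} \<inter> K) = m (\<Union>z\<in>?G. A (y, z))"
        by (rule arg_cong[where f = m]) (auto simp: A_def)
      also have "\<dots> = (\<Sum>z\<in>?G. m (A (y, z)))"
        by (rule Mloc_UN[OF m]) (use fin A in \<open>auto simp: disjoint_family_on_def\<close>, auto simp: A_def)
      finally show "blinfun_apply y (m ({s. f s = y} \<inter> K)) = (\<Sum>z\<in>?G. blinfun_apply y (m (A (y, z))))"
        by (simp add: blinfun.sum_right)
    qed
    finally show ?thesis .
  qed
  have eqg: "simple_vm_integral g m = (\<Sum>y\<in>?F. \<Sum>z\<in>?G. blinfun_apply z (m (A (y, z))))"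
  proof -
    have "simple_vm_integral g m = (\<Sum>z\<in>?G - {0}. blinfun_apply z (m ({s. g s = z} \<inter> K)))"
      unfolding simple_vm_integral_def
    proof (rule sum.cong[OF refl])
      fix y assume "y \<in> ?G - {0}"
      then have "\<not> R < \<bar>s\<bar>" if "g s = y" for s
        using g(2)[of s] that by auto
      then have "{s. g s = y} \<inter> K = {s. g s = y}"
        unfolding K_def by force
      then show "blinfun_apply y (m {s. g s = y}) = blinfun_apply y (m ({s. g s = y} \<inter> K))"
        by simp
    qed
    also have "\<dots> = (\<Sum>z\<in>?G. blinfun_apply z (m ({s. g s = z} \<inter> K)))"
      by (rule sum.mono_neutral_left) (use fin in auto)
    also have "\<dots> = (\<Sum>z\<in>?G. \<Sum>y\<in>?F. blinfun_apply z (m (A (y, z))))"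
    proof (rule sum.cong[OF refl])
      fix z
      have "m ({s. g s = z} \<inter> K) = m (\<Union>y\<in>?F. A (y, z))"
        by (rule arg_cong[where f = m]) (auto simp: A_def)
      also have "\<dots> = (\<Sum>y\<in>?F. m (A (y, z)))"
        by (rule Mloc_UN[OF m]) (use fin A in \<open>auto simp: disjoint_family_on_def\<close>, auto simp: A_def)
      finally show "blinfun_apply z (m ({s. g s = z} \<inter> K)) = (\<Sum>y\<in>?F. blinfun_apply z (m (A (y, z))))"
        by (simp add: blinfun.sum_right)
    qed
    finally show ?thesis by (simp add: sum.swap[of _ ?F ?G])
  qed
  have "simple_vm_integral f m - simple_vm_integral g m
      = (\<Sum>p\<in>?F\<times>?G. blinfun_apply (fst p - snd p) (m (A p)))"
    unfolding eqf eqg by (simp add: sum_subtractf[symmetric] sum.cartesian_product blinfun.diff_left split_beta)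
  also have "\<bar>\<dots>\<bar> \<le> (\<Sum>p\<in>?F\<times>?G. d * norm (m (A p)))"
  proof (rule order_trans[OF sum_abs], rule sum_mono)
    fix p assume "p \<in> ?F \<times> ?G"
    show "\<bar>blinfun_apply (fst p - snd p) (m (A p))\<bar> \<le> d * norm (m (A p))"
    proof (cases "A p = {}")
      case False
      then obtain s where "f s = fst p" "g s = snd p" by (auto simp: A_def split: prod.splits)
      then have "norm (fst p - snd p) \<le> d" using d[of s] by simp
      then have "norm (fst p - snd p) * norm (m (A p)) \<le> d * norm (m (A p))"
        by (rule mult_right_mono) simp
      then show ?thesis
        using norm_blinfun[of "fst p - snd p" "m (A p)"] by simp
    qed (simp add: m0)
  qed
  also have "\<dots> = d * (\<Sum>p\<in>?F\<times>?G. norm (m (A p)))" by (simp add: sum_distrib_left)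
  also have "\<dots> \<le> d * enn2real (total_variation m K)"
  proof (rule mult_left_mono)
    have "(\<Sum>p\<in>?F\<times>?G. ennreal (norm (m (A p)))) \<le> total_variation m K"
      by (rule sum_norm_le_total_variation)
        (use fin A m0 in \<open>auto simp: disjoint_family_on_def\<close>, auto simp: A_def)
    then have "ennreal (\<Sum>p\<in>?F\<times>?G. norm (m (A p))) \<le> total_variation m K"
      by simp
    moreover have "total_variation m K < \<infinity>"
    proof -
      have "\<forall>a b. total_variation m ({a..b} \<inter> UNIV) < \<infinity>"
        using m unfolding Mloc_def by blast
      then show ?thesis unfolding K_def by simp
    qed
    ultimately show "(\<Sum>p\<in>?F\<times>?G. norm (m (A p))) \<le> enn2real (total_variation m K)"
      using enn2real_mono[of "ennreal (\<Sum>p\<in>?F\<times>?G. norm (m (A p)))" "total_variation m K"]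
      by (simp add: sum_nonneg)
    show "0 \<le> d" using d[of 0] norm_ge_zero order_trans by blast
  qed
  finally show ?thesis unfolding K_def .
qed

lemma simple_approx_exists:
  assumes "\<psi> \<in> Cc"
  shows "\<exists>f. simple_approx f \<psi>"
proof -
  obtain R where R: "\<And>s. R < \<bar>s\<bar> \<Longrightarrow> \<psi> s = 0"
  proof -
    have "bounded {s. \<psi> s \<noteq> 0}"
      using assms compact_imp_bounded bounded_subset closure_subset unfolding Cc_def by blast
    then obtain R where "\<forall>s\<in>{s. \<psi> s \<noteq> 0}. \<bar>s\<bar> \<le> R" by (auto simp: bounded_iff)
    then show thesis using that[of R] by force
  qed
  define K where "K = {-\<bar>R\<bar>-1..\<bar>R\<bar>+1}"
  define q :: "nat \<Rightarrow> real \<Rightarrow> real" where "q n s = of_int \<lfloor>s * real (Suc n)\<rfloor> / real (Suc n)" for n s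
  define f where "f n s = (if \<bar>s\<bar> \<le> \<bar>R\<bar> then \<psi> (q n s) else 0)" for n s
  have q: "q n s \<le> s" "s < q n s + 1 / real (Suc n)" for n s
    unfolding q_def by (simp_all add: field_simps) linarith+
  have uc: "uniformly_continuous_on K \<psi>"
    using assms unfolding Cc_def K_def
    by (auto intro!: compact_uniformly_continuous intro: continuous_on_subset)
  have dist_q: "\<bar>q n s - s\<bar> \<le> 1 / real (Suc n)" for n s
    using q[where n = n and s = s] by linarith
  have K1: "s \<in> K" "q n s \<in> K" if "\<bar>s\<bar> \<le> \<bar>R\<bar>" for n s
  proof -
    have "1 / real (Suc n) \<le> 1" by simp
    then have "\<bar>q n s - s\<bar> \<le> 1" using dist_q[of n s] by linarith
    then show "s \<in> K" "q n s \<in> K"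
      using that unfolding K_def atLeastAtMost_iff by linarith+
  qed
  have "simple_function borel (f n)" for n
  proof -
    have "range (f n) \<subseteq> insert 0 ((\<lambda>k. \<psi> (of_int k / real (Suc n))) `
        {\<lfloor>- \<bar>R\<bar> * real (Suc n)\<rfloor> .. \<lfloor>\<bar>R\<bar> * real (Suc n)\<rfloor>})" (is "_ \<subseteq> insert 0 (?h ` ?S)")
    proof (clarify)
      fix s assume "f n s \<notin> ?h ` ?S"
      moreover have "\<lfloor>s * real (Suc n)\<rfloor> \<in> ?S" if "\<bar>s\<bar> \<le> \<bar>R\<bar>"
      proof -
        have "- \<bar>R\<bar> \<le> s" "s \<le> \<bar>R\<bar>" using that by auto
        then show ?thesis
          unfolding atLeastAtMost_iff by (intro conjI floor_mono mult_right_mono) auto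
      qed
      ultimately show "f n s = 0" unfolding f_def q_def by auto
    qed
    then have "finite (range (f n))" by (rule finite_subset) simp
    moreover have "f n -` {y} \<in> sets borel" for y
    proof -
      have eq: "f n -` {y} = ({s. \<bar>s\<bar> \<le> \<bar>R\<bar>} \<inter> (\<lambda>s. \<lfloor>s * real (Suc n)\<rfloor>) -` {k. \<psi> (of_int k / real (Suc n)) = y})
          \<union> (if y = 0 then {s. \<not> \<bar>s\<bar> \<le> \<bar>R\<bar>} else {})"
        by (auto simp: f_def q_def split: if_splits)
      have "(\<lambda>s::real. \<lfloor>s * real (Suc n)\<rfloor>) \<in> borel \<rightarrow>\<^sub>M count_space UNIV" by measurable
      then have "(\<lambda>s::real. \<lfloor>s * real (Suc n)\<rfloor>) -` S \<in> sets borel" for S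
        using measurable_sets[of "\<lambda>s::real. \<lfloor>s * real (Suc n)\<rfloor>" borel "count_space UNIV" S] by simp
      then show ?thesis unfolding eq by (intro sets.Un sets.Int) auto
    qed
    ultimately show ?thesis unfolding simple_function_def by simp
  qed
  moreover have "\<forall>n s. \<bar>R\<bar> < \<bar>s\<bar> \<longrightarrow> f n s = 0" by (auto simp: f_def)
  moreover have "uniform_limit UNIV f \<psi> sequentially"
  proof (rule uniform_limitI)
    fix e :: real assume "e > 0"
    then obtain \<delta> where \<delta>: "\<delta> > 0"
        "\<And>x y. x \<in> K \<Longrightarrow> y \<in> K \<Longrightarrow> dist y x < \<delta> \<Longrightarrow> dist (\<psi> y) (\<psi> x) < e"
      using uc unfolding uniformly_continuous_on_def by metis
    have "\<forall>\<^sub>F n in sequentially. 1 / real (Suc n) < \<delta>"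
      using \<delta>(1) LIMSEQ_inverse_real_of_nat
      by (auto simp: inverse_eq_divide intro: order_tendstoD(2))
    then show "\<forall>\<^sub>F n in sequentially. \<forall>s\<in>UNIV. dist (f n s) (\<psi> s) < e"
    proof eventually_elim
      case (elim n)
      show ?case
      proof
        fix s
        show "dist (f n s) (\<psi> s) < e"
        proof (cases "\<bar>s\<bar> \<le> \<bar>R\<bar>")
          case True
          then show ?thesis
            using \<delta>(2)[OF K1(1)[OF True] K1(2)[OF True, of n]] dist_q[of n s] elim
            by (simp add: f_def dist_real_def)
        next
          case False
          then show ?thesis using R[of s] \<open>e > 0\<close> by (simp add: f_def)
        qed
      qed
    qed
  qed
  ultimately show ?thesis unfolding simple_approx_def by blast
qed

lemma vm_integral_well_defined:
  assumes m: "m \<in> Mloc UNIV" and \<psi>: "\<psi> \<in> Cc" and f: "simple_approx f \<psi>"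
  shows "(\<lambda>n. simple_vm_integral (f n) m) \<longlonglongrightarrow> vm_integral \<psi> m"
proof -
  have close: "\<exists>N. \<forall>n\<ge>N. \<forall>k\<ge>N. \<bar>simple_vm_integral (f n) m - simple_vm_integral (g k) m\<bar> < e"
    if f: "simple_approx f \<psi>" and g: "simple_approx g \<psi>" and "e > 0" for f g e
  proof -
    obtain R1 R2 where "\<And>n s. R1 < \<bar>s\<bar> \<Longrightarrow> f n s = 0" "\<And>n s. R2 < \<bar>s\<bar> \<Longrightarrow> g n s = 0"
      using f g unfolding simple_approx_def by blast
    then have R: "max R1 R2 < \<bar>s\<bar> \<Longrightarrow> f n s = 0" "max R1 R2 < \<bar>s\<bar> \<Longrightarrow> g n s = 0" for n s
      by auto
    define V where "V = enn2real (total_variation m {-max R1 R2..max R1 R2})"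
    have V: "V \<ge> 0" unfolding V_def by simp
    define d where "d = e / (2 * (V + 1))"
    have d: "d > 0" using V \<open>e > 0\<close> by (simp add: d_def)
    obtain N1 N2 where N: "\<And>n s. n \<ge> N1 \<Longrightarrow> dist (f n s) (\<psi> s) < d"
        "\<And>n s. n \<ge> N2 \<Longrightarrow> dist (g n s) (\<psi> s) < d"
      using f g d unfolding simple_approx_def uniform_limit_iff eventually_sequentially by (metis UNIV_I)
    have "\<bar>simple_vm_integral (f n) m - simple_vm_integral (g k) m\<bar> < e"
      if "n \<ge> max N1 N2" "k \<ge> max N1 N2" for n k
    proof -
      have "norm (f n s - g k s) \<le> 2 * d" for s
        using N(1)[of n s] N(2)[of k s] that dist_triangle2[of "f n s" "g k s" "\<psi> s"]
        by (simp add: dist_norm)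
      then have "\<bar>simple_vm_integral (f n) m - simple_vm_integral (g k) m\<bar> \<le> 2 * d * V"
        unfolding V_def
        using f g R by (intro simple_vm_integral_diff_le[OF m]) (auto simp: simple_approx_def)
      also have "\<dots> = e * (V / (V + 1))" using V by (simp add: d_def field_simps)
      also have "\<dots> < e" using V \<open>e > 0\<close> by (simp add: field_simps)
      finally show ?thesis .
    qed
    then show ?thesis by blast
  qed
  have "Cauchy (\<lambda>n. simple_vm_integral (f n) m)"
    unfolding Cauchy_def dist_real_def using close[OF f f] by blast
  then obtain J where J: "(\<lambda>n. simple_vm_integral (f n) m) \<longlonglongrightarrow> J"
    using Cauchy_convergent convergent_def by blast
  have all: "(\<lambda>n. simple_vm_integral (g n) m) \<longlonglongrightarrow> J" if g: "simple_approx g \<psi>" for g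
  proof -
    have "(\<lambda>n. simple_vm_integral (g n) m - simple_vm_integral (f n) m) \<longlonglongrightarrow> 0"
      unfolding lim_sequentially dist_real_def using close[OF g f] by (metis diff_zero)
    from tendsto_add[OF this J] show ?thesis by simp
  qed
  have "vm_integral \<psi> m = J"
    unfolding vm_integral_def
    by (rule the_equality) (use all f J LIMSEQ_unique in blast)+
  with J show ?thesis by simp
qed

definition Mloc_wstar :: "(real set \<Rightarrow> 'h::real_normed_vector) topology" where
  "Mloc_wstar = initial_topology (Mloc UNIV) (vm_integral ` Cc)"

definition mhull :: "(real set \<Rightarrow> 'h::real_normed_vector) \<Rightarrow> (real set \<Rightarrow> 'h) set" where
  "mhull m = Mloc_wstar closure_of (range (\<lambda>h. mshift h m))"

abbreviation hull_top :: "(real set \<Rightarrow> 'h::real_normed_vector) \<Rightarrow> (real set \<Rightarrow> 'h) topology" where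
  "hull_top m \<equiv> subtopology Mloc_wstar (mhull m)"

definition strong_loc_precompact :: "(real set \<Rightarrow> 'h::real_normed_vector) set \<Rightarrow> bool" where
  "strong_loc_precompact S \<longleftrightarrow>
     (\<forall>a b. a \<le> b \<longrightarrow>
        Metric_space.mtotally_bounded (Mfin {a..b}) (Mfin_dist {a..b}) (mrestrict {a..b} ` S))"

lemma total_variation_triangle:
  "total_variation (\<lambda>A. m1 A - m3 A) I
     \<le> total_variation (\<lambda>A. m1 A - m2 A) I + total_variation (\<lambda>A. m2 A - m3 A) I"
proof (subst total_variation_def, rule SUP_least)
  fix P :: "real set set"
  assume P: "P \<in> {P. finite P \<and> disjoint P \<and> (\<forall>B\<in>P. B \<in> sets borel \<and> B \<subseteq> I)}"
  have "(\<Sum>B\<in>P. ennreal (norm (m1 B - m3 B)))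
      \<le> (\<Sum>B\<in>P. ennreal (norm (m1 B - m2 B)) + ennreal (norm (m2 B - m3 B)))"
  proof (rule sum_mono)
    fix B
    have "norm (m1 B - m3 B) \<le> norm (m1 B - m2 B) + norm (m2 B - m3 B)"
      using dist_triangle[of "m1 B" "m3 B" "m2 B"] by (simp add: dist_norm)
    then show "ennreal (norm (m1 B - m3 B)) \<le> ennreal (norm (m1 B - m2 B)) + ennreal (norm (m2 B - m3 B))"
      by (simp add: ennreal_plus[symmetric] del: ennreal_plus)
  qed
  also have "\<dots> = (\<Sum>B\<in>P. ennreal (norm (m1 B - m2 B))) + (\<Sum>B\<in>P. ennreal (norm (m2 B - m3 B)))"
    by (rule sum.distrib)
  also have "\<dots> \<le> total_variation (\<lambda>A. m1 A - m2 A) I + total_variation (\<lambda>A. m2 A - m3 A) I"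
    unfolding total_variation_def by (intro add_mono SUP_upper P)
  finally show "(\<Sum>B\<in>P. ennreal (norm (m1 B - m3 B)))
      \<le> total_variation (\<lambda>A. m1 A - m2 A) I + total_variation (\<lambda>A. m2 A - m3 A) I" .
qed

lemma total_variation_commute:
  "total_variation (\<lambda>A. m1 A - m2 A) I = total_variation (\<lambda>A. m2 A - m1 A) I"
  unfolding total_variation_def by (simp add: norm_minus_commute)

lemma total_variation_diff_le:
  "total_variation (\<lambda>A. m1 A - m2 A) I \<le> total_variation m1 I + total_variation m2 I"
  using total_variation_triangle[of m1 m2 I "\<lambda>_. 0"] total_variation_commute[of "\<lambda>_. 0" m2 I]
  by simp

lemma total_variation_zero: "total_variation (\<lambda>A. 0) I = 0"
  unfolding total_variation_def by (intro antisym SUP_least) auto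

lemma total_variation_diff_eq_0D:
  assumes "total_variation (\<lambda>A. m1 A - m2 A) I = 0" "B \<in> sets borel" "B \<subseteq> I"
  shows "m1 B = m2 B"
proof -
  have "(\<Sum>B\<in>{B}. ennreal (norm (m1 B - m2 B))) \<le> total_variation (\<lambda>A. m1 A - m2 A) I"
    unfolding total_variation_def by (rule SUP_upper) (use assms in auto)
  then show ?thesis using assms(1) by simp
qed

lemma Mb_norm_triangle:
  "Mb_norm I (\<lambda>A. m1 A - m3 A) \<le> Mb_norm I (\<lambda>A. m1 A - m2 A) + Mb_norm I (\<lambda>A. m2 A - m3 A)"
  unfolding Mb_norm_def
proof (rule SUP_least)
  fix t
  show "total_variation (\<lambda>A. m1 A - m3 A) ({t..t+1} \<inter> I)
      \<le> (SUP t. total_variation (\<lambda>A. m1 A - m2 A) ({t..t+1} \<inter> I))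
        + (SUP t. total_variation (\<lambda>A. m2 A - m3 A) ({t..t+1} \<inter> I))"
    by (rule order_trans[OF total_variation_triangle[of _ _ _ m2]]) (intro add_mono SUP_upper UNIV_I)
qed

lemma Mb_norm_diff_le: "Mb_norm I (\<lambda>A. m1 A - m2 A) \<le> Mb_norm I m1 + Mb_norm I m2"
  unfolding Mb_norm_def
proof (rule SUP_least)
  fix t
  show "total_variation (\<lambda>A. m1 A - m2 A) ({t..t+1} \<inter> I)
      \<le> (SUP t. total_variation m1 ({t..t+1} \<inter> I)) + (SUP t. total_variation m2 ({t..t+1} \<inter> I))"
    by (rule order_trans[OF total_variation_diff_le]) (intro add_mono SUP_upper UNIV_I)
qed

lemma Mloc_eqI:
  assumes m: "m1 \<in> Mloc I" "m2 \<in> Mloc I" and I: "I \<in> sets borel"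
    and eq: "\<And>t B. B \<in> sets borel \<Longrightarrow> B \<subseteq> {t..t+1} \<inter> I \<Longrightarrow> m1 B = m2 B"
  shows "m1 = m2"
proof
  fix A
  show "m1 A = m2 A"
  proof (cases "A \<in> sets borel \<and> bounded A \<and> A \<subseteq> I")
    case True
    define P where "P k = A \<inter> {of_int k..<of_int k + 1}" for k :: int
    obtain R where R: "\<And>x. x \<in> A \<Longrightarrow> \<bar>x\<bar> \<le> R"
      using True by (auto simp: bounded_iff)
    let ?S = "{\<lfloor>-R\<rfloor>..\<lfloor>R\<rfloor>}"
    have "A = (\<Union>k\<in>?S. P k)"
    proof (intro equalityI subsetI)
      fix x assume "x \<in> A"
      moreover have "\<lfloor>x\<rfloor> \<in> ?S" using R[OF \<open>x \<in> A\<close>] by (auto intro!: floor_mono)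
      ultimately show "x \<in> (\<Union>k\<in>?S. P k)" unfolding P_def by (intro UN_I[of "\<lfloor>x\<rfloor>"]) auto
    qed (auto simp: P_def)
    moreover have "P k \<in> sets borel \<and> bounded (P k) \<and> P k \<subseteq> I" for k
      using True by (auto simp: P_def intro: bounded_subset)
    moreover have "disjoint_family_on P ?S"
    proof -
      have "k = \<lfloor>x\<rfloor>" if "x \<in> P k" for x k
        using that by (auto simp: P_def intro!: floor_unique[symmetric])
      then show ?thesis unfolding disjoint_family_on_def by blast
    qed
    moreover have "m1 (P k) = m2 (P k)" for k
      by (rule eq[of _ "of_int k"]) (use True in \<open>auto simp: P_def\<close>)
    ultimately show ?thesis
      using Mloc_UN[OF m(1), of ?S P] Mloc_UN[OF m(2), of ?S P] by simp
  next
    case False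
    then show ?thesis using m unfolding Mloc_def by simp
  qed
qed

lemma Metric_space_Mfin:
  assumes I: "I \<in> sets borel"
  shows "Metric_space (Mfin I :: (real set \<Rightarrow> 'h::real_normed_vector) set) (Mfin_dist I)"
proof
  have fin: "total_variation (\<lambda>A. x A - y A) I < \<infinity>" if "x \<in> Mfin I" "y \<in> Mfin I"
    for x y :: "real set \<Rightarrow> 'h"
    using that by (intro le_less_trans[OF total_variation_diff_le]) (auto simp: Mfin_def)
  show "0 \<le> Mfin_dist I x y" for x y :: "real set \<Rightarrow> 'h"
    unfolding Mfin_dist_def by simp
  show "Mfin_dist I x y = Mfin_dist I y x" for x y :: "real set \<Rightarrow> 'h"
    unfolding Mfin_dist_def by (subst total_variation_commute) simp
  fix x y :: "real set \<Rightarrow> 'h" assume xy: "x \<in> Mfin I" "y \<in> Mfin I"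
  show "Mfin_dist I x y = 0 \<longleftrightarrow> x = y"
  proof
    assume "Mfin_dist I x y = 0"
    then have "total_variation (\<lambda>A. x A - y A) I = 0"
      using fin[OF xy] unfolding Mfin_dist_def by (auto simp: enn2real_eq_0_iff)
    then show "x = y"
      using xy by (intro Mloc_eqI[OF _ _ I]) (auto simp: Mfin_def intro: total_variation_diff_eq_0D)
  qed (simp add: Mfin_dist_def total_variation_zero)
  fix z :: "real set \<Rightarrow> 'h" assume z: "z \<in> Mfin I"
  show "Mfin_dist I x z \<le> Mfin_dist I x y + Mfin_dist I y z"
    using fin[OF xy] fin[OF xy(2) z]
    unfolding Mfin_dist_def
    by (subst enn2real_plus[symmetric])
      (auto intro!: enn2real_mono total_variation_triangle simp: ennreal_add_less_top)
qed

lemma Metric_space_Mb: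
  assumes I: "I \<in> sets borel"
  shows "Metric_space (Mb I :: (real set \<Rightarrow> 'h::real_normed_vector) set) (Mb_dist I)"
proof
  have fin: "Mb_norm I (\<lambda>A. x A - y A) < \<infinity>" if "x \<in> Mb I" "y \<in> Mb I"
    for x y :: "real set \<Rightarrow> 'h"
    using that by (intro le_less_trans[OF Mb_norm_diff_le]) (auto simp: Mb_def)
  show "0 \<le> Mb_dist I x y" for x y :: "real set \<Rightarrow> 'h"
    unfolding Mb_dist_def by simp
  show "Mb_dist I x y = Mb_dist I y x" for x y :: "real set \<Rightarrow> 'h"
    unfolding Mb_dist_def Mb_norm_def by (subst total_variation_commute) simp
  fix x y :: "real set \<Rightarrow> 'h" assume xy: "x \<in> Mb I" "y \<in> Mb I"
  show "Mb_dist I x y = 0 \<longleftrightarrow> x = y"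
  proof
    assume "Mb_dist I x y = 0"
    then have "Mb_norm I (\<lambda>A. x A - y A) = 0"
      using fin[OF xy] unfolding Mb_dist_def by (auto simp: enn2real_eq_0_iff)
    then have "total_variation (\<lambda>A. x A - y A) ({t..t+1} \<inter> I) = 0" for t
      using SUP_upper[of t UNIV "\<lambda>t. total_variation (\<lambda>A. x A - y A) ({t..t+1} \<inter> I)"]
      unfolding Mb_norm_def by simp
    then show "x = y"
      using xy by (intro Mloc_eqI[OF _ _ I]) (auto simp: Mb_def intro: total_variation_diff_eq_0D)
  qed (simp add: Mb_dist_def Mb_norm_def total_variation_zero)
  fix z :: "real set \<Rightarrow> 'h" assume z: "z \<in> Mb I"
  show "Mb_dist I x z \<le> Mb_dist I x y + Mb_dist I y z"
    using fin[OF xy] fin[OF xy(2) z]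
    unfolding Mb_dist_def
    by (subst enn2real_plus[symmetric])
      (auto intro!: enn2real_mono Mb_norm_triangle simp: ennreal_add_less_top)
qed


section \<open>Entropy\<close>

text \<open>Meaningful for totally bounded \<open>K\<close>; the centres range over the whole space \<open>X\<close>.\<close>

definition covering_number :: "'a set \<Rightarrow> ('a \<Rightarrow> 'a \<Rightarrow> real) \<Rightarrow> real \<Rightarrow> 'a set \<Rightarrow> nat" where
  "covering_number X d e K =
     (LEAST n. \<exists>C. finite C \<and> C \<subseteq> X \<and> card C = n \<and> K \<subseteq> (\<Union>c\<in>C. Metric_space.mball X d c e))"

definition entropy :: "'a set \<Rightarrow> ('a \<Rightarrow> 'a \<Rightarrow> real) \<Rightarrow> real \<Rightarrow> 'a set \<Rightarrow> real" where
  "entropy X d e K = log 2 (real (covering_number X d e K))"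


section \<open>Processes and attractors\<close>

text \<open>\<open>V t \<tau>\<close> is the solution map from time \<open>\<tau>\<close> to time \<open>t\<close>; only \<open>\<tau> \<le> t\<close> is meaningful.\<close>

definition dynamical_process :: "(real \<Rightarrow> real \<Rightarrow> 'e \<Rightarrow> 'e) \<Rightarrow> bool" where
  "dynamical_process V \<longleftrightarrow>
     (\<forall>\<tau>. V \<tau> \<tau> = id) \<and> (\<forall>t r \<tau>. \<tau> \<le> r \<and> r \<le> t \<longrightarrow> V t \<tau> = V t r \<circ> V r \<tau>)"

definition translation_identity ::
    "((real set \<Rightarrow> 'h) \<Rightarrow> real \<Rightarrow> real \<Rightarrow> 'e \<Rightarrow> 'e) \<Rightarrow> (real set \<Rightarrow> 'h) set \<Rightarrow> bool" where
  "translation_identity U \<Sigma> \<longleftrightarrow>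
     (\<forall>\<nu>\<in>\<Sigma>. \<forall>h t \<tau>. \<tau> \<le> t \<longrightarrow> U \<nu> (t + h) (\<tau> + h) = U (mshift h \<nu>) t \<tau>)"

definition uniformly_absorbing ::
    "((real set \<Rightarrow> 'h) \<Rightarrow> real \<Rightarrow> real \<Rightarrow> 'e::real_normed_vector \<Rightarrow> 'e) \<Rightarrow> (real set \<Rightarrow> 'h) set \<Rightarrow>
      'e set \<Rightarrow> bool" where
  "uniformly_absorbing U \<Sigma> B \<longleftrightarrow>
     (\<forall>D. bounded D \<longrightarrow> (\<exists>T\<ge>0. \<forall>t\<ge>T. \<forall>\<nu>\<in>\<Sigma>. U \<nu> t 0 ` D \<subseteq> B))"

definition extended_semigroup ::
    "((real set \<Rightarrow> 'h) \<Rightarrow> real \<Rightarrow> real \<Rightarrow> 'e \<Rightarrow> 'e) \<Rightarrow> real \<Rightarrow> 'e \<times> (real set \<Rightarrow> 'h) \<Rightarrow>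
      'e \<times> (real set \<Rightarrow> 'h)" where
  "extended_semigroup U t = (\<lambda>(\<xi>, \<nu>). (U \<nu> t 0 \<xi>, mshift t \<nu>))"

definition strong_global_attractor ::
    "((real set \<Rightarrow> 'h::real_normed_vector) \<Rightarrow> real \<Rightarrow> real \<Rightarrow> 'e::real_normed_vector \<Rightarrow> 'e) \<Rightarrow>
      (real set \<Rightarrow> 'h) \<Rightarrow> ('e \<times> (real set \<Rightarrow> 'h)) set \<Rightarrow> bool" where
  "strong_global_attractor U \<mu> A \<longleftrightarrow>
     compactin (prod_topology euclidean (hull_top \<mu>)) A \<and>
     (\<forall>t\<ge>0. extended_semigroup U t ` A = A) \<and>
     (\<forall>D O'. D \<subseteq> UNIV \<times> mhull \<mu> \<and> bounded (fst ` D) \<and>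
        openin (prod_topology euclidean (hull_top \<mu>)) O' \<and> A \<subseteq> O' \<longrightarrow>
        (\<exists>T\<ge>0. \<forall>t\<ge>T. extended_semigroup U t ` D \<subseteq> O'))"

definition strong_uniform_attractor ::
    "((real set \<Rightarrow> 'h::real_normed_vector) \<Rightarrow> real \<Rightarrow> real \<Rightarrow> 'e::real_normed_vector \<Rightarrow> 'e) \<Rightarrow>
      (real set \<Rightarrow> 'h) \<Rightarrow> 'e set \<Rightarrow> bool" where
  "strong_uniform_attractor U \<mu> \<A> \<longleftrightarrow> (\<exists>A. strong_global_attractor U \<mu> A \<and> \<A> = fst ` A)"

end

theory Submission
  imports Defs
begin

text \<open>
  Bounded sets of uniformly non-atomic measures are weak-star compact: the distribution functions
  \<open>t \<mapsto> \<phi> (m {0<..t})\<close> are bounded and equicontinuous, and a limit of them is again the distribution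
  function of a measure because it is dominated by the increments of a limit of the variation
  functions. Hence the hull is compact, and so is a closed ball times the hull when the ball carries
  the weak topology. By weak continuity the intersection of the images of this set is a weakly
  compact, strictly invariant set.

  Partition the hull so that \<open>Pr \<epsilon> \<nu>\<close> on \<open>[0, n s]\<close> varies by at most \<open>2 \<epsilon>\<close> on each part. If a set of
  trajectories has diameter \<open>d\<close> at time \<open>k s\<close>, compactness of the embedding splits it into a number
  of pieces independent of \<open>d\<close>, on each of which the squeezing estimate gives diameter at most
  \<open>d / 8 + O(\<epsilon>)\<close> at time \<open>(k + 1) s\<close>. After \<open>n\<close> steps this yields both total boundedness in norm,
  which upgrades weak to strong compactness and attraction, and the entropy estimate with
  \<open>n \<approx> log 2 (2 R0 / \<epsilon>)\<close>.
\<close>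


section \<open>Functional analysis and weak topologies\<close>

text \<open>The evolution maps are continuous only for the weak topology, so invariance has to be
  obtained there, whereas compactness and attraction are demanded in norm. The bridge is that the
  image of \<open>Y\<close> under \<open>S q\<close> is weakly compact, hence weakly closed, hence
  closed in norm: norm cluster points of tails of trajectories cannot leave the weakly constructed
  attractor. Pieces are encoded as colourings of the initial data (\<xi>, \<nu>), not as subsets of
  the phase space. Equally coloured data are compared along their whole history, so the symbols are
  coloured once, on all of [0, n s], and equivariance of \<open>Pr\<close> carries this bound to
  every step. The covering number of the hull thus enters the count as a single factor; only the
  number P of pieces from the compact embedding is raised to the power n. For the hull, uniform
  non-atomicity lets values on half-open intervals pass to the limit, which weak-star convergence
  alone does not permit. Imposing all limit relations as closed conditions in a product of compact
  intervals gives compactness without subsequences.\<close>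

lemma norming_functional:
  fixes x0 :: "'a::real_normed_vector"
  shows "\<exists>\<phi> :: 'a \<Rightarrow>\<^sub>L real. norm \<phi> \<le> 1 \<and> blinfun_apply \<phi> x0 = norm x0"
proof -
  \<comment> \<open>Hahn-Banach with functionals represented by their graphs. Single-valuedness need
    not be imposed: in a subspace dominated by the norm, (0, a) and (0, -a) force a = 0, which is
    \<open>uniq\<close> below.\<close>
  define \<G> :: "('a \<times> real) set set" where
    "\<G> = {G. subspace G \<and> (\<forall>p\<in>G. snd p \<le> norm (fst p)) \<and> (x0, norm x0) \<in> G}"
  have "\<exists>G\<in>\<G>. \<forall>X\<in>\<G>. G \<subseteq> X \<longrightarrow> X = G"
  proof (rule subset_Zorn_nonempty)
    have "snd p \<le> norm (fst p)" if "p \<in> span {(x0, norm x0)}" for p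
      using that by (auto simp: span_singleton mult_right_mono)
    then have "span {(x0, norm x0)} \<in> \<G>"
      unfolding \<G>_def using subspace_span span_base by blast
    then show "\<G> \<noteq> {}" by blast
  next
    fix \<C> assume ne: "\<C> \<noteq> {}" and chain: "subset.chain \<G> \<C>"
    have "subspace (\<Union>\<C>)"
    proof (rule subspaceI)
      show "0 \<in> \<Union>\<C>"
        using ne chain subspace_0 by (fastforce simp: \<G>_def subset.chain_def)
    next
      fix x y assume "x \<in> \<Union>\<C>" "y \<in> \<Union>\<C>"
      then obtain X Y where XY: "X \<in> \<C>" "Y \<in> \<C>" "x \<in> X" "y \<in> Y" by blast
      then have "X \<subseteq> Y \<or> Y \<subseteq> X" using chain by (meson subset_chain_def)
      moreover have "subspace X" "subspace Y"
        using XY chain by (auto simp: \<G>_def subset.chain_def)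
      ultimately show "x + y \<in> \<Union>\<C>"
        using XY by (meson UnionI subsetD subspace_add)
    next
      fix c x assume "x \<in> \<Union>\<C>"
      then show "c *\<^sub>R x \<in> \<Union>\<C>"
        using chain by (auto simp: \<G>_def subset.chain_def intro: subspace_scale)
    qed
    then show "\<Union>\<C> \<in> \<G>"
      using ne chain by (auto simp: \<G>_def subset.chain_def)
  qed
  then obtain G where "G \<in> \<G>" and max: "\<And>X. X \<in> \<G> \<Longrightarrow> G \<subseteq> X \<Longrightarrow> X = G" by blast
  then have sub: "subspace G" and le: "\<And>x a. (x, a) \<in> G \<Longrightarrow> a \<le> norm x"
    and x0: "(x0, norm x0) \<in> G"
    by (auto simp: \<G>_def)
  have total: "\<exists>a. (z, a) \<in> G" for z
  proof -
    \<comment> \<open>Every lower bound for the value at z lies below every upper bound, so the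
      supremum \<open>c\<close> of the lower bounds is an admissible value.\<close>
    have key: "a - norm (x - z) \<le> norm (y + z) - b" if "(x, a) \<in> G" "(y, b) \<in> G" for x a y b
    proof -
      have "a + b \<le> norm (x + y)"
        using le[of "x + y" "a + b"] subspace_add[OF sub that] by simp
      also have "\<dots> = norm ((x - z) + (y + z))" by simp
      also have "\<dots> \<le> norm (x - z) + norm (y + z)" by (rule norm_triangle_ineq)
      finally show ?thesis by simp
    qed
    define c where "c = (SUP (x, a)\<in>G. a - norm (x - z))"
    have "bdd_above ((\<lambda>(x, a). a - norm (x - z)) ` G)"
      using key[OF _ x0] by (intro bdd_aboveI[of _ "norm (x0 + z) - norm x0"]) auto
    then have c1: "a - norm (x - z) \<le> c" if "(x, a) \<in> G" for x a
      unfolding c_def using that by (intro cSUP_upper2[where x = "(x, a)"]) auto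
    have c2: "c \<le> norm (y + z) - b" if "(y, b) \<in> G" for y b
      unfolding c_def using key[OF _ that] x0 by (intro cSUP_least) auto
    \<comment> \<open>Homogeneity reduces this to t = 1 and t = -1, which are \<open>c2\<close> and
      \<open>c1\<close> for the rescaled element of \<open>G\<close>.\<close>
    have dom: "a + t * c \<le> norm (x + t *\<^sub>R z)" if "(x, a) \<in> G" for x a t
    proof -
      consider "t = 0" | "t > 0" | "t < 0" by linarith
      then show ?thesis
      proof cases
        case 1
        then show ?thesis using le[OF that] by simp
      next
        case 2
        have "(x /\<^sub>R t, a / t) \<in> G"
          using subspace_scale[OF sub that, of "inverse t"] by (simp add: divide_inverse_commute)
        from c2[OF this] have "t * c \<le> t * (norm (x /\<^sub>R t + z) - a / t)"
          using 2 by (intro mult_left_mono) auto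
        also have "\<dots> = norm (t *\<^sub>R (x /\<^sub>R t + z)) - a"
          using 2 by (simp add: right_diff_distrib)
        also have "t *\<^sub>R (x /\<^sub>R t + z) = x + t *\<^sub>R z"
          using 2 by (simp add: scaleR_add_right)
        finally show ?thesis by simp
      next
        case 3
        have "(x /\<^sub>R (-t), a / (-t)) \<in> G"
          using subspace_scale[OF sub that, of "inverse (-t)"] by (simp add: divide_inverse_commute)
        from c1[OF this] have "(-t) * (a / (-t) - norm (x /\<^sub>R (-t) - z)) \<le> (-t) * c"
          using 3 by (intro mult_left_mono) auto
        then have "a - norm ((-t) *\<^sub>R (x /\<^sub>R (-t) - z)) \<le> (-t) * c"
          using 3 by (simp add: right_diff_distrib)
        moreover have "(-t) *\<^sub>R (x /\<^sub>R (-t) - z) = x + t *\<^sub>R z"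
          using 3 by (simp add: scaleR_diff_right)
        ultimately show ?thesis by (simp only:)
      qed
    qed
    define G' where "G' = {p + t *\<^sub>R (z, c) | p t. p \<in> G}"
    have "subspace G'"
    proof (rule subspaceI)
      show "0 \<in> G'"
        unfolding G'_def using subspace_0[OF sub] by (intro CollectI exI[of _ 0]) (simp add: zero_prod_def)
    next
      fix x y assume "x \<in> G'" "y \<in> G'"
      then obtain p t q u where "x = p + t *\<^sub>R (z, c)" "y = q + u *\<^sub>R (z, c)" "p \<in> G" "q \<in> G"
        unfolding G'_def by blast
      moreover from this have "x + y = (p + q) + (t + u) *\<^sub>R (z, c)"
        by (simp add: prod_eq_iff algebra_simps)
      ultimately show "x + y \<in> G'"
        unfolding G'_def using subspace_add[OF sub] by blast
    next
      fix k x assume "x \<in> G'"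
      then obtain p t where "x = p + t *\<^sub>R (z, c)" "p \<in> G"
        unfolding G'_def by blast
      moreover from this have "k *\<^sub>R x = k *\<^sub>R p + (k * t) *\<^sub>R (z, c)"
        by (simp add: prod_eq_iff algebra_simps)
      ultimately show "k *\<^sub>R x \<in> G'"
        unfolding G'_def using subspace_scale[OF sub] by blast
    qed
    moreover have "G \<subseteq> G'"
      unfolding G'_def by (force intro: exI[of _ 0])
    moreover have "snd q \<le> norm (fst q)" if "q \<in> G'" for q
      using that dom by (auto simp: G'_def)
    ultimately have "G' = G"
      using x0 by (intro max) (auto simp: \<G>_def)
    moreover have "(z, c) \<in> G'"
      unfolding G'_def using subspace_0[OF sub]
      by (intro CollectI exI[of _ 0] exI[of _ 1]) (simp add: zero_prod_def)
    ultimately show ?thesis by blast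
  qed
  have uniq: "a = b" if "(x, a) \<in> G" "(x, b) \<in> G" for x a b
    using le[of 0 "a - b"] le[of 0 "b - a"] subspace_diff[OF sub that] subspace_diff[OF sub that(2,1)]
    by simp
  define f where "f z = (THE a. (z, a) \<in> G)" for z
  have f: "(z, f z) \<in> G" for z
    unfolding f_def using total uniq by (metis (mono_tags, lifting) theI)
  have f_eq: "f z = a" if "(z, a) \<in> G" for z a
    using uniq[OF f that] .
  have bound: "\<bar>f z\<bar> \<le> norm z" for z
    using le[OF f[of z]] le[OF subspace_scale[OF sub f[of z], of "-1", simplified]]
    by (simp add: abs_le_iff)
  have "bounded_linear f"
  proof (rule bounded_linear_intro[of _ 1])
    show "f (x + y) = f x + f y" for x y
      using subspace_add[OF sub f[of x] f[of y]] by (intro f_eq) simp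
    show "f (r *\<^sub>R x) = r *\<^sub>R f x" for r x
      using subspace_scale[OF sub f[of x], of r] by (intro f_eq) simp
  qed (use bound in simp)
  then show ?thesis
    using bound f_eq[OF x0]
    by (intro exI[of _ "Blinfun f"])
      (auto simp: bounded_linear_Blinfun_apply intro!: norm_blinfun_bound)
qed

lemma norm_le_if_functionals_le:
  fixes x :: "'a::real_normed_vector"
  assumes "\<And>\<phi> :: 'a \<Rightarrow>\<^sub>L real. blinfun_apply \<phi> x \<le> c * norm \<phi>" and "0 \<le> c"
  shows "norm x \<le> c"
proof -
  obtain \<phi> :: "'a \<Rightarrow>\<^sub>L real" where \<phi>: "norm \<phi> \<le> 1" "blinfun_apply \<phi> x = norm x"
    using norming_functional by blast
  have "norm x \<le> c * norm \<phi>" using assms(1)[of \<phi>] \<phi> by simp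
  also have "\<dots> \<le> c" using mult_left_mono[OF \<phi>(1) assms(2)] by simp
  finally show ?thesis .
qed

lemma functionals_separate:
  fixes x y :: "'a::real_normed_vector"
  assumes "\<And>\<phi> :: 'a \<Rightarrow>\<^sub>L real. blinfun_apply \<phi> x = blinfun_apply \<phi> y"
  shows "x = y"
  using norm_le_if_functionals_le[of "x - y" 0] assms by (simp add: blinfun.diff_right)

section \<open>Initial topologies, the weak topology and weak compactness of balls\<close>

lemma topspace_initial_topology:
  assumes "F \<noteq> {}"
  shows "topspace (initial_topology X F) = X"
proof -
  obtain f where "f \<in> F" using assms by blast
  then have "X \<subseteq> \<Union>{{x \<in> X. f x \<in> V} |f V. f \<in> F \<and> open V}"
    by (intro subsetI UnionI[of X]) (auto intro!: exI[of _ f] exI[of _ UNIV])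
  then show ?thesis
    unfolding initial_topology_def by auto
qed

lemma continuous_map_initial_topology_functional:
  assumes "f \<in> F"
  shows "continuous_map (initial_topology X F) euclideanreal f"
proof -
  have ts: "topspace (initial_topology X F) = X"
    using assms by (intro topspace_initial_topology) auto
  show ?thesis
    unfolding continuous_map_def ts open_openin[symmetric]
    unfolding initial_topology_def using assms by (auto intro!: topology_generated_by_Basis)
qed

lemma continuous_map_into_initial_topology:
  assumes "F \<noteq> {}" "g ` topspace T \<subseteq> X"
    and "\<And>f. f \<in> F \<Longrightarrow> continuous_map T euclideanreal (\<lambda>x. f (g x))"
  shows "continuous_map T (initial_topology X F) g"
  unfolding initial_topology_def
proof (rule continuous_on_generated_topo)
  fix S assume "S \<in> {{x \<in> X. f x \<in> V} |f V. f \<in> F \<and> open V}"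
  then obtain f V where S: "S = {x \<in> X. f x \<in> V}" "f \<in> F" "open V" by blast
  have "g -` S \<inter> topspace T = {x \<in> topspace T. f (g x) \<in> V}"
    using assms(2) S by auto
  also have "openin T \<dots>"
    using assms(3)[OF S(2)] S(3) by (simp add: openin_continuous_map_preimage)
  finally show "openin T (g -` S \<inter> topspace T)" .
next
  show "g ` topspace T \<subseteq> \<Union>{{x \<in> X. f x \<in> V} |f V. f \<in> F \<and> open V}"
    using topspace_initial_topology[OF assms(1), of X] assms(2)
    unfolding initial_topology_def topology_generated_by_topspace by (simp only:)
qed

lemma Hausdorff_initial_topology:
  assumes "F \<noteq> {}" and "\<And>x y. x \<in> X \<Longrightarrow> y \<in> X \<Longrightarrow> (\<And>f. f \<in> F \<Longrightarrow> f x = f y) \<Longrightarrow> x = y"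
  shows "Hausdorff_space (initial_topology X F)"
  unfolding Hausdorff_space_def topspace_initial_topology[OF assms(1)]
proof (intro allI impI, elim conjE)
  fix x y assume xy: "x \<in> X" "y \<in> X" "x \<noteq> y"
  then obtain f where f: "f \<in> F" "f x \<noteq> f y" using assms(2) by blast
  then obtain V W where VW: "open V" "open W" "f x \<in> V" "f y \<in> W" "V \<inter> W = {}"
    using hausdorff[OF f(2)] by auto
  have "openin (initial_topology X F) {x \<in> X. f x \<in> U}" if "open U" for U
    unfolding initial_topology_def using f that by (intro topology_generated_by_Basis) blast
  then show "\<exists>U V. openin (initial_topology X F) U \<and> openin (initial_topology X F) V \<and>
      x \<in> U \<and> y \<in> V \<and> disjnt U V"
    using xy VW
    by (intro exI[of _ "{x \<in> X. f x \<in> V}"] exI[of _ "{x \<in> X. f x \<in> W}"]) (auto simp: disjnt_def)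
qed

lemma topspace_weak_topology [simp]: "topspace weak_topology = UNIV"
  unfolding weak_topology_def by (simp add: topspace_initial_topology)

lemma Hausdorff_weak_topology: "Hausdorff_space (weak_topology :: 'a::real_normed_vector topology)"
  unfolding weak_topology_def
  by (rule Hausdorff_initial_topology) (auto intro: functionals_separate)

lemma continuous_map_euclidean_weak_topology:
  "continuous_map euclidean (weak_topology :: 'a::real_normed_vector topology) (\<lambda>x. x)"
  unfolding weak_topology_def
  by (rule continuous_map_into_initial_topology)
    (auto simp: blinfun.continuous_on)

text \<open>Tychonoff's theorem on the function type, phrased so that closed conditions can be
  intersected afterwards.\<close>

lemma compact_Pi_UNIV:
  assumes "\<And>i. compact (B i :: 'b::topological_space set)"
  shows "compact {p. \<forall>i. p i \<in> B i}"
proof -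
  have "compactin (product_topology (\<lambda>i. euclidean) UNIV) (PiE UNIV B)"
    using assms by (auto simp: compactin_PiE)
  then show ?thesis
    by (simp add: euclidean_product_topology PiE_UNIV_domain Pi_def)
qed

text \<open>Linear functions on the dual within the prescribed bounds form a compact set
  \<open>K\<close> in the product topology. Reflexivity represents each of them by a vector, and the
  representing map \<open>g\<close> is weakly continuous because its composition with a functional
  is a coordinate projection.\<close>

lemma compactin_weak_topology_cball:
  fixes c :: "'a::banach"
  assumes "reflexive_space TYPE('a)"
  shows "compactin weak_topology (cball c r)"
proof (cases "r \<ge> 0")
  case False
  then show ?thesis by simp
next
  case True
  define K :: "(('a \<Rightarrow>\<^sub>L real) \<Rightarrow> real) set" where
    "K = {p. (\<forall>\<phi>. p \<phi> \<in> cball (blinfun_apply \<phi> c) (r * norm \<phi>))}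
        \<inter> (\<Inter>\<phi>. \<Inter>\<psi>. {p. p (\<phi> + \<psi>) = p \<phi> + p \<psi>}) \<inter> (\<Inter>k. \<Inter>\<phi>. {p. p (k *\<^sub>R \<phi>) = k * p \<phi>})"
  have "compact K"
    unfolding K_def
    by (intro compact_Int_closed compact_Pi_UNIV closed_INT ballI closed_Collect_eq continuous_intros
        continuous_on_product_coordinates compact_cball)
  have ex: "\<exists>x. \<forall>\<phi>. blinfun_apply \<phi> x = p \<phi>" if "p \<in> K" for p
  proof -
    have p: "\<bar>blinfun_apply \<phi> c - p \<phi>\<bar> \<le> r * norm \<phi>" for \<phi>
      using that by (simp add: K_def dist_real_def)
    have "\<bar>p \<phi>\<bar> \<le> norm \<phi> * (norm c + r)" for \<phi>
    proof -
      have "\<bar>blinfun_apply \<phi> c\<bar> \<le> norm \<phi> * norm c"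
        using norm_blinfun[of \<phi> c] by simp
      then show ?thesis using p[of \<phi>] by (simp add: algebra_simps)
    qed
    then have "bounded_linear p"
      using that by (intro bounded_linear_intro[where K = "norm c + r"]) (auto simp: K_def)
    then have "blinfun_apply (Blinfun p) = p"
      by (rule bounded_linear_Blinfun_apply)
    then show ?thesis
      using assms unfolding reflexive_space_def by metis
  qed
  define g :: "(('a \<Rightarrow>\<^sub>L real) \<Rightarrow> real) \<Rightarrow> 'a" where
    "g p = (SOME x. \<forall>\<phi>. blinfun_apply \<phi> x = p \<phi>)" for p
  have g: "blinfun_apply \<phi> (g p) = p \<phi>" if "p \<in> K" for p \<phi>
    using someI_ex[OF ex[OF that]] unfolding g_def by blast
  have "continuous_map (top_of_set K) weak_topology g"
    unfolding weak_topology_def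
  proof (rule continuous_map_into_initial_topology)
    fix f assume "f \<in> range (blinfun_apply :: ('a \<Rightarrow>\<^sub>L real) \<Rightarrow> 'a \<Rightarrow> real)"
    then obtain \<phi> where f: "f = blinfun_apply \<phi>" by blast
    have "continuous_on K (\<lambda>p. p \<phi>)"
      by (rule continuous_on_subset[OF continuous_on_product_coordinates]) simp
    moreover have "continuous_on K (\<lambda>p. f (g p)) \<longleftrightarrow> continuous_on K (\<lambda>p. p \<phi>)"
      by (rule continuous_on_cong) (auto simp: f g)
    ultimately show "continuous_map (top_of_set K) euclideanreal (\<lambda>p. f (g p))"
      by simp
  qed auto
  then have "compactin weak_topology (g ` K)"
    using \<open>compact K\<close> by (intro image_compactin[of "top_of_set K"]) (auto simp: compactin_subtopology)
  also have "g ` K = cball c r"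
  proof (intro equalityI subsetI)
    fix x assume "x \<in> g ` K"
    then obtain p where p: "p \<in> K" "x = g p" by blast
    have "norm (x - c) \<le> r"
    proof (rule norm_le_if_functionals_le)
      fix \<phi> :: "'a \<Rightarrow>\<^sub>L real"
      show "blinfun_apply \<phi> (x - c) \<le> r * norm \<phi>"
        using p g[OF p(1), of \<phi>] unfolding K_def
        by (auto simp: dist_real_def blinfun.diff_right abs_le_iff dest!: spec[of _ \<phi>])
    qed (use True in auto)
    then show "x \<in> cball c r" by (simp add: dist_norm norm_minus_commute)
  next
    fix x assume x: "x \<in> cball c r"
    define p where "p \<phi> = blinfun_apply \<phi> x" for \<phi> :: "'a \<Rightarrow>\<^sub>L real"
    have "\<bar>blinfun_apply \<phi> (c - x)\<bar> \<le> r * norm \<phi>" for \<phi> :: "'a \<Rightarrow>\<^sub>L real"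
    proof -
      have "\<bar>blinfun_apply \<phi> (c - x)\<bar> \<le> norm \<phi> * norm (c - x)"
        using norm_blinfun[of \<phi> "c - x"] by simp
      also have "\<dots> \<le> norm \<phi> * r"
        using x by (intro mult_left_mono) (auto simp: dist_norm)
      finally show ?thesis by (simp add: mult.commute)
    qed
    then have "p \<in> K"
      by (auto simp: K_def p_def dist_real_def blinfun.diff_right blinfun.add_left blinfun.scaleR_left)
    moreover have "x = g p"
      by (rule functionals_separate) (simp add: g[OF \<open>p \<in> K\<close>], simp add: p_def)
    ultimately show "x \<in> g ` K" by blast
  qed
  finally show ?thesis .
qed

section \<open>Integration against vector measures\<close>

text \<open>Additivity on bounded Borel sets alone, without the zero extension and the variation
  bound built into \<open>Mloc\<close>. This class is closed under bounded linear maps, sums and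
  differences, and it contains Lebesgue-Stieltjes measures, so vector measures and their scalar
  components share one calculus.\<close>

definition countably_additive_bounded :: "(real set \<Rightarrow> 'b::real_normed_vector) \<Rightarrow> bool" where
  "countably_additive_bounded n \<longleftrightarrow>
     (\<forall>F :: nat \<Rightarrow> real set. range F \<subseteq> sets borel \<and> disjoint_family F \<and> bounded (\<Union>i. F i) \<longrightarrow>
        (\<lambda>i. n (F i)) sums n (\<Union>i. F i))"

context
  fixes n :: "real set \<Rightarrow> 'b::real_normed_vector"
  assumes n: "countably_additive_bounded n"
begin

lemma cab_sums:
  assumes "range F \<subseteq> sets borel" "disjoint_family F" "bounded (\<Union>i::nat. F i)"
  shows "(\<lambda>i. n (F i)) sums n (\<Union>i. F i)"
  using n assms unfolding countably_additive_bounded_def by blast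

lemma cab_empty: "n {} = 0"
proof -
  have "(\<lambda>i::nat. n {}) sums n {}"
    using cab_sums[of "\<lambda>_::nat. {}"] by (simp add: disjoint_family_on_def)
  then show ?thesis
    by (auto dest!: sums_summable simp: summable_const_iff)
qed

lemma cab_Un:
  assumes "A \<in> sets borel" "B \<in> sets borel" "bounded A" "bounded B" "A \<inter> B = {}"
  shows "n (A \<union> B) = n A + n B"
proof -
  define F where "F = (\<lambda>i::nat. if i = 0 then A else if i = 1 then B else {})"
  have U: "(\<Union>i. F i) = A \<union> B"
    unfolding F_def by (auto split: if_splits)
  have "disjoint_family F" "range F \<subseteq> sets borel"
    using assms by (auto simp: F_def disjoint_family_on_def)
  then have "(\<lambda>i. n (F i)) sums n (\<Union>i. F i)"
    using assms U by (intro cab_sums) auto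
  moreover have "(\<lambda>i. n (F i)) sums (\<Sum>i\<in>{0,1}. n (F i))"
    by (rule sums_finite) (auto simp: F_def cab_empty)
  ultimately have "n (\<Union>i. F i) = (\<Sum>i\<in>{0,1}. n (F i))"
    by (rule sums_unique2)
  then show ?thesis
    unfolding U by (simp add: F_def)
qed

lemma cab_Diff:
  assumes "A \<in> sets borel" "B \<in> sets borel" "bounded A" "B \<subseteq> A"
  shows "n (A - B) = n A - n B"
proof -
  have "n ((A - B) \<union> B) = n (A - B) + n B"
    using assms by (intro cab_Un) (auto intro: bounded_subset)
  moreover have "(A - B) \<union> B = A" using assms by blast
  ultimately show ?thesis by simp
qed

lemma cab_decseq:
  assumes "decseq A" "\<And>k::nat. A k \<in> sets borel" "bounded (A 0)" "(\<Inter>k. A k) = {}"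
  shows "(\<lambda>k. n (A k)) \<longlonglongrightarrow> 0"
proof -
  define F where "F i = A i - A (Suc i)" for i
  have sub: "A (Suc k) \<subseteq> A k" "A k \<subseteq> A 0" for k
    using assms(1) by (auto simp: decseq_def)
  have bd: "bounded (A k)" for k
    using assms(3) sub(2) by (rule bounded_subset)
  have U: "(\<Union>i. F i) = A 0"
  proof (intro equalityI subsetI)
    fix x assume x: "x \<in> A 0"
    obtain k where k: "x \<notin> A k" using assms(4) by blast
    have "\<exists>i. x \<in> F i"
    proof (rule ccontr)
      assume "\<nexists>i. x \<in> F i"
      then have "x \<in> A i" for i by (induction i) (use x in \<open>auto simp: F_def\<close>)
      with k show False by blast
    qed
    then show "x \<in> (\<Union>i. F i)" by blast
  qed (use sub(2) in \<open>auto simp: F_def\<close>)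
  have "disjoint_family F"
    unfolding F_def using disjoint_family_Suc[of "\<lambda>i. - A i"] sub(1)
    by (simp add: Diff_eq Int_commute)
  then have "(\<lambda>i. n (F i)) sums n (A 0)"
    using cab_sums[of F] assms(2,3) unfolding U by (auto simp: F_def)
  then have "(\<lambda>k. \<Sum>i<k. n (F i)) \<longlonglongrightarrow> n (A 0)"
    by (simp add: sums_def)
  moreover have "(\<Sum>i<k. n (F i)) = n (A 0) - n (A k)" for k
  proof -
    have "n (F i) = n (A i) - n (A (Suc i))" for i
      unfolding F_def by (rule cab_Diff) (use assms(2) sub(1) bd in auto)
    then show ?thesis
      using sum_lessThan_telescope'[of "\<lambda>i. n (A i)" k] by (simp only:)
  qed
  ultimately have "(\<lambda>k. n (A 0) - (n (A 0) - n (A k))) \<longlonglongrightarrow> n (A 0) - n (A 0)"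
    by (intro tendsto_diff tendsto_const) simp
  then show ?thesis by simp
qed

text \<open>Since b itself is excluded, the sets decrease to the empty set. Both {b<..<y} and
  {b<..y} are of this form.\<close>

lemma cab_tendsto_at_right:
  assumes A: "\<And>y. A y \<in> sets borel" "\<And>y. A y \<subseteq> {b<..y}" "\<And>y z. y \<le> z \<Longrightarrow> A y \<subseteq> A z"
  shows "((\<lambda>y. n (A y)) \<longlongrightarrow> 0) (at_right b)"
proof (rule tendsto_at_right_sequentially[of b "b + 1"])
  fix S :: "nat \<Rightarrow> real" assume S: "decseq S" "S \<longlonglongrightarrow> b"
  show "(\<lambda>k. n (A (S k))) \<longlonglongrightarrow> 0"
  proof (rule cab_decseq)
    show "decseq (\<lambda>k. A (S k))" using S(1) A(3) by (simp add: decseq_def)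
    show "bounded (A (S 0))" using A(2) by (rule bounded_subset[rotated]) auto
    show "(\<Inter>k. A (S k)) = {}"
    proof (rule ccontr)
      assume "(\<Inter>k. A (S k)) \<noteq> {}"
      then obtain x where x: "x \<in> A (S k)" for k by blast
      then have "b < x" "x \<le> S k" for k using A(2) by fastforce+
      with LIMSEQ_le_const[OF S(2), of x] show False by fastforce
    qed
  qed (use A in auto)
qed simp

end

lemma bounded_subset_Ioc:
  assumes "bounded (A :: real set)"
  obtains R where "A \<subseteq> {-R<..R}"
proof -
  obtain b where b: "\<And>x. x \<in> A \<Longrightarrow> \<bar>x\<bar> \<le> b"
    using assms by (auto simp: bounded_iff)
  have "A \<subseteq> {-(b+1)<..b+1}"
  proof
    fix x assume "x \<in> A"
    from b[OF this] show "x \<in> {-(b+1)<..b+1}" by auto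
  qed
  then show thesis by (rule that)
qed

text \<open>Dynkin's argument, with every set intersected with one bounded interval containing A:
  complements would otherwise leave the bounded sets, on which alone additivity is
  available.\<close>

lemma cab_eq_if_eq_Ioc:
  assumes n: "countably_additive_bounded n1" "countably_additive_bounded n2"
    and eq: "\<And>a b. a < b \<Longrightarrow> n1 {a<..b} = n2 {a<..b}"
    and A: "A \<in> sets borel" "bounded A"
  shows "n1 A = n2 A"
proof -
  have eq': "n1 {a<..b} = n2 {a<..b}" for a b
    using eq[of a b] n[THEN cab_empty] by (cases "a < b") auto
  obtain R where R: "A \<subseteq> {-R<..R}" using bounded_subset_Ioc[OF A(2)] by blast
  define I where "I = {-R<..R}"
  have I: "I \<in> sets borel" "bounded I" unfolding I_def by auto
  let ?G = "range (\<lambda>(a::real, b). {a<..b})"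
  have *: "sets borel = sigma_sets UNIV ?G"
    by (metis borel_sigma_sets_Ioc sets_measure_of subset_UNIV Pow_UNIV)
  have "Int_stable ?G"
  proof (rule Int_stableI)
    fix X Y assume "X \<in> ?G" "Y \<in> ?G"
    then obtain a b c d where "X = {a<..b}" "Y = {c<..d}" by auto
    then have "X \<inter> Y = {max a c<..min b d}" by auto
    then show "X \<inter> Y \<in> ?G" by auto
  qed
  moreover have "?G \<subseteq> Pow UNIV" by simp
  moreover have "A \<in> sigma_sets UNIV ?G" using A(1) * by blast
  ultimately have "n1 (A \<inter> I) = n2 (A \<inter> I)"
  proof (induction rule: sigma_sets_induct_disjoint)
    case (basic X)
    then obtain a b where "X = {a<..b}" by auto
    then have "X \<inter> I = {max a (-R)<..min b R}" unfolding I_def by auto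
    then show ?case using eq' by simp
  next
    case empty
    then show ?case using n by (simp add: cab_empty)
  next
    case (compl X)
    have X: "X \<inter> I \<in> sets borel" using compl(1) I * by auto
    have "(UNIV - X) \<inter> I = I - X \<inter> I" by blast
    then show ?case
      using compl(2) X I eq'[of "-R" R] by (simp add: n[THEN cab_Diff] I_def)
  next
    case (union X)
    have X: "range (\<lambda>i. X i \<inter> I) \<subseteq> sets borel" using union(2) I * by blast
    moreover have "disjoint_family (\<lambda>i. X i \<inter> I)"
      using union(1) by (auto simp: disjoint_family_on_def)
    moreover have "bounded (\<Union>i. X i \<inter> I)" using I(2) by (rule bounded_subset) auto
    ultimately have "(\<lambda>i. n1 (X i \<inter> I)) sums n1 (\<Union>i. X i \<inter> I)"
        "(\<lambda>i. n2 (X i \<inter> I)) sums n2 (\<Union>i. X i \<inter> I)"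
      using n[THEN cab_sums] by blast+
    then have "n1 (\<Union>i. X i \<inter> I) = n2 (\<Union>i. X i \<inter> I)"
      using union(3) sums_unique2 by auto
    then show ?case by simp
  qed
  moreover have "A \<inter> I = A" using R I_def by blast
  ultimately show ?thesis by simp
qed

lemma cab_Mloc: "m \<in> Mloc UNIV \<Longrightarrow> countably_additive_bounded m"
  unfolding countably_additive_bounded_def Mloc_def by auto

lemma cab_bounded_linear:
  "bounded_linear f \<Longrightarrow> countably_additive_bounded n \<Longrightarrow> countably_additive_bounded (\<lambda>A. f (n A))"
  unfolding countably_additive_bounded_def by (auto intro: bounded_linear.sums)

lemma cab_add:
  "countably_additive_bounded n1 \<Longrightarrow> countably_additive_bounded n2 \<Longrightarrow>
    countably_additive_bounded (\<lambda>A. n1 A + n2 A)"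
  unfolding countably_additive_bounded_def by (auto intro: sums_add)

lemma cab_diff:
  "countably_additive_bounded n1 \<Longrightarrow> countably_additive_bounded n2 \<Longrightarrow>
    countably_additive_bounded (\<lambda>A. n1 A - n2 A)"
  unfolding countably_additive_bounded_def by (auto intro: sums_diff)

lemma cab_measure:
  assumes "sets M = sets borel" "\<And>A. bounded A \<Longrightarrow> A \<in> sets borel \<Longrightarrow> emeasure M A < \<infinity>"
  shows "countably_additive_bounded (\<lambda>A. measure M A)"
  unfolding countably_additive_bounded_def
proof (intro allI impI, elim conjE)
  fix F :: "nat \<Rightarrow> real set"
  assume F: "range F \<subseteq> sets borel" "disjoint_family F" "bounded (\<Union>i. F i)"
  then have "(\<Union>i. F i) \<in> sets borel" by auto
  then have "emeasure M (\<Union>i. F i) \<noteq> \<infinity>" using assms(2) F(3) by (metis less_irrefl)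
  then show "(\<lambda>i. measure M (F i)) sums measure M (\<Union>i. F i)"
    using F assms(1) by (intro measure_UNION) auto
qed

lemma Mloc_TV_finite: "m \<in> Mloc UNIV \<Longrightarrow> total_variation m {a..b} < \<infinity>"
  unfolding Mloc_def by force

lemma Mloc_eq_if_eq_Ioc:
  assumes m: "m1 \<in> Mloc UNIV" "m2 \<in> Mloc UNIV"
    and "\<And>(\<phi> :: 'h::real_normed_vector \<Rightarrow>\<^sub>L real) a b. a < b \<Longrightarrow>
      blinfun_apply \<phi> (m1 {a<..b}) = blinfun_apply \<phi> (m2 {a<..b})"
  shows "m1 = m2"
proof
  fix A :: "real set"
  show "m1 A = m2 A"
  proof (cases "A \<in> sets borel \<and> bounded A")
    case True
    show ?thesis
    proof (rule cab_eq_if_eq_Ioc[OF m[THEN cab_Mloc]])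
      show "m1 {a<..b} = m2 {a<..b}" if "a < b" for a b
        using assms(3)[OF that] by (rule functionals_separate)
    qed (use True in auto)
  next
    case False
    then show ?thesis using m unfolding Mloc_def by auto
  qed
qed

lemma simple_vm_integral_partition:
  assumes m: "m \<in> Mloc UNIV" and fin: "finite (range f)" "finite S"
    and A: "\<And>i. i \<in> S \<Longrightarrow> A i \<in> sets borel \<and> bounded (A i)" "disjoint_family_on A S"
    and f: "\<And>i s. i \<in> S \<Longrightarrow> s \<in> A i \<Longrightarrow> f s = c i" "\<And>s. f s \<noteq> 0 \<Longrightarrow> \<exists>i\<in>S. s \<in> A i"
  shows "simple_vm_integral f m = (\<Sum>i\<in>S. blinfun_apply (c i) (m (A i)))"
proof -
  \<comment> \<open>On an empty cell \<open>c i\<close> need not be a value of f, and the value 0 is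
    absent from the defining sum. Neither kind of cell contributes.\<close>
  define S' where "S' = {i\<in>S. A i \<noteq> {} \<and> c i \<noteq> 0}"
  have S': "finite S'" "S' \<subseteq> S" using fin(2) by (auto simp: S'_def)
  have "simple_vm_integral f m
      = (\<Sum>y\<in>range f - {0}. \<Sum>i | i \<in> S' \<and> c i = y. blinfun_apply (c i) (m (A i)))"
    unfolding simple_vm_integral_def
  proof (rule sum.cong[OF refl])
    fix y assume y: "y \<in> range f - {0}"
    have "{s. f s = y} = (\<Union>i\<in>{i. i \<in> S' \<and> c i = y}. A i)"
    proof (intro equalityI subsetI)
      fix s assume "s \<in> {s. f s = y}"
      then have s: "f s = y" "f s \<noteq> 0" using y by auto
      then obtain i where "i \<in> S" "s \<in> A i" using f(2) by blast
      then show "s \<in> (\<Union>i\<in>{i. i \<in> S' \<and> c i = y}. A i)"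
        using s f(1)[of i s] by (auto simp: S'_def)
    next
      fix s assume "s \<in> (\<Union>i\<in>{i. i \<in> S' \<and> c i = y}. A i)"
      then show "s \<in> {s. f s = y}" using f(1) by (auto simp: S'_def)
    qed
    moreover have "disjoint_family_on A {i. i \<in> S' \<and> c i = y}"
      using S'(2) by (intro disjoint_family_on_mono[OF _ A(2)]) blast
    ultimately have "m {s. f s = y} = (\<Sum>i | i \<in> S' \<and> c i = y. m (A i))"
      using A(1) S' by (subst Mloc_UN[OF m, symmetric]) auto
    then show "blinfun_apply y (m {s. f s = y}) = (\<Sum>i | i \<in> S' \<and> c i = y. blinfun_apply (c i) (m (A i)))"
      by (simp add: blinfun.sum_right)
  qed
  also have "\<dots> = (\<Sum>i\<in>S'. blinfun_apply (c i) (m (A i)))"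
  proof (rule sum.group)
    show "c ` S' \<subseteq> range f - {0}" 
    proof
      fix y assume "y \<in> c ` S'"
      then obtain i s where "i \<in> S" "s \<in> A i" "c i = y" "c i \<noteq> 0" by (auto simp: S'_def)
      then have "y = f s" "y \<noteq> 0" using f(1)[of i s] by auto
      then show "y \<in> range f - {0}" by blast
    qed
  qed (use fin S' in auto)
  also have "\<dots> = (\<Sum>i\<in>S. blinfun_apply (c i) (m (A i)))"
    by (rule sum.mono_neutral_left) (use fin S' in \<open>auto simp: S'_def Mloc_empty[OF m]\<close>)
  finally show ?thesis .
qed

text \<open>The sets may overlap, as the nested superlevel sets in
  \<open>vm_integral_trapezoid_tendsto\<close> do. Adding one indicator refines the level sets of
  the old sum by membership in \<open>A x\<close>; both integrals are then computed on this common
  partition.\<close>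

lemma simple_vm_integral_sum_indicator:
  fixes c :: "'i \<Rightarrow> 'h::real_normed_vector \<Rightarrow>\<^sub>L real"
  assumes m: "m \<in> Mloc UNIV" and "finite S"
    and A: "\<And>i. i \<in> S \<Longrightarrow> A i \<in> sets borel \<and> bounded (A i)"
  shows "simple_vm_integral (\<lambda>s. \<Sum>i\<in>S. indicator (A i) s *\<^sub>R c i) m = (\<Sum>i\<in>S. blinfun_apply (c i) (m (A i)))
    \<and> simple_function borel (\<lambda>s. \<Sum>i\<in>S. indicator (A i) s *\<^sub>R c i)"
  using assms(2,3)
proof (induction S rule: finite_induct)
  case empty
  then show ?case by (auto simp: simple_vm_integral_def)
next
  case (insert x S)
  define f where "f s = (\<Sum>i\<in>S. indicator (A i) s *\<^sub>R c i)" for s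
  define K where "K = A x \<union> (\<Union>i\<in>S. A i)"
  have K: "K \<in> sets borel" "bounded K"
    unfolding K_def using insert by (auto intro!: sets.finite_UN)
  have f: "simple_vm_integral f m = (\<Sum>i\<in>S. blinfun_apply (c i) (m (A i)))" "simple_function borel f"
    using insert unfolding f_def by auto
  have f0: "s \<in> K" if "f s \<noteq> 0" for s
  proof (rule ccontr)
    assume "s \<notin> K"
    then have "f s = 0" unfolding f_def K_def by (intro sum.neutral) (auto simp: indicator_def)
    with that show False by simp
  qed
  define h where "h s = f s + indicator (A x) s *\<^sub>R c x" for s
  have "simple_function borel (\<lambda>s. indicator (A x) s *\<^sub>R c x)"
  proof -
    have "A x \<in> sets borel" using insert by auto
    then have "simple_function borel (indicator (A x) :: real \<Rightarrow> real)" by (intro simple_function_indicator) auto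
    then show ?thesis by (rule simple_function_compose1)
  qed
  then have h: "simple_function borel h"
    unfolding h_def using f(2) simple_function_compose2[of borel f "\<lambda>s. indicator (A x) s *\<^sub>R c x" "(+)"]
    by simp
  have fin: "finite (range f)" "finite (range h)" using f(2) h by (auto simp: simple_function_def)
  \<comment> \<open>Intersecting with \<open>K\<close> is essential for the value 0, whose level set
    is unbounded and so outside the reach of additivity.\<close>
  define P where "P = (\<lambda>(y, b). {s. f s = y} \<inter> K \<inter> (if b then A x else - A x))"
  let ?S = "range f \<times> (UNIV :: bool set)"
  have P: "P i \<in> sets borel \<and> bounded (P i)" for i
  proof -
    obtain y b where i: "i = (y, b)" by force
    have "{s. f s = y} \<in> sets borel"
      using simple_functionD(2)[OF f(2), of "{y}"] by (simp add: vimage_def)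
    moreover have "A x \<in> sets borel" using insert by auto
    ultimately show ?thesis
      using K unfolding P_def i by (auto intro: bounded_subset)
  qed
  have disj: "disjoint_family_on P T" for T
    by (auto simp: disjoint_family_on_def P_def split: if_splits)
  have "simple_vm_integral f m = (\<Sum>i\<in>?S. blinfun_apply (fst i) (m (P i)))"
    by (rule simple_vm_integral_partition[OF m]) (use fin P disj f0 in \<open>auto simp: P_def\<close>)
  moreover have "simple_vm_integral h m
      = (\<Sum>i\<in>?S. blinfun_apply (fst i + (if snd i then c x else 0)) (m (P i)))"
  proof (rule simple_vm_integral_partition[OF m])
    fix s assume "h s \<noteq> 0"
    then have "s \<in> K" using f0[of s] by (cases "s \<in> A x") (auto simp: h_def K_def)
    then show "\<exists>i\<in>?S. s \<in> P i"
      by (intro bexI[of _ "(f s, s \<in> A x)"]) (auto simp: P_def)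
  qed (use fin P disj in \<open>auto simp: P_def h_def split: if_splits\<close>)
  ultimately have "simple_vm_integral h m - simple_vm_integral f m
      = (\<Sum>i\<in>?S. if snd i then blinfun_apply (c x) (m (P i)) else 0)"
    by (auto simp: sum_subtractf[symmetric] blinfun.add_left intro!: sum.cong)
  also have "\<dots> = (\<Sum>y\<in>range f. \<Sum>b\<in>UNIV. if b then blinfun_apply (c x) (m (P (y, b))) else 0)"
    by (subst sum.cartesian_product) (auto simp: split_beta intro!: sum.cong)
  also have "\<dots> = (\<Sum>y\<in>range f. blinfun_apply (c x) (m (P (y, True))))"
    by (simp add: UNIV_bool)
  also have "\<dots> = blinfun_apply (c x) (m (\<Union>y\<in>range f. P (y, True)))"
    using P by (subst Mloc_UN[OF m fin(1)]) (auto simp: disjoint_family_on_def blinfun.sum_right, auto simp: P_def)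
  also have "(\<Union>y\<in>range f. P (y, True)) = A x"
    by (auto simp: P_def K_def)
  finally have "simple_vm_integral h m = blinfun_apply (c x) (m (A x)) + simple_vm_integral f m"
    by simp
  moreover have "(\<lambda>s. \<Sum>i\<in>insert x S. indicator (A i) s *\<^sub>R c i) = h"
    unfolding h_def f_def by (intro ext) (simp only: sum.insert[OF insert.hyps] add.commute)
  ultimately show ?case using f(1) h insert.hyps by simp
qed

text \<open>The threshold R0 depends on \<psi> only, through the supports of one approximating
  sequence. This uniformity in m is what makes estimates over families of measures possible.\<close>

lemma vm_integral_close:
  fixes \<psi> :: "real \<Rightarrow> 'h::real_normed_vector \<Rightarrow>\<^sub>L real"
  assumes "\<psi> \<in> Cc"
  obtains R0 where "\<And>R f d m. R0 \<le> R \<Longrightarrow> m \<in> Mloc UNIV \<Longrightarrow> simple_function borel f \<Longrightarrow>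
      (\<And>s. R < \<bar>s\<bar> \<Longrightarrow> f s = 0) \<Longrightarrow> (\<And>s. norm (f s - \<psi> s) \<le> d) \<Longrightarrow>
      \<bar>simple_vm_integral f m - vm_integral \<psi> m\<bar> \<le> d * enn2real (total_variation m {-R..R})"
proof -
  obtain F where F: "simple_approx F \<psi>" using simple_approx_exists[OF assms] by blast
  then obtain R0 where R0: "\<And>n s. R0 < \<bar>s\<bar> \<Longrightarrow> F n s = 0"
    unfolding simple_approx_def by blast
  show thesis
  proof (rule that)
    fix R f d and m :: "real set \<Rightarrow> 'h"
    assume R: "R0 \<le> R" and m: "m \<in> Mloc UNIV" and f: "simple_function borel f"
      "\<And>s. R < \<bar>s\<bar> \<Longrightarrow> f s = 0" "\<And>s. norm (f s - \<psi> s) \<le> d"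
    define V where "V = enn2real (total_variation m {-R..R})"
    show "\<bar>simple_vm_integral f m - vm_integral \<psi> m\<bar> \<le> d * V"
    proof (rule field_le_epsilon)
      fix e :: real assume "e > 0"
      define e' where "e' = e / (V + 1)"
      have V: "V \<ge> 0" by (simp add: V_def)
      then have e': "e' > 0" using \<open>e > 0\<close> by (simp add: e'_def)
      have "\<forall>\<^sub>F n in sequentially. \<forall>s\<in>UNIV. dist (F n s) (\<psi> s) < e'"
        using F e' unfolding simple_approx_def uniform_limit_iff by blast
      then have ev: "\<forall>\<^sub>F n in sequentially. \<bar>simple_vm_integral f m - simple_vm_integral (F n) m\<bar> \<le> (d + e') * V"
      proof eventually_elim
        case (elim n)
        show ?case unfolding V_def
        proof (rule simple_vm_integral_diff_le[OF m f(1)])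
          show "simple_function borel (F n)" using F by (simp add: simple_approx_def)
          show "norm (f s - F n s) \<le> d + e'" for s
          proof -
            have "norm (f s - F n s) \<le> norm (f s - \<psi> s) + norm (F n s - \<psi> s)"
              using norm_triangle_ineq4[of "f s - \<psi> s" "F n s - \<psi> s"] by simp
            moreover have "norm (F n s - \<psi> s) < e'" using elim by (simp add: dist_norm)
            ultimately show ?thesis using f(3)[of s] by linarith
          qed
        qed (use f(2) R R0 in auto)
      qed
      have "(\<lambda>n. \<bar>simple_vm_integral f m - simple_vm_integral (F n) m\<bar>)
          \<longlonglongrightarrow> \<bar>simple_vm_integral f m - vm_integral \<psi> m\<bar>"
        using vm_integral_well_defined[OF m assms F] by (intro tendsto_intros)
      then have "\<bar>simple_vm_integral f m - vm_integral \<psi> m\<bar> \<le> (d + e') * V"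
        using ev by (rule tendsto_upperbound) simp
      also have "e' * V \<le> e"
        using V \<open>e > 0\<close> by (simp add: e'_def field_simps)
      then have "(d + e') * V \<le> d * V + e" by (simp add: algebra_simps)
      finally show "\<bar>simple_vm_integral f m - vm_integral \<psi> m\<bar> \<le> d * V + e" .
    qed
  qed
qed

section \<open>The local weak-star topology\<close>

text \<open>Recovers interval values from continuous test functions. Both ramps lie to the right of
  their endpoints: \<open>g \<delta>\<close> vanishes at a and, for \<delta> < b - a, has height 1
  from a + \<delta> to b. The pointwise limit is therefore the indicator of the half-open interval,
  whatever the atoms at a and b.\<close>

lemma vm_integral_trapezoid_tendsto:
  fixes m :: "real set \<Rightarrow> 'h::real_normed_vector" and \<phi> :: "'h \<Rightarrow>\<^sub>L real"
  assumes m: "m \<in> Mloc UNIV" and ab: "a < b"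
  defines "g \<equiv> \<lambda>\<delta> s. max 0 (min 1 (min ((s - a) / \<delta>) ((b + \<delta> - s) / \<delta>))) *\<^sub>R \<phi>"
  shows "((\<lambda>\<delta>. vm_integral (g \<delta>) m) \<longlongrightarrow> blinfun_apply \<phi> (m {a<..b})) (at_right 0)"
    and "\<And>\<delta>. 0 < \<delta> \<Longrightarrow> g \<delta> \<in> Cc"
proof -
  show Cc: "g \<delta> \<in> Cc" if \<delta>: "0 < \<delta>" for \<delta>
  proof -
    have "continuous_on UNIV (g \<delta>)"
      unfolding g_def using \<delta> by (intro continuous_intros) auto
    moreover have "{s. g \<delta> s \<noteq> 0} \<subseteq> {a..b + \<delta>}"
    proof
      fix s assume "s \<in> {s. g \<delta> s \<noteq> 0}"
      then have "0 < min ((s - a) / \<delta>) ((b + \<delta> - s) / \<delta>)"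
        unfolding g_def by (auto simp: max_def split: if_splits)
      then show "s \<in> {a..b + \<delta>}" using \<delta> by (simp add: zero_less_divide_iff)
    qed
    then have "bounded {s. g \<delta> s \<noteq> 0}" by (rule bounded_subset[rotated]) simp
    ultimately show ?thesis unfolding Cc_def by simp
  qed
  define p where "p A = blinfun_apply \<phi> (m A)" for A
  have p: "countably_additive_bounded p"
    unfolding p_def by (intro cab_bounded_linear[OF _ cab_Mloc[OF m]] blinfun.bounded_linear_right)
  show "((\<lambda>\<delta>. vm_integral (g \<delta>) m) \<longlongrightarrow> blinfun_apply \<phi> (m {a<..b})) (at_right 0)"
  proof (rule tendstoI)
    fix e0 :: real assume "e0 > 0"
    define e where "e = e0 / 3"
    have e: "e > 0" using \<open>e0 > 0\<close> by (simp add: e_def)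
    \<comment> \<open>A superlevel set of the trapezoid differs from {a<..b} only by such an initial
      piece and such a final piece.\<close>
    have "((\<lambda>y. p {a<..<y}) \<longlongrightarrow> 0) (at_right a)" "((\<lambda>y. p {b<..y}) \<longlongrightarrow> 0) (at_right b)"
      by (intro cab_tendsto_at_right[OF p]; auto)+
    then have "\<forall>\<^sub>F y in at_right a. dist (p {a<..<y}) 0 < e" "\<forall>\<^sub>F y in at_right b. dist (p {b<..y}) 0 < e"
      using e by (simp_all only: tendsto_iff)
    then obtain \<delta>1 \<delta>2 where \<delta>12: "\<delta>1 > a" "\<delta>2 > b"
      "\<And>y. a < y \<Longrightarrow> y < \<delta>1 \<Longrightarrow> \<bar>p {a<..<y}\<bar> < e" "\<And>y. b < y \<Longrightarrow> y < \<delta>2 \<Longrightarrow> \<bar>p {b<..y}\<bar> < e"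
      by (auto simp: eventually_at_right_field)
    define \<delta>0 where "\<delta>0 = min (b - a) (min (\<delta>1 - a) (\<delta>2 - b))"
    have main: "dist (vm_integral (g \<delta>) m) (blinfun_apply \<phi> (m {a<..b})) < e0" if \<delta>: "0 < \<delta>" "\<delta> < \<delta>0" for \<delta>
    proof -
      have I: "\<bar>p {x..y} - p {a<..b}\<bar> \<le> 2 * e" if "a < x" "x \<le> a + \<delta>" "b \<le> y" "y \<le> b + \<delta>" for x y
      proof -
        have "x \<le> b" "x < \<delta>1" "y < \<delta>2" using that \<delta> by (auto simp: \<delta>0_def)
        have "{a<..y} = {a<..b} \<union> {b<..y}" "{a<..y} = {a<..<x} \<union> {x..y}"
          using that \<open>x \<le> b\<close> by auto
        moreover have "p ({a<..b} \<union> {b<..y}) = p {a<..b} + p {b<..y}"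
          by (rule cab_Un[OF p]) auto
        moreover have "p ({a<..<x} \<union> {x..y}) = p {a<..<x} + p {x..y}"
          by (rule cab_Un[OF p]) auto
        ultimately have "p {x..y} - p {a<..b} = p {b<..y} - p {a<..<x}" by simp
        moreover have "\<bar>p {a<..<x}\<bar> < e" using \<delta>12(3)[of x] that \<open>x < \<delta>1\<close> by simp
        moreover have "\<bar>p {b<..y}\<bar> \<le> e"
          using \<delta>12(4)[of y] that \<open>y < \<delta>2\<close> e by (cases "b = y") (auto simp: cab_empty[OF p])
        ultimately show ?thesis by linarith
      qed
      obtain R0 where R0: "\<And>R f d m. R0 \<le> R \<Longrightarrow> m \<in> Mloc UNIV \<Longrightarrow> simple_function borel f \<Longrightarrow>
          (\<And>s. R < \<bar>s\<bar> \<Longrightarrow> f s = 0) \<Longrightarrow> (\<And>s. norm (f s - g \<delta> s) \<le> d) \<Longrightarrow>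
          \<bar>simple_vm_integral f m - vm_integral (g \<delta>) m\<bar> \<le> d * enn2real (total_variation m {-R..R})"
        using vm_integral_close[OF Cc[OF \<delta>(1)]] by metis
      define R where "R = max R0 (max \<bar>a\<bar> \<bar>b + \<delta>\<bar>)"
      define V where "V = enn2real (total_variation m {-R..R})"
      \<comment> \<open>\<open>V\<close> depends on \<delta> through \<open>R\<close>, but not on j.
        So j tends to infinity with \<delta> fixed, and the layer-cake error disappears.\<close>
      have est: "\<bar>p {a<..b} - vm_integral (g \<delta>) m\<bar> \<le> 2 * e + norm \<phi> * V / Suc j" for j
      proof -
        define n where "n = real (Suc j)"
        have n: "n > 0" by (simp add: n_def)
        \<comment> \<open>Layer cake: the trapezoid is, up to \<open>1 / n\<close>, the average of the indicators of its
          superlevel sets \<open>A k\<close>, all of which are close to \<open>{a<..b}\<close>.\<close>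
        define A where "A k = {a + real k * \<delta> / n .. b + \<delta> - real k * \<delta> / n}" for k :: nat
        define f where "f s = (\<Sum>k\<in>{1..Suc j}. indicator (A k) s *\<^sub>R (\<phi> /\<^sub>R n))" for s
        have f: "simple_vm_integral f m = (\<Sum>k\<in>{1..Suc j}. p (A k) / n)" "simple_function borel f"
          using simple_vm_integral_sum_indicator[OF m, of "{1..Suc j}" A "\<lambda>_. \<phi> /\<^sub>R n"]
          unfolding f_def p_def by (auto simp: A_def blinfun.scaleR_left divide_inverse mult.commute)
        have "norm (f s - g \<delta> s) \<le> norm \<phi> / n" for s
        proof -
          define u where "u = min ((s - a) / \<delta>) ((b + \<delta> - s) / \<delta>)"
          have inA: "s \<in> A k \<longleftrightarrow> real k \<le> n * u" for k
          proof -
            have "s \<in> A k \<longleftrightarrow> real k / n \<le> (s - a) / \<delta> \<and> real k / n \<le> (b + \<delta> - s) / \<delta>"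
              unfolding A_def using \<delta>(1) n by (auto simp: field_simps)
            also have "\<dots> \<longleftrightarrow> real k / n \<le> u" by (simp add: u_def)
            also have "\<dots> \<longleftrightarrow> real k \<le> n * u" using n by (simp add: field_simps)
            finally show ?thesis .
          qed
          define c where "c = real (card {k \<in> {1..Suc j}. s \<in> A k})"
          have "f s = (c / n) *\<^sub>R \<phi>"
          proof -
            have "f s = (\<Sum>k\<in>{1..Suc j}. if s \<in> A k then \<phi> /\<^sub>R n else 0)"
              unfolding f_def by (intro sum.cong refl) (simp split: split_indicator)
            also have "\<dots> = (\<Sum>k\<in>{k \<in> {1..Suc j}. s \<in> A k}. \<phi> /\<^sub>R n)"
              by (rule sum.inter_filter[symmetric]) simp
            also have "\<dots> = (c / n) *\<^sub>R \<phi>"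
              unfolding c_def sum_constant_scaleR by (simp add: divide_inverse)
            finally show ?thesis .
          qed
          then have fg: "f s - g \<delta> s = (c / n - max 0 (min 1 u)) *\<^sub>R \<phi>"
            by (simp add: g_def u_def scaleR_diff_left)
          \<comment> \<open>By \<open>inA\<close>, \<open>c\<close> counts the k between 1 and n
            with k \<le> n u, so it is the floor of n u clipped to [0, n].\<close>
          have "\<bar>c - n * max 0 (min 1 u)\<bar> \<le> 1"
          proof -
            consider "u \<le> 0" | "0 < u" "u \<le> 1" | "1 < u" by linarith
            then show ?thesis
            proof cases
              case 1
              then have nu: "n * u \<le> 0" using n by (simp add: mult_nonneg_nonpos)
              have "{k \<in> {1..Suc j}. s \<in> A k} = {}"
              proof -
                have "\<not> real k \<le> n * u" if "k \<in> {1..Suc j}" for k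
                  using that nu by auto
                then show ?thesis using inA by blast
              qed
              then have "c = 0" unfolding c_def by simp
              then show ?thesis using 1 by simp
            next
              case 2
              have nu: "0 < n * u" "n * u \<le> n" using 2 n by (auto simp: mult_le_cancel_left1)
              have "{k \<in> {1..Suc j}. s \<in> A k} = {1..nat \<lfloor>n * u\<rfloor>}"
              proof (intro equalityI subsetI)
                fix k assume "k \<in> {k \<in> {1..Suc j}. s \<in> A k}"
                then show "k \<in> {1..nat \<lfloor>n * u\<rfloor>}" using inA by (auto simp: le_nat_floor)
              next
                fix k assume k: "k \<in> {1..nat \<lfloor>n * u\<rfloor>}"
                then have "real k \<le> real (nat \<lfloor>n * u\<rfloor>)" by simp
                also have "\<dots> \<le> n * u" using nu by simp
                finally have "real k \<le> n * u" .
                moreover have "k \<le> Suc j" using \<open>real k \<le> n * u\<close> nu(2) unfolding n_def by linarith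
                ultimately show "k \<in> {k \<in> {1..Suc j}. s \<in> A k}" using inA k by auto
              qed
              then have "c = of_int \<lfloor>n * u\<rfloor>" unfolding c_def using nu by simp
              then show ?thesis using 2 by (simp add: max_def min_def) linarith
            next
              case 3
              have "real k \<le> n * u" if "k \<in> {1..Suc j}" for k
              proof -
                have "real k \<le> n * 1" using that by (simp add: n_def)
                also have "\<dots> \<le> n * u" using 3 n by (intro mult_left_mono) auto
                finally show ?thesis .
              qed
              then have "{k \<in> {1..Suc j}. s \<in> A k} = {1..Suc j}" using inA by blast
              then have "c = n" unfolding c_def n_def by simp
              then show ?thesis using 3 by simp
            qed
          qed
          moreover have "c / n - max 0 (min 1 u) = (c - n * max 0 (min 1 u)) / n"
            using n by (simp add: diff_divide_distrib)
          ultimately have "\<bar>c / n - max 0 (min 1 u)\<bar> \<le> 1 / n"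
            using n by (simp add: abs_divide divide_right_mono)
          then show ?thesis unfolding fg
            using mult_right_mono[of _ "1 / n" "norm \<phi>"] by simp
        qed
        moreover have "f s = 0" if "R < \<bar>s\<bar>" for s
        proof -
          have "s \<notin> A k" for k
          proof -
            have "A k \<subseteq> {a..b + \<delta>}" unfolding A_def using \<delta>(1) n by auto
            moreover have "s \<notin> {a..b + \<delta>}" using that unfolding R_def by auto
            ultimately show ?thesis by blast
          qed
          then show ?thesis unfolding f_def by simp
        qed
        ultimately have "\<bar>simple_vm_integral f m - vm_integral (g \<delta>) m\<bar> \<le> norm \<phi> / n * V"
          unfolding V_def by (intro R0 m f(2)) (simp_all add: R_def)
        moreover have "\<bar>simple_vm_integral f m - p {a<..b}\<bar> \<le> 2 * e"
        proof -
          have "simple_vm_integral f m - p {a<..b} = (\<Sum>k\<in>{1..Suc j}. (p (A k) - p {a<..b}) / n)"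
            unfolding f(1) by (simp add: sum_subtractf diff_divide_distrib n_def)
          also have "\<bar>\<dots>\<bar> \<le> (\<Sum>k\<in>{1..Suc j}. 2 * e / n)"
          proof (rule order_trans[OF sum_abs], rule sum_mono)
            fix k assume k: "k \<in> {1..Suc j}"
            have "0 < real k * \<delta> / n" using k \<delta>(1) n by simp
            moreover have "real k * \<delta> \<le> n * \<delta>"
              using k \<delta>(1) by (intro mult_right_mono) (auto simp: n_def)
            then have "real k * \<delta> / n \<le> \<delta>" using n by (simp add: field_simps)
            ultimately have "\<bar>p (A k) - p {a<..b}\<bar> \<le> 2 * e"
              unfolding A_def by (intro I) auto
            then show "\<bar>(p (A k) - p {a<..b}) / n\<bar> \<le> 2 * e / n"
              using n by (simp add: divide_right_mono)
          qed
          also have "\<dots> = 2 * e" by (simp add: n_def)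
          finally show ?thesis .
        qed
        ultimately show ?thesis unfolding n_def by simp
      qed
      have "(\<lambda>j. 2 * e + norm \<phi> * V * (1 / real (Suc j))) \<longlonglongrightarrow> 2 * e + norm \<phi> * V * 0"
        using LIMSEQ_inverse_real_of_nat by (intro tendsto_intros) (simp add: inverse_eq_divide)
      then have "\<bar>p {a<..b} - vm_integral (g \<delta>) m\<bar> \<le> 2 * e + norm \<phi> * V * 0"
        by (rule tendsto_lowerbound) (use est in auto)
      then have "\<bar>p {a<..b} - vm_integral (g \<delta>) m\<bar> < 3 * e" using e by simp
      then show ?thesis by (simp add: p_def dist_real_def e_def abs_minus_commute)
    qed
    have "\<delta>0 > 0" using ab \<delta>12 by (simp add: \<delta>0_def)
    then show "\<forall>\<^sub>F \<delta> in at_right 0. dist (vm_integral (g \<delta>) m) (blinfun_apply \<phi> (m {a<..b})) < e0"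
      unfolding eventually_at_right_field using main by (intro exI[of _ \<delta>0]) auto
  qed
qed

lemma Cc_nonempty: "Cc \<noteq> {}"
proof -
  have "(\<lambda>_. 0) \<in> Cc" by (simp add: Cc_def)
  then show ?thesis by blast
qed

lemma topspace_Mloc_wstar [simp]: "topspace Mloc_wstar = Mloc UNIV"
  unfolding Mloc_wstar_def using Cc_nonempty by (intro topspace_initial_topology) auto

text \<open>Test functions separate measures because the trapezoids determine all half-open
  intervals. The Hausdorff property is what turns compact sets of measures into closed ones.\<close>

lemma Hausdorff_Mloc_wstar:
  "Hausdorff_space (Mloc_wstar :: (real set \<Rightarrow> 'h::real_normed_vector) topology)"
  unfolding Mloc_wstar_def
proof (rule Hausdorff_initial_topology)
  show "vm_integral ` Cc \<noteq> ({} :: ((real set \<Rightarrow> 'h) \<Rightarrow> real) set)" using Cc_nonempty by simp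
next
  fix m1 m2 :: "real set \<Rightarrow> 'h"
  assume m: "m1 \<in> Mloc UNIV" "m2 \<in> Mloc UNIV"
    and eq: "\<And>f. f \<in> vm_integral ` Cc \<Longrightarrow> f m1 = f m2"
  show "m1 = m2"
  proof (rule Mloc_eq_if_eq_Ioc[OF m])
    fix \<phi> :: "'h \<Rightarrow>\<^sub>L real" and a b :: real assume ab: "a < b"
    define g where "g = (\<lambda>\<delta> s. max 0 (min 1 (min ((s - a) / \<delta>) ((b + \<delta> - s) / \<delta>))) *\<^sub>R \<phi>)"
    have lim: "((\<lambda>\<delta>. vm_integral (g \<delta>) m) \<longlongrightarrow> blinfun_apply \<phi> (m {a<..b})) (at_right 0)"
      if "m \<in> Mloc UNIV" for m
      unfolding g_def by (rule vm_integral_trapezoid_tendsto(1)[OF that ab])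
    have "vm_integral (g \<delta>) m1 = vm_integral (g \<delta>) m2" if "\<delta> > 0" for \<delta>
      using vm_integral_trapezoid_tendsto(2)[OF m(1) ab that, of \<phi>] by (intro eq) (auto simp: g_def)
    then have "\<forall>\<^sub>F \<delta> in at_right 0. vm_integral (g \<delta>) m1 = vm_integral (g \<delta>) m2"
      by (auto simp: eventually_at_right_less intro: eventually_mono[OF eventually_at_right_less])
    then have "((\<lambda>\<delta>. vm_integral (g \<delta>) m2) \<longlongrightarrow> blinfun_apply \<phi> (m1 {a<..b})) (at_right 0)"
      using lim[OF m(1)] by (rule Lim_transform_eventually[rotated])
    then show "blinfun_apply \<phi> (m1 {a<..b}) = blinfun_apply \<phi> (m2 {a<..b})"
      using lim[OF m(2)] by (intro tendsto_unique[OF _ _ lim[OF m(2)]]) auto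
  qed
qed

lemma continuous_map_vm_integral:
  "\<psi> \<in> Cc \<Longrightarrow> continuous_map Mloc_wstar euclideanreal (vm_integral \<psi>)"
  unfolding Mloc_wstar_def by (rule continuous_map_initial_topology_functional) simp

section \<open>Translates of measures and invariance of the hull\<close>

lemma total_variation_mshift: "total_variation (mshift h m) A = total_variation m ((+) h ` A)"
proof -
  have le: "total_variation m' ((+) h ` A) \<le> total_variation (mshift h m') A" for h A and m' :: "real set \<Rightarrow> 'a"
  proof (subst total_variation_def, rule SUP_least)
    fix P assume "P \<in> {P. finite P \<and> disjoint P \<and> (\<forall>B\<in>P. B \<in> sets borel \<and> B \<subseteq> (+) h ` A)}"
    then have P: "finite P" "disjoint P" "\<And>B. B \<in> P \<Longrightarrow> B \<in> sets borel \<and> B \<subseteq> (+) h ` A" by auto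
    define T where "T B = (+) (-h) ` B" for B :: "real set"
    have T: "(+) h ` T B = B" for B by (auto simp: T_def image_iff)
    have inj: "inj_on T P" by (metis T inj_onI)
    have borel: "T B \<in> sets borel" if "B \<in> sets borel" for B
    proof -
      have "T B = (+) h -` B" by (force simp: T_def image_iff)
      then show ?thesis
        using measurable_sets[of "(+) h" borel borel B] that by simp
    qed
    have disj: "disjoint (T ` P)"
      unfolding T_def using P(2) by (intro disjoint_image) auto
    have "(\<Sum>B\<in>P. ennreal (norm (m' B))) = (\<Sum>B\<in>T ` P. ennreal (norm (mshift h m' B)))"
      using T by (simp add: sum.reindex[OF inj] mshift_def)
    also have "\<dots> \<le> total_variation (mshift h m') A"
      unfolding total_variation_def
    proof (rule SUP_upper, intro CollectI conjI disj ballI)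
      fix B assume "B \<in> T ` P"
      then obtain B' where B': "B' \<in> P" "B = T B'" by blast
      show "B \<in> sets borel" using B' P(3) borel by blast
      show "B \<subseteq> A" using B' P(3)[of B'] by (auto simp: T_def)
    qed (use P in auto)
    finally show "(\<Sum>B\<in>P. ennreal (norm (m' B))) \<le> total_variation (mshift h m') A" .
  qed
  have "mshift (- h) (mshift h m) = m" "(+) (- h) ` (+) h ` A = A"
    by (auto simp: mshift_def image_image)
  with le[of m h A] le[of "mshift h m" "- h" "(+) h ` A"] show ?thesis by auto
qed

lemma borel_translate: "(+) (h::real) ` A \<in> sets borel \<longleftrightarrow> A \<in> sets borel"
proof -
  have "(+) h' ` A \<in> sets borel" if "A \<in> sets borel" for h' and A :: "real set"
  proof -
    have "(+) h' ` A = (+) (- h') -` A" by (force simp: image_iff)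
    then show ?thesis using measurable_sets[of "(+) (- h')" borel borel A] that by simp
  qed
  moreover have "(+) (- h) ` (+) h ` A = A" by (simp add: image_image)
  ultimately show ?thesis by metis
qed

lemma bounded_translate: "bounded ((+) (h::real) ` A) \<longleftrightarrow> bounded A"
proof -
  have "(+) (- h) ` (+) h ` A = A" by (simp add: image_image)
  then show ?thesis using bounded_translation by metis
qed

lemma mshift_mshift: "mshift h (mshift k m) = mshift (h + k) m"
  by (auto simp: mshift_def image_image add.assoc add.left_commute)

lemma mshift_0 [simp]: "mshift 0 m = m"
  by (simp add: mshift_def)

lemma mshift_Mloc:
  assumes m: "m \<in> Mloc UNIV"
  shows "mshift h m \<in> Mloc UNIV"
proof -
  have "(\<lambda>i. m ((+) h ` F i)) sums m ((+) h ` (\<Union>i. F i))"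
    if "range F \<subseteq> sets borel" "disjoint_family F" "bounded (\<Union>i. F i)" for F :: "nat \<Rightarrow> real set"
  proof -
    have "(\<lambda>i. m ((+) h ` F i)) sums m (\<Union>i. (+) h ` F i)"
    proof (rule Mloc_sums[OF m])
      show "range (\<lambda>i. (+) h ` F i) \<subseteq> sets borel" using that(1) borel_translate by blast
      show "disjoint_family (\<lambda>i. (+) h ` F i)"
        using that(2) by (auto simp: disjoint_family_on_def) blast
      show "bounded (\<Union>i. (+) h ` F i)" using that(3) bounded_translate by (metis image_UN)
    qed simp
    then show ?thesis by (simp add: image_UN)
  qed
  moreover have "total_variation (mshift h m) ({a..b} \<inter> UNIV) < \<infinity>" for a b
    using Mloc_TV_finite[OF m] by (simp add: total_variation_mshift)
  moreover have "m ((+) h ` A) = 0" if "\<not> (A \<in> sets borel \<and> bounded A)" for A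
  proof -
    have z: "m B = 0" if "\<not> (B \<in> sets borel \<and> bounded B)" for B
      using m that unfolding Mloc_def mem_Collect_eq by (metis subset_UNIV)
    show ?thesis by (rule z) (use that in \<open>simp only: borel_translate bounded_translate simp_thms\<close>)
  qed
  ultimately show ?thesis unfolding Mloc_def mshift_def by (simp only: mem_Collect_eq subset_UNIV simp_thms) blast
qed

lemma simple_vm_integral_mshift:
  "simple_vm_integral f (mshift h m) = simple_vm_integral (\<lambda>s. f (s - h)) m"
proof -
  have "range (\<lambda>s. f (s - h)) = range f"
  proof -
    have "surj (\<lambda>s. s - h)" by (rule surjI[of _ "\<lambda>s. s + h"]) simp
    moreover have "range (\<lambda>s. f (s - h)) = f ` range (\<lambda>s. s - h)" by (simp only: image_image)
    ultimately show ?thesis by (simp only:)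
  qed
  moreover have "(+) h ` {s. f s = y} = {s. f (s - h) = y}" for y
    by (force simp: image_iff)
  ultimately show ?thesis unfolding simple_vm_integral_def mshift_def by simp
qed

lemma Cc_translate:
  assumes "\<psi> \<in> Cc"
  shows "(\<lambda>s. \<psi> (s - h)) \<in> Cc"
proof -
  have "continuous_on (range (\<lambda>s. s - h)) \<psi>"
    using assms by (auto simp: Cc_def intro: continuous_on_subset)
  then have "continuous_on UNIV (\<psi> \<circ> (\<lambda>s. s - h))"
    by (intro continuous_on_compose continuous_intros)
  then have "continuous_on UNIV (\<lambda>s. \<psi> (s - h))" by (simp only: comp_def)
  moreover have "{s. \<psi> (s - h) \<noteq> 0} = (+) h ` {s. \<psi> s \<noteq> 0}"
    by (force simp: image_iff)
  moreover have "bounded {s. \<psi> s \<noteq> 0}"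
    using assms compact_imp_bounded bounded_subset closure_subset unfolding Cc_def by blast
  ultimately show ?thesis unfolding Cc_def mem_Collect_eq compact_closure
    by (simp only: bounded_translate)
qed

lemma vm_integral_mshift:
  assumes m: "m \<in> Mloc UNIV" and \<psi>: "\<psi> \<in> Cc"
  shows "vm_integral \<psi> (mshift h m) = vm_integral (\<lambda>s. \<psi> (s - h)) m"
proof -
  obtain f where f: "simple_approx f \<psi>" using simple_approx_exists[OF \<psi>] by blast
  have "simple_approx (\<lambda>n s. f n (s - h)) (\<lambda>s. \<psi> (s - h))"
    unfolding simple_approx_def
  proof (intro conjI allI)
    fix n
    have "simple_function borel (f n)" using f by (simp add: simple_approx_def)
    then show "simple_function borel (\<lambda>s. f n (s - h))"
      using simple_function_comp[of "\<lambda>s. s - h" borel borel "f n"] by (simp add: comp_def)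
  next
    obtain R where "\<forall>n s. R < \<bar>s\<bar> \<longrightarrow> f n s = 0" using f unfolding simple_approx_def by blast
    then show "\<exists>R. \<forall>n s. R < \<bar>s\<bar> \<longrightarrow> f n (s - h) = 0"
      by (intro exI[of _ "R + \<bar>h\<bar>"]) auto
  next
    show "uniform_limit UNIV (\<lambda>n s. f n (s - h)) (\<lambda>s. \<psi> (s - h)) sequentially"
      using f unfolding simple_approx_def uniform_limit_iff by (auto elim!: eventually_mono)
  qed
  from vm_integral_well_defined[OF m Cc_translate[OF \<psi>] this]
    vm_integral_well_defined[OF mshift_Mloc[OF m] \<psi> f]
  show ?thesis unfolding simple_vm_integral_mshift by (metis LIMSEQ_unique)
qed

lemma continuous_map_mshift:
  "continuous_map (Mloc_wstar :: (real set \<Rightarrow> 'h::real_normed_vector) topology) Mloc_wstar (mshift h)"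
proof -
  have "continuous_map (Mloc_wstar :: (real set \<Rightarrow> 'h) topology)
      (initial_topology (Mloc UNIV) (vm_integral ` Cc)) (mshift h)"
  proof (rule continuous_map_into_initial_topology)
    fix f :: "(real set \<Rightarrow> 'h) \<Rightarrow> real" assume "f \<in> vm_integral ` Cc"
    then obtain \<psi> where \<psi>: "\<psi> \<in> Cc" "f = vm_integral \<psi>" by blast
    show "continuous_map Mloc_wstar euclideanreal (\<lambda>m::real set \<Rightarrow> 'h. f (mshift h m))"
      by (rule continuous_map_eq[OF continuous_map_vm_integral[OF Cc_translate[OF \<psi>(1), of h]]])
        (simp add: \<psi> vm_integral_mshift)
  qed (use Cc_nonempty in \<open>auto intro: mshift_Mloc\<close>)
  then show ?thesis by (simp add: Mloc_wstar_def)
qed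

lemma mhull_subset: "mhull m \<subseteq> Mloc UNIV"
  unfolding mhull_def using closure_of_subset_topspace[of Mloc_wstar] by simp

lemma mshift_mhull:
  assumes "\<nu> \<in> mhull m"
  shows "mshift h \<nu> \<in> mhull m"
proof -
  have "mshift h ` mhull m \<subseteq> Mloc_wstar closure_of (mshift h ` range (\<lambda>h. mshift h m))"
    unfolding mhull_def by (rule continuous_map_image_closure_subset[OF continuous_map_mshift])
  also have "mshift h ` range (\<lambda>h. mshift h m) \<subseteq> range (\<lambda>h. mshift h m)"
    by (auto simp: mshift_mshift)
  then have "Mloc_wstar closure_of (mshift h ` range (\<lambda>h. mshift h m)) \<subseteq> mhull m"
    unfolding mhull_def by (rule closure_of_mono)
  finally show ?thesis using assms by blast
qed

lemma mem_mhull: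
  assumes "m \<in> Mloc UNIV"
  shows "m \<in> mhull m"
proof -
  have "range (\<lambda>h. mshift h m) \<subseteq> topspace Mloc_wstar" using mshift_Mloc[OF assms] by auto
  then have "range (\<lambda>h. mshift h m) \<subseteq> mhull m"
    unfolding mhull_def by (rule closure_of_subset)
  then show ?thesis by (metis mshift_0 rangeI subsetD)
qed

section \<open>Vector measures with a given distribution function\<close>

lemma total_variation_mono: "A \<subseteq> B \<Longrightarrow> total_variation m A \<le> total_variation m B"
  unfolding total_variation_def by (rule SUP_subset_mono) auto

lemma norm_le_total_variation:
  "B \<in> sets borel \<Longrightarrow> B \<subseteq> A \<Longrightarrow> ennreal (norm (m B)) \<le> total_variation m A"
  unfolding total_variation_def by (rule SUP_upper2[of "{B}"]) auto

lemma total_variation_superadditive: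
  assumes "m {} = 0" "B \<in> sets borel" "A \<inter> B = {}" "A \<union> B \<subseteq> C"
  shows "total_variation m A + ennreal (norm (m B)) \<le> total_variation m C"
proof -
  have "total_variation m A + ennreal (norm (m B)) = (SUP P\<in>{P. finite P \<and> disjoint P \<and> (\<forall>B\<in>P. B \<in> sets borel \<and> B \<subseteq> A)}.
      (\<Sum>B\<in>P. ennreal (norm (m B))) + ennreal (norm (m B)))"
    unfolding total_variation_def
    by (rule ennreal_SUP_add_left[symmetric]) (auto intro!: exI[of _ "{}"])
  also have "\<dots> \<le> total_variation m C"
  proof (rule SUP_least, elim CollectE conjE)
    fix P assume P: "finite P" "disjoint P" "\<forall>B\<in>P. B \<in> sets borel \<and> B \<subseteq> A"
    show "(\<Sum>B\<in>P. ennreal (norm (m B))) + ennreal (norm (m B)) \<le> total_variation m C"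
    \<comment> \<open>The empty set may already belong to \<open>P\<close>, in which case
      \<open>insert\<close> adds no summand.\<close>
    proof (cases "B = {}")
      case True
      have "(\<Sum>B\<in>P. ennreal (norm (m B))) \<le> total_variation m C"
        unfolding total_variation_def by (rule SUP_upper) (use P assms(4) in auto)
      then show ?thesis using True assms(1) by simp
    next
      case False
      then have "B \<notin> P" using P(3) assms(3) by blast
      moreover have "disjoint (insert B P)"
        using P(2,3) assms(3) unfolding disjoint_def by blast
      then have "(\<Sum>B\<in>insert B P. ennreal (norm (m B))) \<le> total_variation m C"
        unfolding total_variation_def by (intro SUP_upper) (use P assms in auto)
      ultimately show ?thesis using P(1) by (metis add.commute sum.insert)
    qed
  qed
  finally show ?thesis .
qed

lemma total_variation_subadditive:
  assumes m: "m \<in> Mloc UNIV" and AB: "A \<in> sets borel" "B \<in> sets borel" "bounded A" "bounded B" "A \<inter> B = {}"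
  shows "total_variation m (A \<union> B) \<le> total_variation m A + total_variation m B"
proof (subst total_variation_def, rule SUP_least, elim CollectE conjE)
  fix P assume P: "finite P" "disjoint P" "\<forall>C\<in>P. C \<in> sets borel \<and> C \<subseteq> A \<union> B"
  have disj: "disjoint_family_on (\<lambda>C. C \<inter> D) P" for D
    using P(2) unfolding disjoint_family_on_def disjoint_def by blast
  have "(\<Sum>C\<in>P. ennreal (norm (m C))) \<le> (\<Sum>C\<in>P. ennreal (norm (m (C \<inter> A))) + ennreal (norm (m (C \<inter> B))))"
  proof (rule sum_mono)
    fix C assume C: "C \<in> P"
    have "m ((C \<inter> A) \<union> (C \<inter> B)) = m (C \<inter> A) + m (C \<inter> B)"
      using C P(3) AB by (intro cab_Un[OF cab_Mloc[OF m]]) auto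
    moreover have "(C \<inter> A) \<union> (C \<inter> B) = C" using C P(3) by auto
    ultimately have "norm (m C) \<le> norm (m (C \<inter> A)) + norm (m (C \<inter> B))"
      by (metis norm_triangle_ineq)
    then show "ennreal (norm (m C)) \<le> ennreal (norm (m (C \<inter> A))) + ennreal (norm (m (C \<inter> B)))"
      by (simp add: ennreal_plus[symmetric] del: ennreal_plus)
  qed
  also have "\<dots> = (\<Sum>C\<in>P. ennreal (norm (m (C \<inter> A)))) + (\<Sum>C\<in>P. ennreal (norm (m (C \<inter> B))))"
    by (rule sum.distrib)
  also have "\<dots> \<le> total_variation m A + total_variation m B"
    using P AB by (intro add_mono sum_norm_le_total_variation disj Mloc_empty[OF m]) auto
  finally show "(\<Sum>C\<in>P. ennreal (norm (m C))) \<le> total_variation m A + total_variation m B" .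
qed

lemma emeasure_interval_measure_bounded:
  assumes W: "mono W" "\<And>a. continuous (at_right a) W" and A: "bounded A" "A \<in> sets borel"
  shows "emeasure (interval_measure W) A < \<infinity>"
proof -
  obtain R where "A \<subseteq> {-R<..R}" using bounded_subset_Ioc[OF A(1)] by blast
  then have "emeasure (interval_measure W) A \<le> emeasure (interval_measure W) {-R<..R}"
    by (intro emeasure_mono) auto
  also have "\<dots> < \<infinity>"
    using W by (subst emeasure_interval_measure_Ioc_eq) (auto simp: monoD)
  finally show ?thesis .
qed

lemma cab_interval_measure:
  assumes "mono W" "\<And>a. continuous (at_right a) W"
  shows "countably_additive_bounded (\<lambda>A. measure (interval_measure W) A)"
  using assms by (intro cab_measure emeasure_interval_measure_bounded) auto

text \<open>A pointwise limit of variation functions is monotone but need not be right-continuous,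
  as \<open>interval_measure\<close> requires. The last two inequalities keep G' between G and
  values of G further to the right, so bounds in terms of G survive.\<close>

lemma mono_right_regularization:
  fixes G :: "real \<Rightarrow> real"
  assumes "mono G"
  obtains G' where "mono G'" "\<And>t. continuous (at_right t) G'"
    "\<And>t. (G \<longlongrightarrow> G' t) (at_right t)" "\<And>t. G t \<le> G' t" "\<And>t s. t < s \<Longrightarrow> G' t \<le> G s"
proof -
  define G' where "G' t = Inf (G ` {t<..})" for t
  have bdd: "bdd_below (G ` {t<..})" for t
    using assms by (intro bdd_belowI[of _ "G t"]) (auto simp: mono_def)
  have up: "G' t \<le> G s" if "t < s" for t s
    unfolding G'_def using bdd that by (intro cINF_lower) auto
  have low: "G t \<le> G' t" for t
    unfolding G'_def using assms by (intro cINF_greatest) (auto simp: mono_def)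
  have mono': "mono G'"
  proof (rule monoI)
    fix x y :: real assume "x \<le> y"
    show "G' x \<le> G' y"
      unfolding G'_def[of y] using up \<open>x \<le> y\<close> by (intro cINF_greatest) auto
  qed
  have near: "\<exists>s>t. G s < G' t + e" if "e > 0" for t e
  proof (rule ccontr)
    assume "\<not> ?thesis"
    then have "G' t + e \<le> G s" if "t < s" for s using that by force
    then have "G' t + e \<le> Inf (G ` {t<..})" by (intro cINF_greatest) auto
    then have "G' t + e \<le> G' t" by (simp only: G'_def)
    with that show False by simp
  qed
  have squeeze: "(f \<longlongrightarrow> G' t) (at_right t)"
    if f: "\<And>u s. t < u \<Longrightarrow> u < s \<Longrightarrow> G' t \<le> f u \<and> f u \<le> G s" for f t
  proof (rule tendstoI)
    fix e :: real assume "e > 0"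
    then obtain s where s: "t < s" "G s < G' t + e" using near by blast
    have "dist (f u) (G' t) < e" if "t < u" "u < s" for u
      using f[OF that] s by (simp add: dist_real_def)
    then show "\<forall>\<^sub>F u in at_right t. dist (f u) (G' t) < e"
      unfolding eventually_at_right_field using s by blast
  qed
  have "continuous (at_right t) G'" for t
    unfolding continuous_within using up monoD[OF mono'] by (intro squeeze) auto
  moreover have "(G \<longlongrightarrow> G' t) (at_right t)" for t
    using up assms by (intro squeeze) (auto simp: mono_def)
  ultimately show thesis using that mono' up low by blast
qed

text \<open>The scalar function F _ \<phi> is not monotone, but by the domination it becomes so
  after adding norm \<phi> times G'. The Stieltjes measure of the sum, minus norm \<phi> times that
  of G', is the signed measure \<open>n \<phi>\<close>. Domination also makes
  \<open>n \<phi> A\<close> a bounded linear functional of \<phi>, and reflexivity turns it into the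
  vector \<open>m A\<close>.\<close>

lemma measure_of_distribution_function:
  fixes F :: "real \<Rightarrow> ('h::banach \<Rightarrow>\<^sub>L real) \<Rightarrow> real" and G :: "real \<Rightarrow> real"
  assumes reflexive: "reflexive_space TYPE('h)"
    and lin: "\<And>t \<phi> \<psi>. F t (\<phi> + \<psi>) = F t \<phi> + F t \<psi>" "\<And>t k \<phi>. F t (k *\<^sub>R \<phi>) = k * F t \<phi>"
    and G: "mono G"
    and dom: "\<And>a b \<phi>. a \<le> b \<Longrightarrow> \<bar>F b \<phi> - F a \<phi>\<bar> \<le> norm \<phi> * (G b - G a)"
    and cont: "\<And>t \<phi>. ((\<lambda>s. F s \<phi>) \<longlongrightarrow> F t \<phi>) (at_right t)"
  shows "\<exists>m \<in> Mloc UNIV. (\<forall>a b \<phi>. a \<le> b \<longrightarrow> blinfun_apply \<phi> (m {a<..b}) = F b \<phi> - F a \<phi>) \<and>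
     (\<forall>R\<ge>0. total_variation m {-R..R} \<le> ennreal (G (R + 1) - G (- R - 1)))"
proof -
  obtain G' where G': "mono G'" "\<And>t. continuous (at_right t) G'"
    "\<And>t. (G \<longlongrightarrow> G' t) (at_right t)" "\<And>t. G t \<le> G' t" "\<And>t s. t < s \<Longrightarrow> G' t \<le> G s"
    using mono_right_regularization[OF G] by metis
  \<comment> \<open>Both endpoints are moved right by d and d tends to 0: the values of F converge
    to F itself by right continuity, those of G to its regularization.\<close>
  have dom': "\<bar>F b \<phi> - F a \<phi>\<bar> \<le> norm \<phi> * (G' b - G' a)" if "a \<le> b" for a b \<phi>
  proof (rule tendsto_le)
    have F0: "((\<lambda>d. F (d + t) \<phi>) \<longlongrightarrow> F t \<phi>) (at_right 0)" for t
      using cont[of \<phi> t] by (subst (asm) filterlim_at_right_to_0)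
    have G0: "((\<lambda>d. G (d + t)) \<longlongrightarrow> G' t) (at_right 0)" for t
      using G'(3)[of t] by (subst (asm) filterlim_at_right_to_0)
    show "((\<lambda>d. \<bar>F (d + b) \<phi> - F (d + a) \<phi>\<bar>) \<longlongrightarrow> \<bar>F b \<phi> - F a \<phi>\<bar>) (at_right 0)"
      by (intro tendsto_intros F0)
    show "((\<lambda>d. norm \<phi> * (G (d + b) - G (d + a))) \<longlongrightarrow> norm \<phi> * (G' b - G' a)) (at_right 0)"
      by (intro tendsto_intros G0)
  qed (use that dom in auto)
  define W where "W \<phi> t = norm \<phi> * G' t + F t \<phi>" for \<phi> t
  have W: "mono (W \<phi>)" "continuous (at_right a) (W \<phi>)" for \<phi> a
  proof -
    show "mono (W \<phi>)"
    proof (rule monoI)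
      fix x y :: real assume "x \<le> y"
      from dom'[OF this, of \<phi>] show "W \<phi> x \<le> W \<phi> y" by (simp add: W_def algebra_simps)
    qed
    show "continuous (at_right a) (W \<phi>)"
      unfolding W_def continuous_within
      by (intro tendsto_intros cont) (use G'(2)[of a] in \<open>simp add: continuous_within\<close>)
  qed
  define V where "V = interval_measure G'"
  define v where "v A = measure V A" for A
  have v: "countably_additive_bounded v"
    unfolding v_def V_def by (rule cab_interval_measure[OF G'(1,2)])
  have ev: "emeasure V A = ennreal (v A)" if "A \<in> sets borel" "bounded A" for A
    unfolding v_def V_def using emeasure_interval_measure_bounded[OF G'(1,2) that(2,1)]
    by (intro emeasure_eq_ennreal_measure) auto
  define n where "n \<phi> A = measure (interval_measure (W \<phi>)) A - norm \<phi> * v A" for \<phi> A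
  have n: "countably_additive_bounded (n \<phi>)" for \<phi>
    unfolding n_def
    by (intro cab_diff cab_interval_measure[OF W] cab_bounded_linear[OF _ v] bounded_linear_mult_right)
  have nI: "n \<phi> {a<..b} = F b \<phi> - F a \<phi>" if "a \<le> b" for \<phi> a b
  proof -
    have "v {a<..b} = G' b - G' a"
      unfolding v_def V_def using that G'(1,2) by (intro measure_interval_measure_Ioc) (auto simp: mono_def)
    moreover have "measure (interval_measure (W \<phi>)) {a<..b} = W \<phi> b - W \<phi> a"
      using that W by (intro measure_interval_measure_Ioc) (auto intro: monoD)
    ultimately show ?thesis unfolding n_def W_def by (simp add: right_diff_distrib)
  qed
  have n_add: "n (\<phi> + \<psi>) A = n \<phi> A + n \<psi> A" if "A \<in> sets borel" "bounded A" for \<phi> \<psi> A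
    by (rule cab_eq_if_eq_Ioc[OF n cab_add[OF n n] _ that]) (simp add: nI lin)
  have n_scale: "n (k *\<^sub>R \<phi>) A = k * n \<phi> A" if "A \<in> sets borel" "bounded A" for \<phi> k A
    by (rule cab_eq_if_eq_Ioc[OF n cab_bounded_linear[OF bounded_linear_mult_right n] _ that])
      (simp add: nI lin algebra_simps)
  have n_bound: "\<bar>n \<phi> A\<bar> \<le> norm \<phi> * v A" if "A \<in> sets borel" "bounded A" for \<phi> A
  proof -
    \<comment> \<open>Nonnegativity of the Stieltjes measure of \<open>W \<psi>\<close>. The upper
      bound for \<phi> is this lower bound for -\<phi>.\<close>
    have low: "- (norm \<psi> * v A) \<le> n \<psi> A" for \<psi> by (simp add: n_def)
    have "n (- \<phi>) A = - n \<phi> A" using n_scale[OF that, of "-1" \<phi>] by simp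
    then show ?thesis using low[of \<phi>] low[of "- \<phi>"] by simp
  qed
  have "\<exists>x. \<forall>\<phi>. blinfun_apply \<phi> x = n \<phi> A" if "A \<in> sets borel" "bounded A" for A
  proof -
    have "bounded_linear (\<lambda>\<phi>. n \<phi> A)"
      by (rule bounded_linear_intro[where K = "v A"])
        (use n_add[OF that] n_scale[OF that] n_bound[OF that] in \<open>auto simp: mult.commute\<close>)
    then have "blinfun_apply (Blinfun (\<lambda>\<phi>. n \<phi> A)) = (\<lambda>\<phi>. n \<phi> A)"
      by (rule bounded_linear_Blinfun_apply)
    then show ?thesis using reflexive unfolding reflexive_space_def by metis
  qed
  then obtain m0 where m0: "\<And>A \<phi>. A \<in> sets borel \<Longrightarrow> bounded A \<Longrightarrow> blinfun_apply \<phi> (m0 A) = n \<phi> A"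
    by metis
  define m where "m A = (if A \<in> sets borel \<and> bounded A then m0 A else 0)" for A
  have m: "blinfun_apply \<phi> (m A) = n \<phi> A" if "A \<in> sets borel" "bounded A" for A \<phi>
    using m0[OF that] that by (simp add: m_def)
  have m_le: "norm (m A) \<le> v A" if "A \<in> sets borel" "bounded A" for A
  proof (rule norm_le_if_functionals_le)
    fix \<phi>
    show "blinfun_apply \<phi> (m A) \<le> v A * norm \<phi>"
      using n_bound[OF that, of \<phi>] m[OF that, of \<phi>] by (simp add: mult.commute)
  qed (simp add: v_def)
  have TV: "total_variation m A \<le> emeasure V A" if A: "A \<in> sets borel" "bounded A" for A
    unfolding total_variation_def
  proof (rule SUP_least, elim CollectE conjE)
    fix P assume P: "finite P" "disjoint P" "\<forall>B\<in>P. B \<in> sets borel \<and> B \<subseteq> A"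
    have "(\<Sum>B\<in>P. ennreal (norm (m B))) \<le> (\<Sum>B\<in>P. emeasure V B)"
    proof (rule sum_mono)
      fix B assume "B \<in> P"
      then have B: "B \<in> sets borel" "bounded B" using P(3) A(2) by (auto intro: bounded_subset)
      show "ennreal (norm (m B)) \<le> emeasure V B"
        unfolding ev[OF B] by (intro ennreal_leI m_le B)
    qed
    also have "\<dots> = emeasure V (\<Union>B\<in>P. B)"
      using P by (intro sum_emeasure) (auto simp: V_def disjoint_family_on_def disjoint_def)
    also have "\<dots> \<le> emeasure V A"
      using P A by (intro emeasure_mono) (auto simp: V_def)
    finally show "(\<Sum>B\<in>P. ennreal (norm (m B))) \<le> emeasure V A" .
  qed
  have sums: "(\<lambda>i. m (A i)) sums m (\<Union>i. A i)"
    if A: "range A \<subseteq> sets borel" "disjoint_family A" "bounded (\<Union>i. A i)" for A :: "nat \<Rightarrow> real set"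
  proof -
    have Ai: "A i \<in> sets borel" "bounded (A i)" for i
      using A by (auto intro: bounded_subset)
    have U: "(\<Union>i. A i) \<in> sets borel" using A(1) by auto
    \<comment> \<open>Functionals alone would give only weak countable additivity. Domination by v
      gives norm convergence of the series, and functionals then merely identify its sum.\<close>
    have "summable (\<lambda>i. v (A i))"
      using cab_sums[OF v A] by (rule sums_summable)
    then have "summable (\<lambda>i. m (A i))"
      by (rule summable_comparison_test'[where N = 0]) (use m_le Ai in auto)
    then have s: "(\<lambda>i. m (A i)) sums (\<Sum>i. m (A i))" by (rule summable_sums)
    have "(\<Sum>i. m (A i)) = m (\<Union>i. A i)"
    proof (rule functionals_separate)
      fix \<phi> :: "'h \<Rightarrow>\<^sub>L real"
      have "(\<lambda>i. blinfun_apply \<phi> (m (A i))) sums blinfun_apply \<phi> (\<Sum>i. m (A i))"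
        by (rule bounded_linear.sums[OF blinfun.bounded_linear_right s])
      moreover have "(\<lambda>i. blinfun_apply \<phi> (m (A i))) sums blinfun_apply \<phi> (m (\<Union>i. A i))"
        using cab_sums[OF n A, of \<phi>] by (simp add: m Ai U A(3))
      ultimately show "blinfun_apply \<phi> (\<Sum>i. m (A i)) = blinfun_apply \<phi> (m (\<Union>i. A i))"
        by (rule sums_unique2)
    qed
    with s show ?thesis by simp
  qed
  have "m \<in> Mloc UNIV"
  proof -
    have "total_variation m {a..b} < \<infinity>" for a b
      by (rule le_less_trans[OF TV]) (auto simp: ev)
    then show ?thesis
      unfolding Mloc_def mem_Collect_eq using sums by (auto simp: m_def)
  qed
  moreover have "blinfun_apply \<phi> (m {a<..b}) = F b \<phi> - F a \<phi>" if "a \<le> b" for \<phi> a b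
    by (subst m) (auto simp: nI that)
  moreover have "total_variation m {-R..R} \<le> ennreal (G (R + 1) - G (- R - 1))" if "R \<ge> 0" for R
  proof -
    have "total_variation m {-R..R} \<le> emeasure V {-R..R}" by (rule TV) auto
    \<comment> \<open>The closed endpoint -R forces a start further left, and G' at R is bounded by
      G only strictly to the right of R; hence the margins of 1 on both sides.\<close>
    also have "\<dots> \<le> emeasure V {-R-1<..R}" by (rule emeasure_mono) (auto simp: V_def)
    also have "\<dots> = ennreal (G' R - G' (- R - 1))"
      unfolding V_def using that G'(1,2)
      by (intro emeasure_interval_measure_Ioc) (auto simp: mono_def)
    also have "\<dots> \<le> ennreal (G (R + 1) - G (- R - 1))"
      using G'(4)[of "-R-1"] G'(5)[of R "R + 1"] by (intro ennreal_leI) simp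
    finally show ?thesis .
  qed
  ultimately show ?thesis by blast
qed

text \<open>Uses half-open intervals instead of the general level sets in
  \<open>simple_approx\<close>, because a limit of measures is controlled on such intervals only.
  The support bound R1 does not grow as d shrinks.\<close>

lemma step_approximation:
  fixes \<psi> :: "real \<Rightarrow> 'h::real_normed_vector \<Rightarrow>\<^sub>L real"
  assumes "\<psi> \<in> Cc"
  obtains R1 where "\<And>d. d > 0 \<Longrightarrow> \<exists>(S :: int set) x y c. finite S \<and> (\<forall>k. x k \<le> y k) \<and>
      (\<forall>s. norm ((\<Sum>k\<in>S. indicator {x k<..y k} s *\<^sub>R c k) - \<psi> s) \<le> d) \<and>
      (\<forall>s. R1 < \<bar>s\<bar> \<longrightarrow> (\<Sum>k\<in>S. indicator {x k<..y k} s *\<^sub>R c k) = 0)"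
proof -
  obtain R0 where R0: "\<And>s. \<psi> s \<noteq> 0 \<Longrightarrow> \<bar>s\<bar> \<le> R0"
  proof -
    have "bounded {s. \<psi> s \<noteq> 0}"
      using assms compact_imp_bounded bounded_subset closure_subset unfolding Cc_def by blast
    then show thesis using that by (auto simp: bounded_iff)
  qed
  \<comment> \<open>An integral radius is a multiple of every mesh size 1/n, so the cells fill
    {-R<..R} exactly.\<close>
  define R where "R = \<lceil>\<bar>R0\<bar>\<rceil> + 1"
  have R: "\<bar>R0\<bar> < of_int R" unfolding R_def by linarith
  then have R_pos: "0 \<le> R" by linarith
  define K where "K = {- of_int R .. of_int R :: real}"
  have uc: "uniformly_continuous_on K \<psi>"
    using assms unfolding Cc_def K_def
    by (auto intro!: compact_uniformly_continuous intro: continuous_on_subset)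
  show thesis
  proof (rule that)
    fix d :: real assume "d > 0"
    then obtain \<delta> where \<delta>: "\<delta> > 0"
        "\<And>x y. x \<in> K \<Longrightarrow> y \<in> K \<Longrightarrow> dist y x < \<delta> \<Longrightarrow> dist (\<psi> y) (\<psi> x) < d"
      using uc unfolding uniformly_continuous_on_def by metis
    obtain N where N: "1 / real (Suc N) < \<delta>"
      using nat_approx_posE[OF \<delta>(1)] by blast
    define n where "n = int (Suc N)"
    have n: "n > 0" "1 / of_int n < \<delta>" using N by (simp_all add: n_def)
    define x y :: "int \<Rightarrow> real" where "x k = of_int k / of_int n" and "y k = of_int (k + 1) / of_int n" for k
    define c where "c k = \<psi> (y k)" for k
    define S where "S = {- (R * n)..<R * n}"
    \<comment> \<open>The cells are open on the left, so the cell containing s is found with the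
      ceiling and its index is one less.\<close>
    have mem: "s \<in> {x k<..y k} \<longleftrightarrow> k = \<lceil>s * of_int n\<rceil> - 1" for s k
    proof -
      have "s \<in> {x k<..y k} \<longleftrightarrow> of_int k < s * of_int n \<and> s * of_int n \<le> of_int k + 1"
        unfolding x_def y_def using n(1) by (simp add: field_simps)
      also have "\<dots> \<longleftrightarrow> \<lceil>s * of_int n\<rceil> = k + 1" by (simp add: ceiling_eq_iff)
      finally show ?thesis by auto
    qed
    define f where "f s = (\<Sum>k\<in>S. indicator {x k<..y k} s *\<^sub>R c k)" for s
    have f: "f s = (if \<lceil>s * of_int n\<rceil> - 1 \<in> S then \<psi> (of_int \<lceil>s * of_int n\<rceil> / of_int n) else 0)" for s
    proof -
      have "f s = (\<Sum>k\<in>S. if k = \<lceil>s * of_int n\<rceil> - 1 then c k else 0)"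
        unfolding f_def by (rule sum.cong[OF refl]) (simp add: indicator_def mem del: greaterThanAtMost_iff)
      also have "\<dots> = (if \<lceil>s * of_int n\<rceil> - 1 \<in> S then c (\<lceil>s * of_int n\<rceil> - 1) else 0)"
        by (rule sum.delta) (simp add: S_def)
      finally show ?thesis by (simp add: c_def y_def)
    qed
    have inS: "\<lceil>s * of_int n\<rceil> - 1 \<in> S \<longleftrightarrow> - of_int R < s \<and> s \<le> of_int R" for s :: real
    proof -
      have "\<lceil>s * of_int n\<rceil> - 1 \<in> S \<longleftrightarrow> - R * n < \<lceil>s * of_int n\<rceil> \<and> \<lceil>s * of_int n\<rceil> \<le> R * n"
        unfolding S_def by auto
      also have "\<dots> \<longleftrightarrow> of_int (- R * n) < s * of_int n \<and> s * of_int n \<le> of_int (R * n)"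
        by (simp only: less_ceiling_iff ceiling_le_iff)
      also have "\<dots> \<longleftrightarrow> - of_int R < s \<and> s \<le> of_int R"
        unfolding of_int_mult of_int_minus using n(1) by (simp only: mult_less_cancel_right_pos mult_le_cancel_right_pos of_int_0_less_iff)
      finally show ?thesis .
    qed
    have "norm (f s - \<psi> s) \<le> d" for s
    proof (cases "- of_int R < s \<and> s \<le> of_int R")
      case True
      define q where "q = of_int \<lceil>s * of_int n\<rceil> / (of_int n :: real)"
      have fq: "f s = \<psi> q" using True inS f by (simp add: q_def)
      have c: "s * of_int n \<le> of_int \<lceil>s * of_int n\<rceil>" "of_int \<lceil>s * of_int n\<rceil> < s * of_int n + 1"
        by linarith+
      have "s \<le> q" "q < s + 1 / of_int n"
        unfolding q_def using c n(1) by (simp_all add: field_simps)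
      moreover have "q \<le> of_int R"
      proof -
        have "s * of_int n \<le> of_int (R * n)" using True n(1) by simp
        then have "\<lceil>s * of_int n\<rceil> \<le> R * n" by (simp only: ceiling_le_iff)
        then have "(of_int \<lceil>s * of_int n\<rceil> :: real) \<le> of_int (R * n)" by (simp only: of_int_le_iff)
        then show ?thesis unfolding q_def using n(1) by (simp add: field_simps)
      qed
      ultimately have "dist (\<psi> q) (\<psi> s) < d"
        using True n(2) by (intro \<delta>(2)) (auto simp: K_def dist_real_def)
      then show ?thesis unfolding fq by (simp add: dist_norm)
    next
      case False
      have "\<psi> s = 0"
      proof (rule ccontr)
        assume "\<psi> s \<noteq> 0"
        then have "\<bar>s\<bar> \<le> R0" by (rule R0)
        with R False show False by linarith
      qed
      moreover have "f s = 0" using False inS[of s] f[of s] by argo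
      ultimately show ?thesis using \<open>d > 0\<close> by simp
    qed
    moreover have "f s = 0" if "of_int R < \<bar>s\<bar>" for s
      using that inS[of s] f[of s] by auto
    moreover have "x k \<le> y k" for k
      unfolding x_def y_def using n(1) by (simp add: divide_right_mono)
    ultimately show "\<exists>(S :: int set) x y c. finite S \<and> (\<forall>k. x k \<le> y k) \<and>
      (\<forall>s. norm ((\<Sum>k\<in>S. indicator {x k<..y k} s *\<^sub>R c k) - \<psi> s) \<le> d) \<and>
      (\<forall>s. of_int R < \<bar>s\<bar> \<longrightarrow> (\<Sum>k\<in>S. indicator {x k<..y k} s *\<^sub>R c k) = 0)"
      unfolding f_def
      by (intro exI[of _ S] exI[of _ x] exI[of _ y] exI[of _ c]) (simp add: S_def)
  qed
qed

text \<open>The locally uniform variation bound makes p \<mapsto>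
  \<open>vm_integral \<psi> (\<Phi> p)\<close> a uniform limit on K of finite sums over half-open
  intervals, each continuous by hypothesis.\<close>

lemma continuous_on_vm_integral_family:
  fixes \<Phi> :: "'p::topological_space \<Rightarrow> real set \<Rightarrow> 'h::real_normed_vector"
  assumes \<psi>: "\<psi> \<in> Cc" and M: "\<And>p. p \<in> K \<Longrightarrow> \<Phi> p \<in> Mloc UNIV"
    and TV: "\<And>R. \<exists>V. \<forall>p\<in>K. total_variation (\<Phi> p) {-R..R} \<le> ennreal V"
    and cont: "\<And>(\<phi> :: 'h \<Rightarrow>\<^sub>L real) a b. a \<le> b \<Longrightarrow> continuous_on K (\<lambda>p. blinfun_apply \<phi> (\<Phi> p {a<..b}))"
  shows "continuous_on K (\<lambda>p. vm_integral \<psi> (\<Phi> p))"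
proof -
  obtain R0 where R0: "\<And>R f d m. R0 \<le> R \<Longrightarrow> m \<in> Mloc UNIV \<Longrightarrow> simple_function borel f \<Longrightarrow>
      (\<And>s. R < \<bar>s\<bar> \<Longrightarrow> f s = 0) \<Longrightarrow> (\<And>s. norm (f s - \<psi> s) \<le> d) \<Longrightarrow>
      \<bar>simple_vm_integral f m - vm_integral \<psi> m\<bar> \<le> d * enn2real (total_variation m {-R..R})"
    by (fact vm_integral_close[OF \<psi>])
  obtain R1 where R1: "\<And>d. d > 0 \<Longrightarrow> \<exists>(S :: int set) x y c. finite S \<and> (\<forall>k. x k \<le> y k) \<and>
      (\<forall>s. norm ((\<Sum>k\<in>S. indicator {x k<..y k} s *\<^sub>R c k) - \<psi> s) \<le> d) \<and>
      (\<forall>s. R1 < \<bar>s\<bar> \<longrightarrow> (\<Sum>k\<in>S. indicator {x k<..y k} s *\<^sub>R c k) = 0)"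
    by (fact step_approximation[OF \<psi>])
  define R where "R = max R0 R1"
  obtain V0 where V0: "\<And>p. p \<in> K \<Longrightarrow> total_variation (\<Phi> p) {-R..R} \<le> ennreal V0" using TV[of R] by blast
  define V where "V = max V0 0"
  have V: "enn2real (total_variation (\<Phi> p) {-R..R}) \<le> V" if "p \<in> K" for p
  proof -
    have "total_variation (\<Phi> p) {-R..R} \<le> ennreal V"
      using V0[OF that] by (rule order_trans) (simp add: V_def ennreal_leI)
    then show ?thesis by (simp add: enn2real_leI V_def)
  qed
  have approx: "\<exists>g. continuous_on K g \<and> (\<forall>p\<in>K. dist (g p) (vm_integral \<psi> (\<Phi> p)) < e)" if "e > 0" for e
  proof -
    define d where "d = e / (V + 1)"
    have d: "d > 0" using that by (simp add: d_def V_def)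
    from R1[OF d] obtain S :: "int set" and x y c where "finite S \<and> (\<forall>k. x k \<le> y k) \<and>
      (\<forall>s. norm ((\<Sum>k\<in>S. indicator {x k<..y k} s *\<^sub>R c k) - \<psi> s) \<le> d) \<and>
      (\<forall>s. R1 < \<bar>s\<bar> \<longrightarrow> (\<Sum>k\<in>S. indicator {x k<..y k} s *\<^sub>R c k) = 0)"
      by (elim exE) (rule that)
    then have S: "finite S" "\<And>k. x k \<le> y k"
      "\<And>s. norm ((\<Sum>k\<in>S. indicator {x k<..y k} s *\<^sub>R c k) - \<psi> s) \<le> d"
      "\<And>s. R1 < \<bar>s\<bar> \<Longrightarrow> (\<Sum>k\<in>S. indicator {x k<..y k} s *\<^sub>R c k) = 0"
      by blast+
    define g where "g p = (\<Sum>k\<in>S. blinfun_apply (c k) (\<Phi> p {x k<..y k}))" for p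
    have "continuous_on K g"
      unfolding g_def using S(2) by (intro continuous_on_sum cont)
    moreover have "dist (g p) (vm_integral \<psi> (\<Phi> p)) < e" if p: "p \<in> K" for p
    proof -
      have si: "simple_vm_integral (\<lambda>s. \<Sum>k\<in>S. indicator {x k<..y k} s *\<^sub>R c k) (\<Phi> p) = g p \<and>
          simple_function borel (\<lambda>s. \<Sum>k\<in>S. indicator {x k<..y k} s *\<^sub>R c k)"
        unfolding g_def by (rule simple_vm_integral_sum_indicator[OF M[OF p] S(1)]) auto
      have "\<bar>simple_vm_integral (\<lambda>s. \<Sum>k\<in>S. indicator {x k<..y k} s *\<^sub>R c k) (\<Phi> p) - vm_integral \<psi> (\<Phi> p)\<bar>
          \<le> d * enn2real (total_variation (\<Phi> p) {-R..R})"
      proof (rule R0)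
        show "R0 \<le> R" by (simp add: R_def)
        show "simple_function borel (\<lambda>s. \<Sum>k\<in>S. indicator {x k<..y k} s *\<^sub>R c k)" using si by blast
        show "(\<Sum>k\<in>S. indicator {x k<..y k} s *\<^sub>R c k) = 0" if "R < \<bar>s\<bar>" for s
          using S(4)[of s] that by (simp add: R_def)
      qed (use M p S in auto)
      then have "\<bar>g p - vm_integral \<psi> (\<Phi> p)\<bar> \<le> d * enn2real (total_variation (\<Phi> p) {-R..R})"
        using si by simp
      also have "\<dots> \<le> d * V" using V[OF p] d by (intro mult_left_mono) auto
      also have "\<dots> < e" using \<open>e > 0\<close> by (simp add: d_def V_def field_simps)
      finally show ?thesis by (simp add: dist_real_def)
    qed
    ultimately show ?thesis by blast
  qed
  have "\<forall>n. \<exists>g. continuous_on K g \<and> (\<forall>p\<in>K. dist (g p) (vm_integral \<psi> (\<Phi> p)) < 1 / real (Suc n))"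
    using approx by simp
  then obtain g where g: "\<And>n. continuous_on K (g n)"
    "\<And>n p. p \<in> K \<Longrightarrow> dist (g n p) (vm_integral \<psi> (\<Phi> p)) < 1 / real (Suc n)"
    by metis
  have "uniform_limit K g (\<lambda>p. vm_integral \<psi> (\<Phi> p)) sequentially"
  proof (rule uniform_limitI)
    fix e :: real assume "e > 0"
    have "\<forall>\<^sub>F n in sequentially. 1 / real (Suc n) < e"
      using \<open>e > 0\<close> LIMSEQ_inverse_real_of_nat
      by (auto simp: inverse_eq_divide intro: order_tendstoD(2))
    then show "\<forall>\<^sub>F n in sequentially. \<forall>p\<in>K. dist (g n p) (vm_integral \<psi> (\<Phi> p)) < e"
      by eventually_elim (use g(2) less_trans in blast)
  qed
  then show ?thesis
    by (rule uniform_limit_theorem[rotated]) (use g(1) in auto)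
qed

section \<open>Variation over long intervals; distribution and variation functions\<close>

lemma total_variation_Ioc_le:
  assumes m: "m \<in> Mloc UNIV" and M: "\<And>t. total_variation m {t..t+1} \<le> ennreal M" "M \<ge> 0"
  shows "total_variation m {t<..t + real N} \<le> ennreal (real N * M)"
proof (induction N)
  case 0
  have "total_variation m {} \<le> 0"
    unfolding total_variation_def
  proof (rule SUP_least, elim CollectE conjE)
    fix P assume P: "\<forall>B\<in>P. B \<in> sets borel \<and> B \<subseteq> ({} :: real set)"
    then have "(\<Sum>B\<in>P. ennreal (norm (m B))) = 0"
      using Mloc_empty[OF m] by (intro sum.neutral) auto
    then show "(\<Sum>B\<in>P. ennreal (norm (m B))) \<le> 0" by simp
  qed
  then show ?case by simp
next
  case (Suc N)
  have "{t<..t + real (Suc N)} = {t<..t + real N} \<union> {t + real N<..t + real N + 1}" by auto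
  then have "total_variation m {t<..t + real (Suc N)}
      \<le> total_variation m {t<..t + real N} + total_variation m {t + real N<..t + real N + 1}"
    using total_variation_subadditive[OF m, of "{t<..t + real N}" "{t + real N<..t + real N + 1}"] by auto
  also have "\<dots> \<le> ennreal (real N * M) + ennreal M"
  proof (intro add_mono Suc)
    have "total_variation m {t + real N<..t + real N + 1} \<le> total_variation m {t + real N..t + real N + 1}"
      by (rule total_variation_mono) auto
    also have "\<dots> \<le> ennreal M" by (rule M(1))
    finally show "total_variation m {t + real N<..t + real N + 1} \<le> ennreal M" .
  qed
  also have "\<dots> = ennreal (real (Suc N) * M)"
    using M(2) by (simp add: ennreal_plus[symmetric] algebra_simps del: ennreal_plus)
  finally show ?case .
qed

text \<open>A locally finite measure on the whole line may have no distribution function based at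
  minus infinity. Basing it at 0, with the sign reversed on the negative axis, keeps the increments
  right and gives bounds depending on t alone.\<close>

definition distribution_function :: "(real set \<Rightarrow> 'b) \<Rightarrow> real \<Rightarrow> 'b::real_normed_vector" where
  "distribution_function m t = (if 0 \<le> t then m {0<..t} else - m {t<..0})"

definition variation_function :: "(real set \<Rightarrow> 'b::real_normed_vector) \<Rightarrow> real \<Rightarrow> real" where
  "variation_function m t =
     (if 0 \<le> t then enn2real (total_variation m {0<..t}) else - enn2real (total_variation m {t<..0}))"

lemma distribution_function_diff:
  assumes n: "countably_additive_bounded n" and "a \<le> b"
  shows "distribution_function n b - distribution_function n a = n {a<..b}"
proof -
  have add: "n {x<..z} = n {x<..y} + n {y<..z}" if "x \<le> y" "y \<le> z" for x y z :: real
  proof -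
    have "{x<..z} = {x<..y} \<union> {y<..z}" using that by auto
    then show ?thesis by (simp add: cab_Un[OF n, of "{x<..y}" "{y<..z}"])
  qed
  consider "0 \<le> a" | "a < 0" "0 \<le> b" | "b < 0" by linarith
  then show ?thesis
  proof cases
    case 1
    then show ?thesis using assms(2) add[of 0 a b] by (simp add: distribution_function_def)
  next
    case 2
    then show ?thesis using add[of a 0 b] by (simp add: distribution_function_def)
  next
    case 3
    then show ?thesis using assms(2) add[of a b 0] by (simp add: distribution_function_def)
  qed
qed

text \<open>Supplies the domination in \<open>measure_of_distribution_function\<close>. On one side
  of 0, adjoining the new interval to a partition increases the variation by the norm of its
  measure; an interval containing 0 is split there.\<close>

lemma norm_le_variation_function_diff:
  assumes m: "m \<in> Mloc UNIV" and "a \<le> b"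
  shows "norm (m {a<..b}) \<le> variation_function m b - variation_function m a"
proof -
  let ?T = "\<lambda>x y. enn2real (total_variation m {x<..y})"
  have fin: "total_variation m {x<..y} < \<infinity>" for x y
    by (rule le_less_trans[OF total_variation_mono Mloc_TV_finite[OF m, of x y]]) auto
  have sup: "?T x y + norm (m B) \<le> ?T x' y'"
    if "B \<in> sets borel" "{x<..y} \<inter> B = {}" "{x<..y} \<union> B \<subseteq> {x'<..y'}" for x y x' y' B
  proof -
    have "total_variation m {x<..y} + ennreal (norm (m B)) \<le> total_variation m {x'<..y'}"
      by (rule total_variation_superadditive[of m, OF Mloc_empty[OF m] that])
    then have "enn2real (total_variation m {x<..y} + ennreal (norm (m B))) \<le> ?T x' y'"
      by (rule enn2real_mono) (use fin[of x' y'] in simp)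
    then show ?thesis using fin[of x y] by (simp add: enn2real_plus)
  qed
  have le: "norm (m {x<..y}) \<le> ?T x y" for x y
  proof -
    have "?T x x + norm (m {x<..y}) \<le> ?T x y" by (rule sup) auto
    then show ?thesis using enn2real_nonneg[of "total_variation m {x<..x}"] by linarith
  qed
  consider "0 \<le> a" | "a < 0" "0 \<le> b" | "b < 0" by linarith
  then show ?thesis
  proof cases
    case 1
    have "?T 0 a + norm (m {a<..b}) \<le> ?T 0 b" by (rule sup) (use 1 assms(2) in auto)
    then show ?thesis using 1 assms(2) by (simp add: variation_function_def)
  next
    case 2
    have "m {a<..b} = m {a<..0} + m {0<..b}"
      using cab_Un[OF cab_Mloc[OF m], of "{a<..0}" "{0<..b}"] 2 ivl_disj_un_two(6)[of a 0 b] by auto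
    then have "norm (m {a<..b}) \<le> norm (m {a<..0}) + norm (m {0<..b})" by (simp add: norm_triangle_ineq)
    then show ?thesis using 2 le[of a 0] le[of 0 b] by (simp add: variation_function_def)
  next
    case 3
    have "?T b 0 + norm (m {a<..b}) \<le> ?T a 0" by (rule sup) (use 3 assms(2) in auto)
    then show ?thesis using 3 assms(2) by (simp add: variation_function_def)
  qed
qed

section \<open>Compactness of the hull\<close>

lemma Mb_una_modulus:
  fixes \<mu> :: "real set \<Rightarrow> 'h::real_normed_vector"
  assumes "\<mu> \<in> Mb_una"
  obtains \<omega> :: "('h \<Rightarrow>\<^sub>L real) \<Rightarrow> real \<Rightarrow> real" where "\<And>\<phi>. (\<omega> \<phi> \<longlongrightarrow> 0) (at_right 0)"
    "\<And>\<phi> t e. 0 \<le> e \<Longrightarrow> \<bar>blinfun_apply \<phi> (\<mu> {t<..t+e})\<bar> \<le> \<omega> \<phi> e"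
proof -
  have "\<forall>\<phi> :: 'h \<Rightarrow>\<^sub>L real. \<exists>\<omega> :: real \<Rightarrow> real.
     mono_on {0..} \<omega> \<and> (\<forall>e\<ge>0. 0 \<le> \<omega> e) \<and> (\<omega> \<longlongrightarrow> 0) (at_right 0) \<and>
     (\<forall>e\<ge>0. \<forall>t. \<bar>blinfun_apply \<phi> (\<mu> {t..t+e})\<bar> \<le> \<omega> e)"
    using assms unfolding Mb_una_def by blast
  then obtain \<omega> :: "('h \<Rightarrow>\<^sub>L real) \<Rightarrow> real \<Rightarrow> real" where \<omega>: "\<And>\<phi>. mono_on {0..} (\<omega> \<phi>)"
    "\<And>\<phi>. (\<omega> \<phi> \<longlongrightarrow> 0) (at_right 0)"
    "\<And>\<phi> e t. 0 \<le> e \<Longrightarrow> \<bar>blinfun_apply \<phi> (\<mu> {t..t+e})\<bar> \<le> \<omega> \<phi> e"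
    by metis
  have \<mu>: "\<mu> \<in> Mloc UNIV" using assms by (simp add: Mb_una_def Mb_def)
  have "\<bar>blinfun_apply \<phi> (\<mu> {t<..t+e})\<bar> \<le> \<omega> \<phi> e" if "0 \<le> e" for \<phi> t e
  proof -
    \<comment> \<open>Monotonicity and the right limit 0 make \<phi> vanish on singletons, so closed
      intervals may be replaced by half-open ones.\<close>
    have "\<omega> \<phi> 0 \<le> 0"
    proof (rule tendsto_lowerbound[OF \<omega>(2)[of \<phi>]])
      show "\<forall>\<^sub>F x in at_right 0. \<omega> \<phi> 0 \<le> \<omega> \<phi> x"
        using mono_onD[OF \<omega>(1)] by (auto simp: eventually_at_right_field intro!: exI[of _ 1])
    qed simp
    then have "blinfun_apply \<phi> (\<mu> {t}) = 0"
      using \<omega>(3)[of 0 \<phi> t] by simp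
    moreover have "\<mu> ({t} \<union> {t<..t+e}) = \<mu> {t} + \<mu> {t<..t+e}"
      by (rule cab_Un[OF cab_Mloc[OF \<mu>]]) auto
    moreover have "{t} \<union> {t<..t+e} = {t..t+e}" using that by auto
    ultimately have "blinfun_apply \<phi> (\<mu> {t<..t+e}) = blinfun_apply \<phi> (\<mu> {t..t+e})"
      by (simp add: blinfun.add_right)
    then show ?thesis using \<omega>(3)[OF that, of \<phi> t] by simp
  qed
  then show thesis using that \<omega>(2) by blast
qed

text \<open>These bounds are the sides of the Tychonoff box in \<open>compactin_mhull\<close>. They
  involve m only through the constant M, which is common to all translates.\<close>

lemma bound_at_nat_ceiling:
  assumes m: "m \<in> Mloc UNIV" and M: "\<And>t. total_variation m {t..t+1} \<le> ennreal M" "M \<ge> 0"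
  shows "\<bar>variation_function m t\<bar> \<le> real (nat \<lceil>\<bar>t\<bar>\<rceil>) * M"
    and "norm (distribution_function m t) \<le> real (nat \<lceil>\<bar>t\<bar>\<rceil>) * M"
proof -
  define N where "N = nat \<lceil>\<bar>t\<bar>\<rceil>"
  have N: "\<bar>t\<bar> \<le> real N" by (simp add: N_def)
  have TV: "total_variation m {x<..y} \<le> ennreal (real N * M)" if "y \<le> x + real N" for x y
    by (rule order_trans[OF total_variation_mono total_variation_Ioc_le[OF m M]]) (use that in auto)
  have "norm (m {x<..y}) \<le> real N * M" if "y \<le> x + real N" for x y
  proof -
    have "ennreal (norm (m {x<..y})) \<le> ennreal (real N * M)"
      by (rule order_trans[OF norm_le_total_variation TV[OF that]]) auto
    then show ?thesis using M(2) by (simp add: ennreal_le_iff)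
  qed
  moreover have "enn2real (total_variation m {x<..y}) \<le> real N * M" if "y \<le> x + real N" for x y
    using TV[OF that] M(2) by (intro enn2real_leI) auto
  ultimately show "\<bar>variation_function m t\<bar> \<le> real (nat \<lceil>\<bar>t\<bar>\<rceil>) * M"
      "norm (distribution_function m t) \<le> real (nat \<lceil>\<bar>t\<bar>\<rceil>) * M"
    using N unfolding variation_function_def distribution_function_def N_def[symmetric] by auto
qed

text \<open>It suffices to find a weak-star compact, hence closed, set of measures that contains all
  translates. Continuity of a distribution function is not a closed condition, but obeying the fixed
  modulus \<omega> is, and so are linearity, monotonicity and domination; these cut out
  \<open>K\<close>.\<close>

lemma compactin_mhull:
  fixes \<mu> :: "real set \<Rightarrow> 'h::banach"
  assumes reflexive: "reflexive_space TYPE('h)" and una: "\<mu> \<in> Mb_una"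
  shows "compactin Mloc_wstar (mhull \<mu>)"
proof -
  have \<mu>: "\<mu> \<in> Mloc UNIV" "Mb_norm UNIV \<mu> < \<infinity>" using una by (simp_all add: Mb_una_def Mb_def)
  define M where "M = enn2real (Mb_norm UNIV \<mu>)"
  have M: "M \<ge> 0" "total_variation \<mu> {t..t+1} \<le> ennreal M" for t
  proof -
    have "total_variation \<mu> ({t..t+1} \<inter> UNIV) \<le> Mb_norm UNIV \<mu>"
      unfolding Mb_norm_def by (rule SUP_upper) simp
    then show "total_variation \<mu> {t..t+1} \<le> ennreal M" using \<mu>(2) by (simp add: M_def)
  qed (simp add: M_def)
  obtain \<omega> :: "('h \<Rightarrow>\<^sub>L real) \<Rightarrow> real \<Rightarrow> real" where \<omega>: "\<And>\<phi>. (\<omega> \<phi> \<longlongrightarrow> 0) (at_right 0)"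
    "\<And>\<phi> t e. 0 \<le> e \<Longrightarrow> \<bar>blinfun_apply \<phi> (\<mu> {t<..t+e})\<bar> \<le> \<omega> \<phi> e"
    using Mb_una_modulus[OF una] by blast
  define b where "b t = real (nat \<lceil>\<bar>t\<bar>\<rceil>) * M" for t :: real
  \<comment> \<open>A point of \<open>K\<close> encodes a pair \<open>(F, G)\<close>: coordinate \<open>(t, Some \<phi>)\<close> is the value at \<open>t\<close> of the
    distribution function of the scalar measure \<open>\<phi> \<circ> m\<close>, and \<open>(t, None)\<close> that of the variation of \<open>m\<close>.\<close>
  define box where "box = (\<lambda>(t, i). case i of None \<Rightarrow> {- b t..b t}
      | Some \<phi> \<Rightarrow> {- (b t * norm \<phi>)..b t * norm (\<phi> :: 'h \<Rightarrow>\<^sub>L real)})"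
  define K :: "(real \<times> ('h \<Rightarrow>\<^sub>L real) option \<Rightarrow> real) set" where
    "K = {p. \<forall>i. p i \<in> box i}
      \<inter> (\<Inter>t. \<Inter>\<phi>. \<Inter>\<psi>. {p. p (t, Some (\<phi> + \<psi>)) = p (t, Some \<phi>) + p (t, Some \<psi>)})
      \<inter> (\<Inter>t. \<Inter>k. \<Inter>\<phi>. {p. p (t, Some (k *\<^sub>R \<phi>)) = k * p (t, Some \<phi>)})
      \<inter> (\<Inter>s. \<Inter>t\<in>{s..}. {p. p (s, None) \<le> p (t, None)})
      \<inter> (\<Inter>s. \<Inter>t\<in>{s..}. \<Inter>\<phi>. {p. \<bar>p (t, Some \<phi>) - p (s, Some \<phi>)\<bar> \<le> norm \<phi> * (p (t, None) - p (s, None))})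
      \<inter> (\<Inter>t. \<Inter>e\<in>{0..}. \<Inter>\<phi>. {p. \<bar>p (t + e, Some \<phi>) - p (t, Some \<phi>)\<bar> \<le> \<omega> \<phi> e})"
  have "compact K"
    unfolding K_def
    by (intro compact_Int_closed compact_Pi_UNIV closed_INT ballI closed_Collect_eq closed_Collect_le
        continuous_intros continuous_on_product_coordinates)
      (auto simp: box_def split: option.split)
  have K: "p (t, None) \<le> b t" "- b t \<le> p (t, None)"
    "p (t, Some (\<phi> + \<psi>)) = p (t, Some \<phi>) + p (t, Some \<psi>)"
    "p (t, Some (k *\<^sub>R \<phi>)) = k * p (t, Some \<phi>)"
    "s \<le> t \<Longrightarrow> p (s, None) \<le> p (t, None)"
    "s \<le> t \<Longrightarrow> \<bar>p (t, Some \<phi>) - p (s, Some \<phi>)\<bar> \<le> norm \<phi> * (p (t, None) - p (s, None))"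
    "0 \<le> e \<Longrightarrow> \<bar>p (t + e, Some \<phi>) - p (t, Some \<phi>)\<bar> \<le> \<omega> \<phi> e" if "p \<in> K" for p s t k \<phi> \<psi> e
  proof -
    have "p (t, None) \<in> box (t, None)" using that unfolding K_def by blast
    then show "p (t, None) \<le> b t" "- b t \<le> p (t, None)" by (simp_all add: box_def)
  qed (use that in \<open>simp_all add: K_def\<close>)
  have "\<exists>m\<in>Mloc UNIV. (\<forall>x y \<phi>. x \<le> y \<longrightarrow> blinfun_apply \<phi> (m {x<..y}) = p (y, Some \<phi>) - p (x, Some \<phi>)) \<and>
     (\<forall>R\<ge>0. total_variation m {-R..R} \<le> ennreal (p (R + 1, None) - p (- R - 1, None)))"
    if p: "p \<in> K" for p
  proof (rule measure_of_distribution_function[OF reflexive, where F = "\<lambda>t \<phi>. p (t, Some \<phi>)" and G = "\<lambda>t. p (t, None)"])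
    \<comment> \<open>Right continuity comes from the modulus in \<open>K\<close>. The coordinate
      \<open>None\<close> carries no modulus, which is why the dominating function is regularized in
      \<open>measure_of_distribution_function\<close>.\<close>
    show "((\<lambda>s. p (s, Some \<phi>)) \<longlongrightarrow> p (t, Some \<phi>)) (at_right t)" for t \<phi>
    proof (subst filterlim_at_right_to_0, rule LIM_zero_cancel, rule tendsto_rabs_zero_cancel,
        rule tendsto_sandwich[OF _ _ tendsto_const \<omega>(1)])
      show "\<forall>\<^sub>F e in at_right 0. \<bar>p (e + t, Some \<phi>) - p (t, Some \<phi>)\<bar> \<le> \<omega> \<phi> e"
        using eventually_at_right_less[of 0]
        by eventually_elim (use K(7)[OF p] in \<open>simp add: add.commute\<close>)
    qed simp
  qed (use K[OF p] in \<open>auto intro: monoI\<close>)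
  then obtain \<Phi> where \<Phi>: "\<And>p. p \<in> K \<Longrightarrow> \<Phi> p \<in> Mloc UNIV"
    "\<And>p x y \<phi>. p \<in> K \<Longrightarrow> x \<le> y \<Longrightarrow> blinfun_apply \<phi> (\<Phi> p {x<..y}) = p (y, Some \<phi>) - p (x, Some \<phi>)"
    "\<And>p R. p \<in> K \<Longrightarrow> R \<ge> 0 \<Longrightarrow> total_variation (\<Phi> p) {-R..R} \<le> ennreal (p (R + 1, None) - p (- R - 1, None))"
    by metis
  have cont_vm: "continuous_on K (\<lambda>p. vm_integral \<psi> (\<Phi> p))" if "\<psi> \<in> Cc" for \<psi>
  proof (rule continuous_on_vm_integral_family[OF that \<Phi>(1)])
    fix R :: real
    define R' where "R' = max R 0"
    have "total_variation (\<Phi> p) {-R..R} \<le> ennreal (b (R' + 1) + b (- R' - 1))" if p: "p \<in> K" for p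
    proof -
      have "total_variation (\<Phi> p) {-R..R} \<le> total_variation (\<Phi> p) {-R'..R'}"
        by (rule total_variation_mono) (auto simp: R'_def)
      also have "\<dots> \<le> ennreal (p (R' + 1, None) - p (- R' - 1, None))"
        by (rule \<Phi>(3)[OF p]) (simp add: R'_def)
      also have "\<dots> \<le> ennreal (b (R' + 1) + b (- R' - 1))"
        using K(1)[OF p, of "R' + 1"] K(2)[OF p, of "- R' - 1"] by (intro ennreal_leI) linarith
      finally show ?thesis .
    qed
    then show "\<exists>V. \<forall>p\<in>K. total_variation (\<Phi> p) {-R..R} \<le> ennreal V" by blast
  next
    fix \<phi> :: "'h \<Rightarrow>\<^sub>L real" and x y :: real assume xy: "x \<le> y"
    have "continuous_on K (\<lambda>p. p i)" for i
      by (rule continuous_on_subset[OF continuous_on_product_coordinates]) simp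
    then have "continuous_on K (\<lambda>p. p (y, Some \<phi>) - p (x, Some \<phi>))"
      by (intro continuous_on_diff)
    moreover have "continuous_on K (\<lambda>p. blinfun_apply \<phi> (\<Phi> p {x<..y}))
        \<longleftrightarrow> continuous_on K (\<lambda>p. p (y, Some \<phi>) - p (x, Some \<phi>))"
      by (rule continuous_on_cong) (simp_all add: \<Phi>(2) xy)
    ultimately show "continuous_on K (\<lambda>p. blinfun_apply \<phi> (\<Phi> p {x<..y}))" by blast
  qed
  have "continuous_map (top_of_set K) (initial_topology (Mloc UNIV) (vm_integral ` Cc)) \<Phi>"
  proof (rule continuous_map_into_initial_topology)
    show "vm_integral ` Cc \<noteq> ({} :: ((real set \<Rightarrow> 'h) \<Rightarrow> real) set)" using Cc_nonempty by simp
    show "\<Phi> ` topspace (top_of_set K) \<subseteq> Mloc UNIV" using \<Phi>(1) by auto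
    fix f :: "(real set \<Rightarrow> 'h) \<Rightarrow> real" assume "f \<in> vm_integral ` Cc"
    then obtain \<psi> where "\<psi> \<in> Cc" "f = vm_integral \<psi>" by blast
    then show "continuous_map (top_of_set K) euclideanreal (\<lambda>p. f (\<Phi> p))"
      using cont_vm by simp
  qed
  then have "continuous_map (top_of_set K) Mloc_wstar \<Phi>" by (simp only: Mloc_wstar_def)
  then have comp: "compactin Mloc_wstar (\<Phi> ` K)"
    using \<open>compact K\<close> by (intro image_compactin[of "top_of_set K"]) (auto simp: compactin_subtopology)
  \<comment> \<open>\<open>M\<close> and \<omega> bound \<mu> uniformly in the position of the
    interval, so a single \<open>K\<close> serves all translates.\<close>
  have "range (\<lambda>h. mshift h \<mu>) \<subseteq> \<Phi> ` K"
  proof clarify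
    fix h
    define m where "m = mshift h \<mu>"
    have m: "m \<in> Mloc UNIV" unfolding m_def by (rule mshift_Mloc[OF \<mu>(1)])
    have mM: "total_variation m {t..t+1} \<le> ennreal M" for t
      using M(2)[of "h + t"] by (simp add: m_def total_variation_mshift ac_simps)
    define p where "p = (\<lambda>(t, i). case i of None \<Rightarrow> variation_function m t
        | Some \<phi> \<Rightarrow> blinfun_apply \<phi> (distribution_function m t))"
    have p_diff: "p (t, Some \<phi>) - p (s, Some \<phi>) = blinfun_apply \<phi> (m {s<..t})" if "s \<le> t" for s t \<phi>
      using distribution_function_diff[OF cab_Mloc[OF m] that]
      by (simp add: p_def blinfun.diff_right[symmetric])
    have p_None: "norm (m {s<..t}) \<le> p (t, None) - p (s, None)" if "s \<le> t" for s t
      using norm_le_variation_function_diff[OF m that] by (simp add: p_def)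
    have "p i \<in> box i" for i
    proof -
      obtain t j where i: "i = (t, j)" by force
      show ?thesis
      proof (cases j)
        case None
        then show ?thesis
          using bound_at_nat_ceiling(1)[OF m mM M(1), of t]
          by (simp add: i p_def box_def b_def abs_le_iff)
      next
        case (Some \<phi>)
        have "\<bar>blinfun_apply \<phi> (distribution_function m t)\<bar> \<le> norm \<phi> * norm (distribution_function m t)"
          using norm_blinfun[of \<phi> "distribution_function m t"] by simp
        also have "\<dots> \<le> norm \<phi> * b t"
          unfolding b_def by (intro mult_left_mono bound_at_nat_ceiling(2)[OF m mM M(1)]) simp
        finally show ?thesis
          by (simp add: Some i p_def box_def abs_le_iff mult.commute)
      qed
    qed
    moreover have "p (s, None) \<le> p (t, None)" if "s \<le> t" for s t
      using p_None[OF that] norm_ge_zero[of "m {s<..t}"] by linarith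
    moreover have "\<bar>p (t, Some \<phi>) - p (s, Some \<phi>)\<bar> \<le> norm \<phi> * (p (t, None) - p (s, None))"
      if "s \<le> t" for s t \<phi>
    proof -
      have "\<bar>p (t, Some \<phi>) - p (s, Some \<phi>)\<bar> \<le> norm \<phi> * norm (m {s<..t})"
        using norm_blinfun[of \<phi> "m {s<..t}"] by (simp add: p_diff[OF that])
      also have "\<dots> \<le> norm \<phi> * (p (t, None) - p (s, None))"
        by (intro mult_left_mono p_None[OF that]) simp
      finally show ?thesis .
    qed
    moreover have "\<bar>p (t + e, Some \<phi>) - p (t, Some \<phi>)\<bar> \<le> \<omega> \<phi> e" if "0 \<le> e" for t e \<phi>
      using p_diff[of t "t + e" \<phi>] \<omega>(2)[OF that, of \<phi> "h + t"] that
      by (simp add: m_def mshift_def add.assoc)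
    moreover have "p (t, Some (\<phi> + \<psi>)) = p (t, Some \<phi>) + p (t, Some \<psi>)"
      "p (t, Some (k *\<^sub>R \<phi>)) = k * p (t, Some \<phi>)" for t k \<phi> \<psi>
      by (simp_all add: p_def blinfun.add_left blinfun.scaleR_left)
    ultimately have p: "p \<in> K"
      unfolding K_def by (intro IntI INT_I CollectI allI) auto
    have "\<Phi> p = m"
    proof (rule Mloc_eq_if_eq_Ioc[OF \<Phi>(1)[OF p] m])
      fix \<phi> :: "'h \<Rightarrow>\<^sub>L real" and x y :: real assume "x < y"
      then show "blinfun_apply \<phi> (\<Phi> p {x<..y}) = blinfun_apply \<phi> (m {x<..y})"
        using \<Phi>(2)[OF p, of x y \<phi>] p_diff[of x y \<phi>] by simp
    qed
    then show "mshift h \<mu> \<in> \<Phi> ` K" using p by (metis m_def image_eqI)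
  qed
  moreover have "closedin Mloc_wstar (\<Phi> ` K)"
    by (rule compactin_imp_closedin[OF Hausdorff_Mloc_wstar comp])
  ultimately have "mhull \<mu> \<subseteq> \<Phi> ` K"
    unfolding mhull_def by (rule closure_of_minimal)
  then show ?thesis
    by (rule closed_compactin[OF comp]) (simp add: mhull_def)
qed

section \<open>Covering numbers\<close>

lemma total_variation_cong:
  assumes "\<And>B. B \<in> sets borel \<Longrightarrow> B \<subseteq> A \<Longrightarrow> m B = m' B"
  shows "total_variation m A = total_variation m' A"
  unfolding total_variation_def
  by (intro SUP_cong refl sum.cong) (use assms in auto)

lemma Mloc_eq_0:
  assumes "m \<in> Mloc I" "\<not> (A \<in> sets borel \<and> bounded A \<and> A \<subseteq> I)"
  shows "m A = 0"
  using assms(1)[unfolded Mloc_def mem_Collect_eq, THEN conjunct1] assms(2) by blast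

lemma mrestrict_Mb:
  assumes m: "m \<in> Mb UNIV"
  shows "mrestrict I m \<in> Mb I"
proof -
  have M: "m \<in> Mloc UNIV" and bd: "Mb_norm UNIV m < \<infinity>" using m by (simp_all add: Mb_def)
  have TV: "total_variation (mrestrict I m) (A \<inter> I) \<le> total_variation m A" for A
  proof -
    have "total_variation (mrestrict I m) (A \<inter> I) = total_variation m (A \<inter> I)"
      by (rule total_variation_cong) (auto simp: mrestrict_def)
    also have "\<dots> \<le> total_variation m A" by (rule total_variation_mono) simp
    finally show ?thesis .
  qed
  have "mrestrict I m \<in> Mloc I"
    unfolding Mloc_def mem_Collect_eq
  proof (intro conjI allI impI)
    fix A assume A: "\<not> (A \<in> sets borel \<and> bounded A \<and> A \<subseteq> I)"
    then have "m A = 0" if "A \<subseteq> I" using that by (intro Mloc_eq_0[OF M]) blast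
    then show "mrestrict I m A = 0" by (simp add: mrestrict_def)
  next
    fix F :: "nat \<Rightarrow> real set"
    assume F: "range F \<subseteq> sets borel \<and> disjoint_family F \<and> bounded (\<Union>i. F i) \<and> (\<Union>i. F i) \<subseteq> I"
    then have "(\<lambda>i. m (F i)) sums m (\<Union>i. F i)" by (intro Mloc_sums[OF M]) auto
    moreover have "F i \<subseteq> I" for i using F by blast
    ultimately show "(\<lambda>i. mrestrict I m (F i)) sums mrestrict I m (\<Union>i. F i)"
      using F by (simp add: mrestrict_def)
  next
    show "total_variation (mrestrict I m) ({a..b} \<inter> I) < \<infinity>" for a b
      by (rule le_less_trans[OF TV Mloc_TV_finite[OF M]])
  qed
  moreover have "Mb_norm I (mrestrict I m) \<le> Mb_norm UNIV m"
    unfolding Mb_norm_def by (intro SUP_mono') (simp add: TV)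
  ultimately show ?thesis using bd unfolding Mb_def by (auto intro: le_less_trans)
qed

lemma Mb_norm_le_total_variation: "Mb_norm I m \<le> total_variation m I"
  unfolding Mb_norm_def by (intro SUP_least total_variation_mono) simp

lemma Mfin_subset_Mb: "Mfin I \<subseteq> Mb I"
  unfolding Mfin_def Mb_def using le_less_trans[OF Mb_norm_le_total_variation] by auto

lemma Mb_dist_le_Mfin_dist:
  assumes "m1 \<in> Mfin I" "m2 \<in> Mfin I"
  shows "Mb_dist I m1 m2 \<le> Mfin_dist I m1 m2"
  unfolding Mb_dist_def Mfin_dist_def
proof (rule enn2real_mono[OF Mb_norm_le_total_variation])
  show "total_variation (\<lambda>A. m1 A - m2 A) I < top"
    using assms by (intro le_less_trans[OF total_variation_diff_le]) (auto simp: Mfin_def)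
qed

lemma Mb_dist_mshift_le:
  fixes m1 m2 :: "real set \<Rightarrow> 'h::real_normed_vector"
  assumes m: "m1 \<in> Mb UNIV" "m2 \<in> Mb UNIV" and I: "{h..h + s} \<subseteq> I"
  shows "Mb_dist {0..s} (mshift h m1) (mshift h m2) \<le> Mb_dist I (mrestrict I m1) (mrestrict I m2)"
proof -
  define n where "n A = m1 A - m2 A" for A
  have fin: "Mb_norm I (\<lambda>A. mrestrict I m1 A - mrestrict I m2 A) < \<infinity>"
    by (rule le_less_trans[OF Mb_norm_diff_le]) (use m[THEN mrestrict_Mb[where I = I]] in \<open>auto simp: Mb_def\<close>)
  have le: "total_variation (mshift h n) ({t..t+1} \<inter> {0..s})
      \<le> total_variation (\<lambda>A. mrestrict I m1 A - mrestrict I m2 A) ({h+t..h+t+1} \<inter> I)" for t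
  proof -
    have sub: "(+) h ` ({t..t+1} \<inter> {0..s}) \<subseteq> {h+t..h+t+1} \<inter> I"
    proof
      fix x assume "x \<in> (+) h ` ({t..t+1} \<inter> {0..s})"
      then obtain y where "x = h + y" "y \<in> {t..t+1} \<inter> {0..s}" by (rule imageE)
      then have "x \<in> {h..h + s}" "x \<in> {h+t..h+t+1}" by auto
      then show "x \<in> {h+t..h+t+1} \<inter> I" using I by blast
    qed
    have "total_variation (mshift h n) ({t..t+1} \<inter> {0..s}) = total_variation n ((+) h ` ({t..t+1} \<inter> {0..s}))"
      by (rule total_variation_mshift)
    also have "\<dots> \<le> total_variation n ({h+t..h+t+1} \<inter> I)"
      by (rule total_variation_mono[OF sub])
    also have "\<dots> = total_variation (\<lambda>A. mrestrict I m1 A - mrestrict I m2 A) ({h+t..h+t+1} \<inter> I)"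
      by (rule total_variation_cong) (auto simp: n_def mrestrict_def)
    finally show ?thesis .
  qed
  have "Mb_norm {0..s} (mshift h n) \<le> Mb_norm I (\<lambda>A. mrestrict I m1 A - mrestrict I m2 A)"
    unfolding Mb_norm_def
  proof (rule SUP_least)
    fix t
    show "total_variation (mshift h n) ({t..t+1} \<inter> {0..s})
        \<le> (SUP t. total_variation (\<lambda>A. mrestrict I m1 A - mrestrict I m2 A) ({t..t+1} \<inter> I))"
      using le[of t] by (rule SUP_upper2[of "h + t", rotated]) simp
  qed
  moreover have "mshift h n = (\<lambda>A. mshift h m1 A - mshift h m2 A)"
    by (simp add: mshift_def n_def fun_eq_iff)
  ultimately show ?thesis
    unfolding Mb_dist_def using fin by (intro enn2real_mono) auto
qed

text \<open>Finite covers are handled as colourings: a map \<kappa> into {..<n} with small fibres.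
  One representative per colour gives the centres, and g allows the covered set to be parametrised
  by initial data.\<close>

lemma covering_number_le:
  assumes "Metric_space M d" and g: "K \<subseteq> g ` X" "g ` X \<subseteq> M"
    and \<kappa>: "\<kappa> ` X \<subseteq> {..<n::nat}" "\<And>x y. x \<in> X \<Longrightarrow> y \<in> X \<Longrightarrow> \<kappa> x = \<kappa> y \<Longrightarrow> d (g x) (g y) < e"
  shows "covering_number M d e K \<le> n"
proof -
  interpret Metric_space M d by fact
  define rep where "rep i = (SOME x. x \<in> X \<and> \<kappa> x = i)" for i
  have rep: "rep (\<kappa> x) \<in> X" "\<kappa> (rep (\<kappa> x)) = \<kappa> x" if "x \<in> X" for x
    using someI[of "\<lambda>y. y \<in> X \<and> \<kappa> y = \<kappa> x" x] that by (simp_all add: rep_def)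
  define C where "C = (\<lambda>i. g (rep i)) ` \<kappa> ` X"
  have fin: "finite (\<kappa> ` X)" using \<kappa>(1) by (rule finite_subset) simp
  have "card C \<le> card (\<kappa> ` X)" unfolding C_def by (rule card_image_le[OF fin])
  also have "\<dots> \<le> n" using card_mono[OF _ \<kappa>(1)] by simp
  finally have "card C \<le> n" .
  moreover have "K \<subseteq> (\<Union>c\<in>C. mball c e)"
  proof
    fix k assume "k \<in> K"
    then obtain x where x: "x \<in> X" "k = g x" using g(1) by blast
    then have "k \<in> mball (g (rep (\<kappa> x))) e"
      using \<kappa>(2)[OF rep(1)[OF x(1)] x(1) rep(2)[OF x(1)]] rep(1)[OF x(1)] g(2) by auto
    then show "k \<in> (\<Union>c\<in>C. mball c e)" unfolding C_def using x by blast
  qed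
  then have "covering_number M d e K \<le> card C"
    unfolding covering_number_def
    by (intro Least_le exI[of _ C]) (use fin g(2) rep in \<open>auto simp: C_def\<close>)
  ultimately show ?thesis by simp
qed

text \<open>The finite net C only witnesses that the \<open>LEAST\<close> in
  \<open>covering_number\<close> is attained. Each point is coloured by a ball of a minimal cover,
  and two points of one ball are less than 2 e apart.\<close>

lemma covering_number_colouring:
  assumes "Metric_space M d" and K: "K \<subseteq> M"
    and C: "finite C" "C \<subseteq> M" "K \<subseteq> (\<Union>c\<in>C. Metric_space.mball M d c e)"
  shows "\<exists>\<kappa>. \<kappa> ` K \<subseteq> {..<covering_number M d e K} \<and>
    (\<forall>x\<in>K. \<forall>y\<in>K. \<kappa> x = \<kappa> y \<longrightarrow> d x y < 2 * e)"
proof -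
  interpret Metric_space M d by fact
  define N where "N = covering_number M d e K"
  have "\<exists>D. finite D \<and> D \<subseteq> M \<and> card D = N \<and> K \<subseteq> (\<Union>c\<in>D. mball c e)"
    unfolding N_def covering_number_def by (rule LeastI[of _ "card C"]) (use C in blast)
  then obtain D where D: "finite D" "D \<subseteq> M" "card D = N" "K \<subseteq> (\<Union>c\<in>D. mball c e)" by blast
  obtain h where h: "bij_betw h D {..<N}"
    using ex_bij_betw_finite_nat[OF D(1)] D(3) by (auto simp: atLeast0LessThan)
  have "\<forall>x\<in>K. \<exists>c. c \<in> D \<and> x \<in> mball c e" using D(4) by blast
  then obtain c where c: "\<And>x. x \<in> K \<Longrightarrow> c x \<in> D \<and> x \<in> mball (c x) e" by metis
  have "(h \<circ> c) ` K \<subseteq> {..<N}"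
    using h c by (auto simp: bij_betw_def)
  moreover have "d x y < 2 * e" if "x \<in> K" "y \<in> K" "(h \<circ> c) x = (h \<circ> c) y" for x y
  proof -
    have "c x = c y" using h c that by (auto simp: bij_betw_def inj_on_def)
    then have "d (c x) x < e" "d (c x) y < e" "c x \<in> M" "x \<in> M" "y \<in> M"
      using c[OF that(1)] c[OF that(2)] by auto
    then show ?thesis using triangle[of x "c x" y] commute[of x "c x"] by simp
  qed
  ultimately show ?thesis unfolding N_def by blast
qed

text \<open>Precompactness is given in total variation on the whole interval, while the entropy is
  measured in the smaller \<open>Mb\<close> norm. A finite net for the former is one for the
  latter.\<close>

lemma strong_loc_precompact_colouring:
  fixes S :: "(real set \<Rightarrow> 'h::real_normed_vector) set"
  assumes S: "strong_loc_precompact S" "S \<subseteq> Mb UNIV" and l: "0 \<le> l" and e: "e > 0"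
  shows "\<exists>\<kappa>. \<kappa> ` S \<subseteq> {..<covering_number (Mb {0..l}) (Mb_dist {0..l}) e (mrestrict {0..l} ` S)} \<and>
    (\<forall>x\<in>S. \<forall>y\<in>S. \<kappa> x = \<kappa> y \<longrightarrow> Mb_dist {0..l} (mrestrict {0..l} x) (mrestrict {0..l} y) < 2 * e)"
proof -
  define I where "I = {0..l}"
  have I: "I \<in> sets borel" by (simp add: I_def)
  have F: "Metric_space (Mfin I :: (real set \<Rightarrow> 'h) set) (Mfin_dist I)"
    by (rule Metric_space_Mfin[OF I])
  have B: "Metric_space (Mb I :: (real set \<Rightarrow> 'h) set) (Mb_dist I)"
    by (rule Metric_space_Mb[OF I])
  have "Metric_space.mtotally_bounded (Mfin I) (Mfin_dist I) (mrestrict I ` S)"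
    using S(1) l unfolding strong_loc_precompact_def I_def by blast
  then have "\<exists>C. finite C \<and> C \<subseteq> mrestrict I ` S \<and>
      mrestrict I ` S \<subseteq> (\<Union>x\<in>C. Metric_space.mball (Mfin I) (Mfin_dist I) x e)"
    unfolding Metric_space.mtotally_bounded_def[OF F] by (rule allE[where x = e]) (use e in simp)
  then obtain C where C: "finite C" "C \<subseteq> mrestrict I ` S"
    "mrestrict I ` S \<subseteq> (\<Union>x\<in>C. Metric_space.mball (Mfin I) (Mfin_dist I) x e)"
    by (elim exE conjE) (rule that)
  have K: "mrestrict I ` S \<subseteq> Mb I" using mrestrict_Mb S(2) by blast
  have "mrestrict I ` S \<subseteq> (\<Union>x\<in>C. Metric_space.mball (Mb I) (Mb_dist I) x e)"
  proof
    fix m assume "m \<in> mrestrict I ` S"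
    then obtain x where x: "x \<in> C" "m \<in> Metric_space.mball (Mfin I) (Mfin_dist I) x e" using C(3) by blast
    then have "x \<in> Mfin I" "m \<in> Mfin I" "Mfin_dist I x m < e"
      by (auto simp: Metric_space.in_mball[OF F])
    then have "m \<in> Metric_space.mball (Mb I) (Mb_dist I) x e"
      using Mfin_subset_Mb Mb_dist_le_Mfin_dist[of x I m]
      by (auto simp: Metric_space.in_mball[OF B])
    then show "m \<in> (\<Union>x\<in>C. Metric_space.mball (Mb I) (Mb_dist I) x e)" using x(1) by blast
  qed
  from covering_number_colouring[OF B K C(1) order_trans[OF C(2) K] this]
  obtain \<kappa> where \<kappa>: "\<kappa> ` mrestrict I ` S \<subseteq> {..<covering_number (Mb I) (Mb_dist I) e (mrestrict I ` S)}"
    "\<forall>x\<in>mrestrict I ` S. \<forall>y\<in>mrestrict I ` S. \<kappa> x = \<kappa> y \<longrightarrow> Mb_dist I x y < 2 * e"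
    by (elim exE conjE) (rule that)
  then show ?thesis
    unfolding I_def[symmetric] by (intro exI[of _ "\<lambda>x. \<kappa> (mrestrict I x)"]) (auto simp: image_image)
qed

text \<open>By linearity the number P depends on \<eta> alone and not on the diameter d: differences
  to the representative of a colour, divided by d, lie in the unit ball, whose image is covered by P
  balls of radius \<eta> / 2.\<close>

lemma compact_embedding_refine:
  fixes J :: "'e::real_normed_vector \<Rightarrow>\<^sub>L 'w::real_normed_vector"
  assumes J: "compact_embedding J" and \<eta>: "\<eta> > 0"
  obtains P :: nat where "P \<ge> 1" "\<And>(X :: 'x set) u \<kappa> n d. d > 0 \<Longrightarrow> \<kappa> ` X \<subseteq> {..<n::nat} \<Longrightarrow>
    (\<And>x y. x \<in> X \<Longrightarrow> y \<in> X \<Longrightarrow> \<kappa> x = \<kappa> y \<Longrightarrow> norm (u x - u y) \<le> d) \<Longrightarrow>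
    \<exists>\<kappa>'. \<kappa>' ` X \<subseteq> {..<n * P} \<and> (\<forall>x\<in>X. \<forall>y\<in>X. \<kappa>' x = \<kappa>' y \<longrightarrow>
      \<kappa> x = \<kappa> y \<and> norm (blinfun_apply J (u x - u y)) \<le> \<eta> * d)"
proof -
  have "compact (closure (blinfun_apply J ` cball 0 1))"
    using J unfolding compact_embedding_def by blast
  then have "\<forall>e>0. \<exists>C. finite C \<and> closure (blinfun_apply J ` cball 0 1) \<subseteq> (\<Union>c\<in>C. ball c e)"
    unfolding compact_eq_totally_bounded by (rule conjunct2)
  then have "\<exists>C. finite C \<and> closure (blinfun_apply J ` cball 0 1) \<subseteq> (\<Union>c\<in>C. ball c (\<eta> / 2))"
    by (rule allE[where x = "\<eta> / 2"]) (use \<eta> in simp)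
  then obtain C where C: "finite C" "closure (blinfun_apply J ` cball 0 1) \<subseteq> (\<Union>c\<in>C. ball c (\<eta> / 2))"
    by (elim exE conjE) (rule that)
  define P where "P = card C"
  obtain h where h: "bij_betw h C {..<P}"
    using ex_bij_betw_finite_nat[OF C(1)] by (auto simp: P_def atLeast0LessThan)
  have "\<forall>z\<in>cball 0 1. \<exists>c. c \<in> C \<and> blinfun_apply J z \<in> ball c (\<eta> / 2)"
    using C(2) closure_subset[of "blinfun_apply J ` cball 0 1"] by blast
  then obtain q where q: "\<And>z. z \<in> cball 0 1 \<Longrightarrow> q z \<in> C \<and> blinfun_apply J z \<in> ball (q z) (\<eta> / 2)"
    by metis
  have hq: "h (q z) < P" if "z \<in> cball 0 1" for z
    using h q[OF that] by (auto simp: bij_betw_def)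
  have "P \<ge> 1" using hq[of 0] by simp
  moreover have "\<exists>\<kappa>'. \<kappa>' ` X \<subseteq> {..<n * P} \<and> (\<forall>x\<in>X. \<forall>y\<in>X. \<kappa>' x = \<kappa>' y \<longrightarrow>
      \<kappa> x = \<kappa> y \<and> norm (blinfun_apply J (u x - u y)) \<le> \<eta> * d)"
    if d: "d > 0" and \<kappa>: "\<kappa> ` X \<subseteq> {..<n::nat}"
      "\<And>x y. x \<in> X \<Longrightarrow> y \<in> X \<Longrightarrow> \<kappa> x = \<kappa> y \<Longrightarrow> norm (u x - u y) \<le> d"
    for X :: "'x set" and u \<kappa> n d
  proof -
    define rep where "rep i = (SOME x. x \<in> X \<and> \<kappa> x = i)" for i
    have rep: "rep (\<kappa> x) \<in> X" "\<kappa> (rep (\<kappa> x)) = \<kappa> x" if "x \<in> X" for x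
      using someI[of "\<lambda>y. y \<in> X \<and> \<kappa> y = \<kappa> x" x] that by (simp_all add: rep_def)
    define z where "z x = (u x - u (rep (\<kappa> x))) /\<^sub>R d" for x
    have z: "z x \<in> cball 0 1" if "x \<in> X" for x
    proof -
      have "norm (u x - u (rep (\<kappa> x))) \<le> d" using rep[OF that] that by (intro \<kappa>(2)) auto
      moreover have "norm (z x) = norm (u x - u (rep (\<kappa> x))) / d"
        using d by (simp add: z_def divide_inverse_commute)
      ultimately show ?thesis using d by simp
    qed
    \<comment> \<open>Mixed-radix code: division by P returns the old colour, the remainder the
      index of the ball.\<close>
    define \<kappa>' where "\<kappa>' x = h (q (z x)) + P * \<kappa> x" for x
    have range': "\<kappa>' x < n * P" if "x \<in> X" for x
    proof -
      have "\<kappa>' x < P + P * \<kappa> x" using hq[OF z[OF that]] by (simp add: \<kappa>'_def)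
      also have "\<dots> = P * Suc (\<kappa> x)" by simp
      also have "\<dots> \<le> P * n" using \<kappa>(1) that by (intro mult_le_mono) auto
      finally show ?thesis by (simp add: mult.commute)
    qed
    have same: "\<kappa> x = \<kappa> y \<and> norm (blinfun_apply J (u x - u y)) \<le> \<eta> * d"
      if xy: "x \<in> X" "y \<in> X" "\<kappa>' x = \<kappa>' y" for x y
    proof -
      have hx: "h (q (z x)) < P" and hy: "h (q (z y)) < P" using hq z xy by auto
      have "\<kappa>' x div P = \<kappa> x" "\<kappa>' y div P = \<kappa> y" "\<kappa>' x mod P = h (q (z x))" "\<kappa>' y mod P = h (q (z y))"
        using hx hy by (simp_all add: \<kappa>'_def)
      then have eq: "\<kappa> x = \<kappa> y" "h (q (z x)) = h (q (z y))" using xy(3) by auto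
      then have "q (z x) = q (z y)"
        using h q[OF z[OF xy(1)]] q[OF z[OF xy(2)]] by (auto simp: bij_betw_def inj_on_def)
      then have "dist (q (z x)) (blinfun_apply J (z x)) < \<eta> / 2" "dist (q (z x)) (blinfun_apply J (z y)) < \<eta> / 2"
        using q[OF z[OF xy(1)]] q[OF z[OF xy(2)]] by auto
      then have "dist (blinfun_apply J (z x)) (blinfun_apply J (z y)) < \<eta>"
        by (rule dist_triangle_half_r)
      then have "norm (blinfun_apply J (z x - z y)) < \<eta>" by (simp add: dist_norm blinfun.diff_right)
      moreover have "u x - u y = d *\<^sub>R (z x - z y)"
        using d eq(1) by (simp add: z_def scaleR_diff_right)
      ultimately show ?thesis using d eq(1) by (simp add: blinfun.scaleR_right mult.commute)
    qed
    have "\<kappa>' ` X \<subseteq> {..<n * P} \<and> (\<forall>x\<in>X. \<forall>y\<in>X. \<kappa>' x = \<kappa>' y \<longrightarrow>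
      \<kappa> x = \<kappa> y \<and> norm (blinfun_apply J (u x - u y)) \<le> \<eta> * d)"
    proof (intro conjI[OF image_subsetI] ballI impI)
      show "\<kappa>' x \<in> {..<n * P}" if "x \<in> X" for x using range'[OF that] by (rule lessThan_iff[THEN iffD2])
    qed (rule same)
    then show ?thesis by (rule exI[where x = \<kappa>'])
  qed
  ultimately show thesis by (rule that)
qed

section \<open>Iterated squeezing\<close>

text \<open>The absorbing set enters through its centre and its inclusion in a closed ball, so open
  and closed balls are treated alike. \<open>L\<close> and \<open>C\<close> may have either
  sign.\<close>

locale squeezing_family =
  fixes \<mu> :: "real set \<Rightarrow> 'h::banach"
    and U :: "(real set \<Rightarrow> 'h) \<Rightarrow> real \<Rightarrow> real \<Rightarrow> 'e::banach \<Rightarrow> 'e"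
    and s L C r :: real
    and c :: 'e
    and \<B> :: "'e set"
    and Pr :: "real \<Rightarrow> (real set \<Rightarrow> 'h) \<Rightarrow> (real set \<Rightarrow> 'h)"
    and J :: "'e \<Rightarrow>\<^sub>L 'w::banach"
  assumes reflexive: "reflexive_space TYPE('e)" "reflexive_space TYPE('h)"
    and una: "\<mu> \<in> Mb_una"
    and process: "\<And>\<nu>. \<nu> \<in> mhull \<mu> \<Longrightarrow> dynamical_process (U \<nu>)"
    and translation: "translation_identity U (mhull \<mu>)"
    and weak_cont: "\<And>t \<tau>. \<tau> \<le> t \<Longrightarrow>
          continuous_map (prod_topology weak_topology (hull_top \<mu>)) weak_topology
            (\<lambda>(\<xi>, \<nu>). U \<nu> t \<tau> \<xi>)"
    and ball: "r > 0" "\<B> \<subseteq> cball c r" "c \<in> \<B>"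
    and absorbing: "uniformly_absorbing U (mhull \<mu>) \<B>"
    and s_pos: "s > 0"
    and invariant: "\<And>\<nu>. \<nu> \<in> mhull \<mu> \<Longrightarrow> U \<nu> s 0 ` \<B> \<subseteq> \<B>"
    and embedding: "compact_embedding J"
    and Pr_una: "\<And>\<epsilon>. \<epsilon> > 0 \<Longrightarrow> Pr \<epsilon> ` mhull \<mu> \<subseteq> Mb_una"
    and Pr_shift: "\<And>\<epsilon> h \<nu>. \<epsilon> > 0 \<Longrightarrow> \<nu> \<in> mhull \<mu> \<Longrightarrow> Pr \<epsilon> (mshift h \<nu>) = mshift h (Pr \<epsilon> \<nu>)"
    and Pr_precompact: "\<And>\<epsilon>. \<epsilon> > 0 \<Longrightarrow> strong_loc_precompact (Pr \<epsilon> ` mhull \<mu>)"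
    and squeezing: "\<And>\<epsilon> \<xi>\<^sub>1 \<xi>\<^sub>2 \<nu>\<^sub>1 \<nu>\<^sub>2. \<epsilon> > 0 \<Longrightarrow> \<xi>\<^sub>1 \<in> \<B> \<Longrightarrow> \<xi>\<^sub>2 \<in> \<B> \<Longrightarrow>
          \<nu>\<^sub>1 \<in> mhull \<mu> \<Longrightarrow> \<nu>\<^sub>2 \<in> mhull \<mu> \<Longrightarrow>
          norm (U \<nu>\<^sub>1 s 0 \<xi>\<^sub>1 - U \<nu>\<^sub>2 s 0 \<xi>\<^sub>2)
            \<le> 1 / 16 * norm (\<xi>\<^sub>1 - \<xi>\<^sub>2) + L * norm (blinfun_apply J (\<xi>\<^sub>1 - \<xi>\<^sub>2)) + \<epsilon>
              + C * Mb_dist {0..s} (Pr \<epsilon> \<nu>\<^sub>1) (Pr \<epsilon> \<nu>\<^sub>2)"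
begin

lemma \<mu>_Mloc: "\<mu> \<in> Mloc UNIV"
  using una by (simp add: Mb_una_def Mb_def)

lemma \<mu>_mhull: "\<mu> \<in> mhull \<mu>"
  by (rule mem_mhull[OF \<mu>_Mloc])

lemma U_id: "\<nu> \<in> mhull \<mu> \<Longrightarrow> U \<nu> 0 0 \<xi> = \<xi>"
  using process[of \<nu>] by (simp add: dynamical_process_def)

lemma U_add:
  assumes "\<nu> \<in> mhull \<mu>" "0 \<le> t" "0 \<le> q"
  shows "U \<nu> (t + q) 0 \<xi> = U (mshift q \<nu>) t 0 (U \<nu> q 0 \<xi>)"
proof -
  have "\<forall>t r \<tau>. \<tau> \<le> r \<and> r \<le> t \<longrightarrow> U \<nu> t \<tau> = U \<nu> t r \<circ> U \<nu> r \<tau>"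
    using process[OF assms(1)] unfolding dynamical_process_def by (rule conjunct2)
  then have "U \<nu> (t + q) 0 = U \<nu> (t + q) q \<circ> U \<nu> q 0"
    using assms by (elim allE[where x = "t + q"] allE[where x = q] allE[where x = 0]) auto
  moreover have "U \<nu> (t + q) (0 + q) = U (mshift q \<nu>) t 0"
    using translation assms unfolding translation_identity_def by blast
  ultimately show ?thesis by simp
qed

definition trajectory :: "nat \<Rightarrow> 'e \<times> (real set \<Rightarrow> 'h) \<Rightarrow> 'e" where
  "trajectory k x = U (snd x) (real k * s) 0 (fst x)"

lemma trajectory_0: "snd x \<in> mhull \<mu> \<Longrightarrow> trajectory 0 x = fst x"
  by (simp add: trajectory_def U_id)

lemma trajectory_Suc:
  assumes "snd x \<in> mhull \<mu>"
  shows "trajectory (Suc k) x = U (mshift (real k * s) (snd x)) s 0 (trajectory k x)"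
proof -
  have "real (Suc k) * s = s + real k * s" by (simp add: algebra_simps)
  then show ?thesis
    unfolding trajectory_def using U_add[OF assms, of s "real k * s" "fst x"] s_pos by simp
qed

lemma trajectory_in_\<B>: "x \<in> \<B> \<times> mhull \<mu> \<Longrightarrow> trajectory k x \<in> \<B>"
proof (induction k)
  case 0
  then show ?case by (auto simp: trajectory_0)
next
  case (Suc k)
  then have x: "snd x \<in> mhull \<mu>" by auto
  from invariant[OF mshift_mhull[OF x, of "real k * s"]] Suc show ?case
    by (auto simp: trajectory_Suc[OF x])
qed

text \<open>The error of one squeezing step in units of \<epsilon>: 1 from the term \<epsilon>
  itself, and 2 \<bar>C\<bar> because symbols of one colour have \<open>Pr\<close> images at
  distance at most 2 \<epsilon>.\<close>

definition error_const :: real where "error_const = 1 + 2 * \<bar>C\<bar>"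

abbreviation hull_covering :: "real \<Rightarrow> real \<Rightarrow> nat" where
  "hull_covering \<epsilon> l \<equiv> covering_number (Mb {0..l}) (Mb_dist {0..l}) \<epsilon> (mrestrict {0..l} ` Pr \<epsilon> ` mhull \<mu>)"

text \<open>The induction refines a colouring step by step and keeps the closeness of the symbols
  (\<open>same\<close>) fixed from the start, so the hull contributes its covering number once and
  each step only the factor P.\<close>

lemma trajectory_colouring:
  obtains P :: nat where "P \<ge> 1" "\<And>\<epsilon> n l. \<epsilon> > 0 \<Longrightarrow> real n * s \<le> l \<Longrightarrow>
    \<exists>\<kappa>. \<kappa> ` (\<B> \<times> mhull \<mu>) \<subseteq> {..<hull_covering \<epsilon> l * P ^ n} \<and>
      (\<forall>x\<in>\<B> \<times> mhull \<mu>. \<forall>y\<in>\<B> \<times> mhull \<mu>. \<kappa> x = \<kappa> y \<longrightarrow>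
        norm (trajectory n x - trajectory n y) \<le> 2 * r / 8 ^ n + 2 * error_const * \<epsilon>)"
proof -
  \<comment> \<open>Chosen so that the \<open>L\<close> term contributes at most another sixteenth
    of the diameter, for a total contraction by 1/8.\<close>
  define \<eta> where "\<eta> = 1 / (16 * (max L 0 + 1))"
  have \<eta>: "\<eta> > 0" unfolding \<eta>_def by (intro divide_pos_pos) auto
  have L\<eta>: "max L 0 * \<eta> \<le> 1 / 16" unfolding \<eta>_def by (simp add: field_simps)
  define X where "X = \<B> \<times> mhull \<mu>"
  obtain P :: nat where P: "P \<ge> 1"
    "\<And>(X :: ('e \<times> (real set \<Rightarrow> 'h)) set) u \<kappa> n d. d > 0 \<Longrightarrow> \<kappa> ` X \<subseteq> {..<n::nat} \<Longrightarrow>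
    (\<And>x y. x \<in> X \<Longrightarrow> y \<in> X \<Longrightarrow> \<kappa> x = \<kappa> y \<Longrightarrow> norm (u x - u y) \<le> d) \<Longrightarrow>
    \<exists>\<kappa>'. \<kappa>' ` X \<subseteq> {..<n * P} \<and> (\<forall>x\<in>X. \<forall>y\<in>X. \<kappa>' x = \<kappa>' y \<longrightarrow>
      \<kappa> x = \<kappa> y \<and> norm (blinfun_apply J (u x - u y)) \<le> \<eta> * d)"
    by (fact compact_embedding_refine[OF embedding \<eta>])
  have ec: "error_const \<ge> 1" by (simp add: error_const_def)
  have main: "\<exists>\<kappa>. \<kappa> ` X \<subseteq> {..<hull_covering \<epsilon> l * P ^ n} \<and>
      (\<forall>x\<in>X. \<forall>y\<in>X. \<kappa> x = \<kappa> y \<longrightarrow> norm (trajectory n x - trajectory n y) \<le> 2 * r / 8 ^ n + 2 * error_const * \<epsilon>)"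
    if \<epsilon>: "\<epsilon> > 0" and nl: "real n * s \<le> l" for \<epsilon> n l
  proof -
    define I where "I = {0..l}"
    define N where "N = hull_covering \<epsilon> l"
    have "0 \<le> real n * s" using s_pos by simp
    then have l: "0 \<le> l" using nl by linarith
    have Mb: "Pr \<epsilon> ` mhull \<mu> \<subseteq> Mb UNIV"
      using Pr_una[OF \<epsilon>] by (auto simp: Mb_una_def)
    from strong_loc_precompact_colouring[OF Pr_precompact[OF \<epsilon>] Mb l \<epsilon>, folded N_def, folded I_def]
    obtain \<kappa>0 where \<kappa>0: "\<kappa>0 ` Pr \<epsilon> ` mhull \<mu> \<subseteq> {..<N}"
      "\<forall>x\<in>Pr \<epsilon> ` mhull \<mu>. \<forall>y\<in>Pr \<epsilon> ` mhull \<mu>. \<kappa>0 x = \<kappa>0 y \<longrightarrow>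
        Mb_dist I (mrestrict I x) (mrestrict I y) < 2 * \<epsilon>"
      by (elim exE conjE) (rule that)
    \<comment> \<open>The starting diameter 2 r decays by 1/8 per step. The additive part is stable:
      with E = \<open>error_const\<close>, a step turns 2 E \<epsilon> into 2 E \<epsilon> / 8 + E
      \<epsilon>, which is below 2 E \<epsilon>.\<close>
    define D where "D k = 2 * r / 8 ^ k + 2 * error_const * \<epsilon>" for k :: nat
    have D_pos: "D k > 0" for k
    proof -
      have "2 * r / 8 ^ k > 0" using ball(1) by simp
      moreover have "2 * error_const * \<epsilon> \<ge> 0" using ec \<epsilon> by simp
      ultimately show ?thesis unfolding D_def by linarith
    qed
    define same where "same x y \<longleftrightarrow> Mb_dist I (mrestrict I (Pr \<epsilon> (snd x))) (mrestrict I (Pr \<epsilon> (snd y))) \<le> 2 * \<epsilon>"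
      for x y :: "'e \<times> (real set \<Rightarrow> 'h)"
    have "\<exists>\<kappa>. \<kappa> ` X \<subseteq> {..<N * P ^ k} \<and> (\<forall>x\<in>X. \<forall>y\<in>X. \<kappa> x = \<kappa> y \<longrightarrow>
        same x y \<and> norm (trajectory k x - trajectory k y) \<le> D k)" if "k \<le> n" for k
      using that
    proof (induction k)
      case 0
      define \<kappa> where "\<kappa> x = \<kappa>0 (Pr \<epsilon> (snd x))" for x :: "'e \<times> (real set \<Rightarrow> 'h)"
      have "\<kappa> x < N" if "x \<in> X" for x
      proof -
        have "Pr \<epsilon> (snd x) \<in> Pr \<epsilon> ` mhull \<mu>" using that by (auto simp: X_def)
        then show ?thesis using \<kappa>0(1) by (auto simp: \<kappa>_def)
      qed
      moreover have "same x y \<and> norm (trajectory 0 x - trajectory 0 y) \<le> D 0"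
        if "x \<in> X" "y \<in> X" "\<kappa> x = \<kappa> y" for x y
      proof -
        have xy: "snd x \<in> mhull \<mu>" "snd y \<in> mhull \<mu>" "fst x \<in> cball c r" "fst y \<in> cball c r"
          using that ball(2) by (auto simp: X_def)
        have "same x y"
          using \<kappa>0(2) xy that(3) unfolding same_def \<kappa>_def by (auto intro: less_imp_le)
        moreover have "norm (fst x - fst y) \<le> 2 * r"
          using xy(3,4) dist_triangle3[of "fst x" "fst y" c] by (simp add: dist_norm)
        moreover have "2 * r \<le> D 0" using ec \<epsilon> by (simp add: D_def)
        ultimately show ?thesis by (simp add: trajectory_0 xy)
      qed
      ultimately show ?case by (intro exI[of _ \<kappa>] conjI ballI impI image_subsetI) simp_all
    next
      case (Suc k)
      then have "k \<le> n" by simp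
      from Suc.IH[OF this] obtain \<kappa> where \<kappa>: "\<kappa> ` X \<subseteq> {..<N * P ^ k}"
        "\<forall>x\<in>X. \<forall>y\<in>X. \<kappa> x = \<kappa> y \<longrightarrow> same x y \<and> norm (trajectory k x - trajectory k y) \<le> D k"
        by (elim exE conjE) (rule that)
      have \<kappa>D: "norm (trajectory k x - trajectory k y) \<le> D k" if "x \<in> X" "y \<in> X" "\<kappa> x = \<kappa> y" for x y
        using \<kappa>(2) that by blast
      have "\<exists>\<kappa>'. \<kappa>' ` X \<subseteq> {..<N * P ^ k * P} \<and> (\<forall>x\<in>X. \<forall>y\<in>X. \<kappa>' x = \<kappa>' y \<longrightarrow>
          \<kappa> x = \<kappa> y \<and> norm (blinfun_apply J (trajectory k x - trajectory k y)) \<le> \<eta> * D k)"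
        by (rule P(2)[OF D_pos \<kappa>(1)], rule \<kappa>D)
      then obtain \<kappa>' where \<kappa>': "\<kappa>' ` X \<subseteq> {..<N * P ^ k * P}"
        "\<forall>x\<in>X. \<forall>y\<in>X. \<kappa>' x = \<kappa>' y \<longrightarrow>
          \<kappa> x = \<kappa> y \<and> norm (blinfun_apply J (trajectory k x - trajectory k y)) \<le> \<eta> * D k"
        by (elim exE conjE) (rule that)
      have "same x y \<and> norm (trajectory (Suc k) x - trajectory (Suc k) y) \<le> D (Suc k)"
        if xy: "x \<in> X" "y \<in> X" "\<kappa>' x = \<kappa>' y" for x y
      proof -
        have \<kappa>xy: "\<kappa> x = \<kappa> y" and Jxy: "norm (blinfun_apply J (trajectory k x - trajectory k y)) \<le> \<eta> * D k"
          using \<kappa>'(2) xy by blast+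
        then have same: "same x y" and dk: "norm (trajectory k x - trajectory k y) \<le> D k"
          using \<kappa>(2) xy(1,2) by blast+
        have nu: "snd x \<in> mhull \<mu>" "snd y \<in> mhull \<mu>" using xy by (auto simp: X_def)
        \<comment> \<open>Step k of both trajectories is a step from time 0 driven by symbols
          shifted by h. Equivariance of \<open>Pr\<close> turns the distance of these symbols on
          {0..s} into a distance on {h..h + s}, inside the interval that was coloured.\<close>
        define h where "h = real k * s"
        have h: "{h..h + s} \<subseteq> I"
        proof -
          have "real (Suc k) * s \<le> real n * s" using Suc.prems s_pos by (intro mult_right_mono) auto
          then have "h + s \<le> l" using nl by (simp add: h_def algebra_simps)
          moreover have "0 \<le> h" using s_pos by (simp add: h_def)
          ultimately show ?thesis by (auto simp: I_def)
        qed
        have PrMb: "Pr \<epsilon> (snd x) \<in> Mb UNIV" "Pr \<epsilon> (snd y) \<in> Mb UNIV" using Mb nu by blast+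
        have "Mb_dist {0..s} (Pr \<epsilon> (mshift h (snd x))) (Pr \<epsilon> (mshift h (snd y)))
            \<le> Mb_dist I (mrestrict I (Pr \<epsilon> (snd x))) (mrestrict I (Pr \<epsilon> (snd y)))"
          unfolding Pr_shift[OF \<epsilon> nu(1)] Pr_shift[OF \<epsilon> nu(2)] by (rule Mb_dist_mshift_le[OF PrMb h])
        also have "\<dots> \<le> 2 * \<epsilon>" using same by (simp add: same_def)
        finally have dP: "Mb_dist {0..s} (Pr \<epsilon> (mshift h (snd x))) (Pr \<epsilon> (mshift h (snd y))) \<le> 2 * \<epsilon>" .
        have "C * Mb_dist {0..s} (Pr \<epsilon> (mshift h (snd x))) (Pr \<epsilon> (mshift h (snd y)))
            \<le> \<bar>C\<bar> * Mb_dist {0..s} (Pr \<epsilon> (mshift h (snd x))) (Pr \<epsilon> (mshift h (snd y)))"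
          by (intro mult_right_mono) (auto simp: Mb_dist_def)
        also have "\<dots> \<le> \<bar>C\<bar> * (2 * \<epsilon>)" by (intro mult_left_mono dP) simp
        finally have Cterm: "C * Mb_dist {0..s} (Pr \<epsilon> (mshift h (snd x))) (Pr \<epsilon> (mshift h (snd y))) \<le> \<bar>C\<bar> * (2 * \<epsilon>)" .
        have "L * norm (blinfun_apply J (trajectory k x - trajectory k y))
            \<le> max L 0 * norm (blinfun_apply J (trajectory k x - trajectory k y))"
          by (intro mult_right_mono) auto
        also have "\<dots> \<le> max L 0 * (\<eta> * D k)" by (intro mult_left_mono Jxy) simp
        also have "\<dots> = (max L 0 * \<eta>) * D k" by simp
        also have "\<dots> \<le> 1 / 16 * D k" using L\<eta> D_pos[of k] by (intro mult_right_mono) auto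
        finally have Lterm: "L * norm (blinfun_apply J (trajectory k x - trajectory k y)) \<le> 1 / 16 * D k" .
        have "norm (trajectory (Suc k) x - trajectory (Suc k) y)
            \<le> 1 / 16 * norm (trajectory k x - trajectory k y)
              + L * norm (blinfun_apply J (trajectory k x - trajectory k y)) + \<epsilon>
              + C * Mb_dist {0..s} (Pr \<epsilon> (mshift h (snd x))) (Pr \<epsilon> (mshift h (snd y)))"
          unfolding trajectory_Suc[OF nu(1)] trajectory_Suc[OF nu(2)] h_def
          using xy by (intro squeezing \<epsilon> trajectory_in_\<B> mshift_mhull nu) (auto simp: X_def)
        also have "\<dots> \<le> 1 / 16 * D k + 1 / 16 * D k + \<epsilon> + \<bar>C\<bar> * (2 * \<epsilon>)"
          using dk Lterm Cterm by linarith
        also have "\<dots> = D k / 8 + error_const * \<epsilon>"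
          by (simp add: error_const_def algebra_simps)
        also have "\<dots> \<le> D (Suc k)"
        proof -
          have "D k / 8 = 2 * r / 8 ^ Suc k + error_const * \<epsilon> / 4" by (simp add: D_def field_simps)
          moreover have "0 \<le> error_const * \<epsilon>" using ec \<epsilon> by simp
          ultimately show ?thesis unfolding D_def[of "Suc k"] by linarith
        qed
        finally show ?thesis using same by blast
      qed
      moreover have "\<kappa>' ` X \<subseteq> {..<N * P ^ Suc k}" using \<kappa>'(1) by (simp only: power_Suc ac_simps)
      ultimately show ?case by (intro exI[of _ \<kappa>'] conjI ballI impI) simp_all
    qed
    from this[OF order_refl] obtain \<kappa> where "\<kappa> ` X \<subseteq> {..<N * P ^ n}"
      "\<forall>x\<in>X. \<forall>y\<in>X. \<kappa> x = \<kappa> y \<longrightarrow> same x y \<and> norm (trajectory n x - trajectory n y) \<le> D n"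
      by (elim exE conjE) (rule that)
    then show ?thesis unfolding D_def N_def by (intro exI[of _ \<kappa>]) blast
  qed
  show thesis
    by (rule that[OF P(1)], fold X_def, rule main)
qed

end

section \<open>The strong uniform attractor\<close>

lemma compact_closure_if_totally_bounded:
  fixes Q :: "'a::banach set"
  assumes "\<And>e. e > 0 \<Longrightarrow> \<exists>k. finite k \<and> Q \<subseteq> (\<Union>x\<in>k. ball x e)"
  shows "compact (closure Q)"
  unfolding compact_eq_totally_bounded
proof (intro conjI allI impI)
  show "complete (closure Q)" by (simp add: complete_eq_closed)
  fix e :: real assume "e > 0"
  then have "e / 2 > 0" by simp
  from assms[OF this] obtain k where k: "finite k" "Q \<subseteq> (\<Union>x\<in>k. ball x (e / 2))" by blast
  have "closure Q \<subseteq> (\<Union>x\<in>k. cball x (e / 2))"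
  proof (rule closure_minimal)
    show "Q \<subseteq> (\<Union>x\<in>k. cball x (e / 2))" using k(2) ball_subset_cball by blast
    show "closed (\<Union>x\<in>k. cball x (e / 2))" using k(1) by (intro closed_UN) auto
  qed
  also have "\<dots> \<subseteq> (\<Union>x\<in>k. ball x e)"
  proof (intro UN_mono order_refl)
    show "cball x (e / 2) \<subseteq> ball x e" for x :: 'a using \<open>e > 0\<close> by auto
  qed
  finally show "\<exists>k. finite k \<and> closure Q \<subseteq> (\<Union>x\<in>k. ball x e)" using k(1) by blast
qed

context squeezing_family
begin

abbreviation "\<Sigma> \<equiv> mhull \<mu>"
abbreviation "S \<equiv> extended_semigroup U"
abbreviation "X\<^sub>w \<equiv> prod_topology weak_topology (hull_top \<mu>) :: ('e \<times> (real set \<Rightarrow> 'h)) topology"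
abbreviation "X\<^sub>n \<equiv> prod_topology euclidean (hull_top \<mu>) :: ('e \<times> (real set \<Rightarrow> 'h)) topology"

definition Y :: "('e \<times> (real set \<Rightarrow> 'h)) set" where "Y = cball c r \<times> \<Sigma>"

lemma topspace_hull_top: "topspace (hull_top \<mu>) = \<Sigma>"
  using mhull_subset[of \<mu>] by auto

lemma topspace_X: "topspace X\<^sub>w = UNIV \<times> \<Sigma>" "topspace X\<^sub>n = UNIV \<times> \<Sigma>"
  unfolding topspace_prod_topology topspace_hull_top by simp_all

lemma compactin_hull_top: "compactin (hull_top \<mu>) \<Sigma>"
  using compactin_mhull[OF reflexive(2) una] by (simp add: compactin_subtopology)

lemma Hausdorff_X: "Hausdorff_space X\<^sub>w" "Hausdorff_space X\<^sub>n"
  unfolding Hausdorff_space_prod_topology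
  by (simp_all add: Hausdorff_weak_topology Hausdorff_space_subtopology Hausdorff_Mloc_wstar Hausdorff_space_euclidean)

lemma continuous_map_X: "continuous_map X\<^sub>n X\<^sub>w (\<lambda>x. x)"
proof -
  have "continuous_map X\<^sub>n X\<^sub>w (\<lambda>x. (fst x, snd x))"
  proof (rule continuous_map_pairedI)
    show "continuous_map X\<^sub>n weak_topology fst"
      using continuous_map_compose[OF continuous_map_fst continuous_map_euclidean_weak_topology]
      by (simp add: comp_def)
  qed (rule continuous_map_snd)
  then show ?thesis by simp
qed

lemma closedin_X:
  assumes "closedin X\<^sub>w A"
  shows "closedin X\<^sub>n A"
proof -
  have "closedin X\<^sub>n {x \<in> topspace X\<^sub>n. x \<in> A}"
    by (rule closedin_continuous_map_preimage[OF continuous_map_X assms])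
  moreover have "A \<subseteq> topspace X\<^sub>n" using closedin_subset[OF assms] by (simp only: topspace_X)
  then have "{x \<in> topspace X\<^sub>n. x \<in> A} = A" by blast
  ultimately show ?thesis by (simp only:)
qed

lemma compactin_Y: "compactin X\<^sub>w Y"
  unfolding Y_def
  using compactin_weak_topology_cball[OF reflexive(1)] compactin_hull_top by (simp add: compactin_Times)

lemma S_mem: "x \<in> UNIV \<times> \<Sigma> \<Longrightarrow> S t x \<in> UNIV \<times> \<Sigma>"
  by (auto simp: extended_semigroup_def mshift_mhull)

lemma S_add:
  assumes "x \<in> UNIV \<times> \<Sigma>" "0 \<le> t" "0 \<le> q"
  shows "S (t + q) x = S t (S q x)"
  using assms U_add[of "snd x" t q "fst x"]
  by (auto simp: extended_semigroup_def mshift_mshift split_beta)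

lemma continuous_map_S:
  assumes "0 \<le> t"
  shows "continuous_map X\<^sub>w X\<^sub>w (S t)"
proof -
  have "continuous_map X\<^sub>w X\<^sub>w (\<lambda>x. ((\<lambda>(\<xi>, \<nu>). U \<nu> t 0 \<xi>) x, mshift t (snd x)))"
  proof (rule continuous_map_pairedI[OF weak_cont[OF assms]])
    have "continuous_map (hull_top \<mu>) (hull_top \<mu>) (mshift t)"
      using continuous_map_mshift mshift_mhull
      by (intro continuous_map_into_subtopology continuous_map_from_subtopology) auto
    then show "continuous_map X\<^sub>w (hull_top \<mu>) (\<lambda>x. mshift t (snd x))"
      using continuous_map_compose[OF continuous_map_snd] by (simp add: comp_def)
  qed
  moreover have "S t = (\<lambda>x. ((\<lambda>(\<xi>, \<nu>). U \<nu> t 0 \<xi>) x, mshift t (snd x)))"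
    by (auto simp: extended_semigroup_def)
  ultimately show ?thesis by (simp only:)
qed

section \<open>Absorption and total boundedness of trajectories\<close>

lemma absorbs:
  assumes "bounded D"
  obtains T where "T > 0" "\<And>t. t \<ge> T \<Longrightarrow> S t ` (D \<times> \<Sigma>) \<subseteq> \<B> \<times> \<Sigma>"
proof -
  obtain T where T: "T \<ge> 0" "\<forall>t\<ge>T. \<forall>\<nu>\<in>\<Sigma>. U \<nu> t 0 ` D \<subseteq> \<B>"
    using absorbing assms unfolding uniformly_absorbing_def by blast
  show thesis
  proof (rule that)
    \<comment> \<open>Strict positivity is wanted because multiples of this time must exhaust the
      half-line in \<open>strong_global_attractor_exists\<close>.\<close>
    show "T + 1 > 0" using T(1) by simp
    show "S t ` (D \<times> \<Sigma>) \<subseteq> \<B> \<times> \<Sigma>" if "t \<ge> T + 1" for t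
    proof (intro image_subsetI, elim SigmaE)
      fix x \<xi> \<nu> assume x: "\<xi> \<in> D" "\<nu> \<in> \<Sigma>" "x = (\<xi>, \<nu>)"
      have "t \<ge> T" using that by simp
      then have "U \<nu> t 0 \<xi> \<in> \<B>" using T(2) x by blast
      then show "S t x \<in> \<B> \<times> \<Sigma>" using x by (simp add: extended_semigroup_def mshift_mhull)
    qed
  qed
qed

lemma \<B>_subset_Y: "\<B> \<times> \<Sigma> \<subseteq> Y"
  unfolding Y_def using ball(2) by blast

lemma trajectory_eq_S: "trajectory k x = fst (S (real k * s) x)"
  by (simp add: trajectory_def extended_semigroup_def split_beta)

lemma trajectories_totally_bounded:
  assumes "e > 0"
  obtains n k where "finite k" "trajectory n ` (\<B> \<times> \<Sigma>) \<subseteq> (\<Union>x\<in>k. ball x e)"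
proof -
  obtain P :: nat where P: "P \<ge> 1" "\<And>\<epsilon> n l. \<epsilon> > 0 \<Longrightarrow> real n * s \<le> l \<Longrightarrow>
    \<exists>\<kappa>. \<kappa> ` (\<B> \<times> mhull \<mu>) \<subseteq> {..<hull_covering \<epsilon> l * P ^ n} \<and>
      (\<forall>x\<in>\<B> \<times> mhull \<mu>. \<forall>y\<in>\<B> \<times> mhull \<mu>. \<kappa> x = \<kappa> y \<longrightarrow>
        norm (trajectory n x - trajectory n y) \<le> 2 * r / 8 ^ n + 2 * error_const * \<epsilon>)"
    by (fact trajectory_colouring)
  have ec: "error_const \<ge> 1" by (simp add: error_const_def)
  \<comment> \<open>The additive error takes e / 2. The number of steps n is chosen afterwards to
    push the geometric term below the other half.\<close>
  define \<epsilon> where "\<epsilon> = e / (4 * error_const)"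
  have \<epsilon>: "\<epsilon> > 0" "2 * error_const * \<epsilon> = e / 2" using assms ec by (simp_all add: \<epsilon>_def)
  have "(\<lambda>n. 2 * r * (1 / 8) ^ n) \<longlonglongrightarrow> 2 * r * 0"
    by (intro tendsto_intros LIMSEQ_power_zero) simp
  then have "\<forall>\<^sub>F n in sequentially. 2 * r * (1 / 8) ^ n < e / 2"
    using assms by (intro order_tendstoD(2)) auto
  then obtain n where "2 * r * (1 / 8) ^ n < e / 2" by (auto simp: eventually_sequentially)
  then have n: "2 * r / 8 ^ n < e / 2" by (simp add: power_divide)
  from P(2)[OF \<epsilon>(1) order_refl, of n] obtain \<kappa> where
    \<kappa>: "\<kappa> ` (\<B> \<times> \<Sigma>) \<subseteq> {..<hull_covering \<epsilon> (real n * s) * P ^ n}"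
      "\<forall>x\<in>\<B> \<times> \<Sigma>. \<forall>y\<in>\<B> \<times> \<Sigma>. \<kappa> x = \<kappa> y \<longrightarrow>
        norm (trajectory n x - trajectory n y) \<le> 2 * r / 8 ^ n + 2 * error_const * \<epsilon>"
    by (elim exE conjE) (rule that)
  define rep where "rep i = (SOME x. x \<in> \<B> \<times> \<Sigma> \<and> \<kappa> x = i)" for i
  have rep: "rep (\<kappa> x) \<in> \<B> \<times> \<Sigma>" "\<kappa> (rep (\<kappa> x)) = \<kappa> x" if "x \<in> \<B> \<times> \<Sigma>" for x
    using someI[of "\<lambda>y. y \<in> \<B> \<times> \<Sigma> \<and> \<kappa> y = \<kappa> x" x] that unfolding rep_def by blast+
  define k where "k = (\<lambda>i. trajectory n (rep i)) ` \<kappa> ` (\<B> \<times> \<Sigma>)"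
  show thesis
  proof (rule that)
    have "finite (\<kappa> ` (\<B> \<times> \<Sigma>))" using \<kappa>(1) by (rule finite_subset) simp
    then show "finite k" unfolding k_def by (rule finite_imageI)
    show "trajectory n ` (\<B> \<times> \<Sigma>) \<subseteq> (\<Union>x\<in>k. ball x e)"
    proof (rule image_subsetI)
      fix x assume x: "x \<in> \<B> \<times> \<Sigma>"
      have "norm (trajectory n (rep (\<kappa> x)) - trajectory n x) \<le> 2 * r / 8 ^ n + 2 * error_const * \<epsilon>"
        by (rule \<kappa>(2)[rule_format, OF rep(1)[OF x] x rep(2)[OF x]])
      then have "trajectory n x \<in> ball (trajectory n (rep (\<kappa> x))) e"
        using n \<epsilon>(2) by (simp add: dist_norm)
      moreover have "trajectory n (rep (\<kappa> x)) \<in> k" unfolding k_def by (intro imageI x)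
      ultimately show "trajectory n x \<in> (\<Union>x\<in>k. ball x e)" by (rule UN_I[rotated])
    qed
  qed
qed

text \<open>The finite set F accommodates the initial terms of a sequence, of which only a tail lies
  in the images at time n s.\<close>

lemma compact_closure_if_eventually_trajectory:
  assumes "\<And>n. \<exists>F. finite F \<and> Q \<subseteq> F \<union> trajectory n ` (\<B> \<times> \<Sigma>)"
  shows "compact (closure Q)"
proof (rule compact_closure_if_totally_bounded)
  fix e :: real assume e: "e > 0"
  obtain n k where k: "finite k" "trajectory n ` (\<B> \<times> \<Sigma>) \<subseteq> (\<Union>x\<in>k. ball x e)"
    by (rule trajectories_totally_bounded[OF e])
  obtain F where F: "finite F" "Q \<subseteq> F \<union> trajectory n ` (\<B> \<times> \<Sigma>)" using assms by blast
  have "Q \<subseteq> (\<Union>x\<in>F \<union> k. ball x e)"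
  proof
    fix x assume "x \<in> Q"
    then consider "x \<in> F" | "x \<in> (\<Union>x\<in>k. ball x e)" using F k by blast
    then show "x \<in> (\<Union>x\<in>F \<union> k. ball x e)"
    proof cases
      case 1
      moreover have "x \<in> ball x e" using e by simp
      ultimately show ?thesis by blast
    qed blast
  qed
  then show "\<exists>k. finite k \<and> Q \<subseteq> (\<Union>x\<in>k. ball x e)" using F(1) k(1) by (intro exI[of _ "F \<union> k"]) simp
qed

text \<open>The set \<open>A\<close> is invariant by weak compactness, compact in norm because
  invariance places its first projection in every \<open>trajectory n\<close> image, and attracting
  because a sequence of escaping points would have a norm cluster point, which must lie in
  \<open>A\<close>.\<close>

lemma strong_global_attractor_exists:
  obtains A where "strong_global_attractor U \<mu> A" "A \<subseteq> \<B> \<times> \<Sigma>"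
proof -
  obtain T where T: "T > 0" "\<And>t. t \<ge> T \<Longrightarrow> S t ` (cball c r \<times> \<Sigma>) \<subseteq> \<B> \<times> \<Sigma>"
    by (fact absorbs[OF bounded_cball])
  have TY: "S t ` Y \<subseteq> \<B> \<times> \<Sigma>" if "t \<ge> T" for t
    unfolding Y_def by (rule T(2)[OF that])
  have Ysub: "Y \<subseteq> UNIV \<times> \<Sigma>" by (auto simp: Y_def)
  have closedS: "closedin X\<^sub>w (S t ` Y)" if "0 \<le> t" for t
    by (rule compactin_imp_closedin[OF Hausdorff_X(1) image_compactin[OF compactin_Y continuous_map_S[OF that]]])
  \<comment> \<open>\<open>Y\<close> itself is not known to be positively invariant. It is mapped
    into itself after time \<open>T\<close>, so monotonicity holds across gaps of at least
    \<open>T\<close>.\<close>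
  have nested: "S t' ` Y \<subseteq> S t ` Y" if "0 \<le> t" "t + T \<le> t'" for t t'
  proof (rule image_subsetI)
    fix y assume y: "y \<in> Y"
    have "S t' y = S t (S (t' - t) y)"
      using S_add[of y t "t' - t"] y Ysub that T(1) by auto
    moreover have "T \<le> t' - t" using that by simp
    then have "S (t' - t) y \<in> Y" by (rule subsetD[OF order_trans[OF TY \<B>_subset_Y] imageI[OF y]])
    ultimately show "S t' y \<in> S t ` Y" by (rule image_eqI)
  qed
  define A where "A = (\<Inter>t\<in>{T..}. S t ` Y)"
  have A_mem: "x \<in> S t ` Y" if "x \<in> A" "0 \<le> t" for x t
    using that(1) nested[OF that(2) order_refl] T(1) that(2) unfolding A_def by (auto intro: subsetD)
  have A_memI: "x \<in> A" if "\<And>t. t \<ge> T \<Longrightarrow> x \<in> S t ` Y" for x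
    unfolding A_def using that by blast
  have A\<B>: "A \<subseteq> \<B> \<times> \<Sigma>"
    using TY[OF order_refl] A_mem T(1) by (meson less_imp_le subset_iff)
  then have A_sub: "A \<subseteq> UNIV \<times> \<Sigma>" by auto
  have "closedin X\<^sub>w A"
    unfolding A_def using closedS T(1) by (intro closedin_INT) auto
  have inv1: "S q ` A \<subseteq> A" if q: "0 \<le> q" for q
  proof (intro image_subsetI A_memI)
    fix x t assume x: "x \<in> A" and t: "t \<ge> T"
    have "x \<in> S (t + T) ` Y" using x t T(1) by (intro A_mem) auto
    then obtain y where y: "y \<in> Y" "x = S (t + T) y" by blast
    have "S q x = S (q + (t + T)) y"
      using S_add[of y q "t + T"] y Ysub q t T(1) by auto
    moreover have "S (q + (t + T)) y \<in> S t ` Y"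
      using nested[of t "q + (t + T)"] y(1) q t T(1) by auto
    ultimately show "S q x \<in> S t ` Y" by simp
  qed
  have inv2: "A \<subseteq> S q ` A" if q: "0 \<le> q" for q
  proof
    fix x assume x: "x \<in> A"
    \<comment> \<open>Preimages of x under \<open>S q\<close> among states of increasing age.
      Consecutive ages differ by \<open>T\<close>, exactly the gap required by
      \<open>nested\<close>; a point common to all of them is a preimage of x in
      \<open>A\<close>.\<close>
    define G where "G k = {y \<in> topspace X\<^sub>w. S q y \<in> {x}} \<inter> S (T * real (Suc k)) ` Y" for k :: nat
    have pos: "0 \<le> T * real (Suc k)" for k using T(1) by simp
    have "closedin X\<^sub>w {x}"
      unfolding closedin_Hausdorff_sing_eq[OF Hausdorff_X(1)] topspace_X by (rule subsetD[OF A_sub x])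
    then have "closedin X\<^sub>w {y \<in> topspace X\<^sub>w. S q y \<in> {x}}"
      by (rule closedin_continuous_map_preimage[OF continuous_map_S[OF q]])
    then have closedG: "closedin X\<^sub>w (G k)" for k
      unfolding G_def by (intro closedin_Int closedS pos)
    have GY: "G k \<subseteq> Y" for k
    proof -
      have "T * 1 \<le> T * real (Suc k)" using T(1) by (intro mult_left_mono) auto
      then have "S (T * real (Suc k)) ` Y \<subseteq> \<B> \<times> \<Sigma>" by (intro TY) simp
      then show ?thesis unfolding G_def using \<B>_subset_Y by blast
    qed
    have "(\<Inter>k. G k) \<noteq> {}"
    proof (rule compact_space_imp_nest)
      show "compact_space (subtopology X\<^sub>w Y)" using compactin_Y by (rule compact_space_subtopology)
      show "closedin (subtopology X\<^sub>w Y) (G k)" for k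
        by (rule closedin_subset_topspace[OF closedG GY])
      show "decseq G"
      proof (rule decseq_SucI)
        fix k
        have "S (T * real (Suc (Suc k))) ` Y \<subseteq> S (T * real (Suc k)) ` Y"
          by (rule nested[OF pos]) (simp add: algebra_simps)
        then show "G (Suc k) \<subseteq> G k" unfolding G_def by blast
      qed
      show "G k \<noteq> {}" for k
      proof -
        have "x \<in> S (q + T * real (Suc k)) ` Y" using x q pos[of k] by (intro A_mem) auto
        then obtain y where y: "y \<in> Y" "x = S (q + T * real (Suc k)) y" by blast
        have "S (T * real (Suc k)) y \<in> G k"
          using S_add[OF subsetD[OF Ysub y(1)] q pos[of k]] S_mem[OF subsetD[OF Ysub y(1)]] y
          unfolding G_def topspace_X by simp
        then show ?thesis by blast
      qed
    qed
    then obtain y where y: "\<And>k. y \<in> G k" by blast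
    have "y \<in> A"
    proof (rule A_memI)
      fix t assume t: "t \<ge> T"
      obtain k where k: "(t + T) / T < real k" using reals_Archimedean2 by blast
      then have "t + T \<le> T * real (Suc k)" using T(1) by (simp add: field_simps)
      then have "S (T * real (Suc k)) ` Y \<subseteq> S t ` Y" using t T(1) by (intro nested) auto
      then show "y \<in> S t ` Y" using y[of k] unfolding G_def by blast
    qed
    moreover have "x = S q y" using y[of 0] by (simp add: G_def)
    ultimately show "x \<in> S q ` A" by (rule image_eqI[rotated])
  qed
  have fst_A: "fst ` A \<subseteq> trajectory n ` (\<B> \<times> \<Sigma>)" for n
  proof (rule image_subsetI)
    fix x assume "x \<in> A"
    then have "x \<in> S (real n * s) ` A" using inv2[of "real n * s"] s_pos by auto
    then obtain y where "y \<in> \<B> \<times> \<Sigma>" "x = S (real n * s) y" using A\<B> by blast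
    then show "fst x \<in> trajectory n ` (\<B> \<times> \<Sigma>)" by (simp add: trajectory_eq_S)
  qed
  have "compact (closure (fst ` A))"
  proof (rule compact_closure_if_eventually_trajectory)
    fix n
    show "\<exists>F. finite F \<and> fst ` A \<subseteq> F \<union> trajectory n ` (\<B> \<times> \<Sigma>)"
      using fst_A[of n] by (intro exI[of _ "{}"]) simp
  qed
  then have "compactin X\<^sub>n (closure (fst ` A) \<times> \<Sigma>)"
    using compactin_hull_top by (simp add: compactin_Times)
  moreover have "A \<subseteq> closure (fst ` A) \<times> \<Sigma>"
  proof
    fix x assume x: "x \<in> A"
    then have "fst x \<in> closure (fst ` A)" by (intro subsetD[OF closure_subset] imageI)
    moreover have "snd x \<in> \<Sigma>" using x A_sub by auto
    ultimately show "x \<in> closure (fst ` A) \<times> \<Sigma>" by (simp add: mem_Times_iff)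
  qed
  ultimately have "compactin X\<^sub>n A"
    using closedin_X[OF \<open>closedin X\<^sub>w A\<close>] by (rule closed_compactin)
  moreover have "S t ` A = A" if "0 \<le> t" for t
    using inv1[OF that] inv2[OF that] by (rule equalityI)
  moreover have "\<exists>T\<ge>0. \<forall>t\<ge>T. S t ` D \<subseteq> O'"
    if D: "D \<subseteq> UNIV \<times> \<Sigma>" "bounded (fst ` D)" and O': "openin X\<^sub>n O'" "A \<subseteq> O'" for D O'
  proof (rule ccontr)
    assume neg: "\<not> (\<exists>T\<ge>0. \<forall>t\<ge>T. S t ` D \<subseteq> O')"
    obtain T' where T': "T' > 0" "\<And>t. t \<ge> T' \<Longrightarrow> S t ` (fst ` D \<times> \<Sigma>) \<subseteq> \<B> \<times> \<Sigma>"
      by (fact absorbs[OF D(2)])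
    have "\<exists>t y. t \<ge> real k \<and> y \<in> D \<and> S t y \<notin> O'" for k :: nat
    proof -
      have "\<not> (\<forall>t\<ge>real k. S t ` D \<subseteq> O')" using neg by (metis of_nat_0_le_iff)
      then show ?thesis by (auto simp: image_subset_iff)
    qed
    then obtain t y where ty: "\<And>k. t k \<ge> real k" "\<And>k. y k \<in> D" "\<And>k. S (t k) (y k) \<notin> O'" by metis
    define z where "z k = S (t k) (y k)" for k
    have yS: "y k \<in> UNIV \<times> \<Sigma>" for k using ty(2) D(1) by blast
    have zS: "z k \<in> UNIV \<times> \<Sigma>" for k unfolding z_def by (rule S_mem[OF yS])
    \<comment> \<open>The last q units of time are split off: the rest of the orbit is long enough
      to have entered the absorbing set.\<close>
    have ev: "z k \<in> S q ` (\<B> \<times> \<Sigma>)" if "0 \<le> q" "q + T' \<le> real k" for k q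
    proof -
      have tk: "t k - q \<ge> T'" using ty(1)[of k] that by linarith
      have "y k \<in> fst ` D \<times> \<Sigma>" using ty(2)[of k] yS[of k] by (simp add: mem_Times_iff)
      then have "S (t k - q) (y k) \<in> \<B> \<times> \<Sigma>" by (rule subsetD[OF T'(2)[OF tk] imageI])
      moreover have "z k = S q (S (t k - q) (y k))"
        using S_add[OF yS that(1), of "t k - q"] tk T'(1) by (simp add: z_def)
      ultimately show ?thesis by (rule image_eqI[rotated])
    qed
    define Q where "Q = closure (range (\<lambda>k. fst (z k)))"
    have "compact Q" unfolding Q_def
    proof (rule compact_closure_if_eventually_trajectory)
      fix n
      define m where "m = nat \<lceil>real n * s + T'\<rceil>"
      have "range (\<lambda>k. fst (z k)) \<subseteq> (\<lambda>k. fst (z k)) ` {..<m} \<union> trajectory n ` (\<B> \<times> \<Sigma>)"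
      proof (rule image_subsetI)
        fix k
        show "fst (z k) \<in> (\<lambda>k. fst (z k)) ` {..<m} \<union> trajectory n ` (\<B> \<times> \<Sigma>)"
        proof (cases "k < m")
          case False
          then have "real n * s + T' \<le> real k" unfolding m_def by linarith
          then have "z k \<in> S (real n * s) ` (\<B> \<times> \<Sigma>)" using s_pos by (intro ev) auto
          then show ?thesis by (auto simp: trajectory_eq_S)
        qed simp
      qed
      then show "\<exists>F. finite F \<and> range (\<lambda>k. fst (z k)) \<subseteq> F \<union> trajectory n ` (\<B> \<times> \<Sigma>)"
        by (intro exI[of _ "(\<lambda>k. fst (z k)) ` {..<m}"]) simp
    qed
    define W where "W = Q \<times> \<Sigma>"
    have W: "compactin X\<^sub>n W"
      unfolding W_def using \<open>compact Q\<close> compactin_hull_top by (simp add: compactin_Times)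
    then have closedW: "closedin X\<^sub>n W" by (rule compactin_imp_closedin[OF Hausdorff_X(2)])
    have zW: "z k \<in> W" for k
    proof -
      have "fst (z k) \<in> Q" unfolding Q_def by (intro subsetD[OF closure_subset] rangeI)
      moreover have "snd (z k) \<in> \<Sigma>" using zS[of k] by (simp add: mem_Times_iff)
      ultimately show ?thesis by (simp add: W_def mem_Times_iff)
    qed
    \<comment> \<open>The cluster points of the sequence are the intersection of these closures of
      tails, so no convergent subsequence has to be extracted.\<close>
    define G where "G j = X\<^sub>n closure_of (z ` {j..})" for j :: nat
    have G_le: "G j \<subseteq> V" if "closedin X\<^sub>n V" "\<And>k. k \<ge> j \<Longrightarrow> z k \<in> V" for j V
      unfolding G_def using that by (intro closure_of_minimal) auto
    have "(\<Inter>j. G j) \<noteq> {}"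
    proof (rule compact_space_imp_nest)
      show "compact_space (subtopology X\<^sub>n W)" using W by (rule compact_space_subtopology)
      show "closedin (subtopology X\<^sub>n W) (G j)" for j
      proof (rule closedin_subset_topspace)
        show "closedin X\<^sub>n (G j)" by (simp add: G_def)
        show "G j \<subseteq> W" using zW by (intro G_le closedW)
      qed
      show "decseq G"
      proof (rule decseq_SucI)
        show "G (Suc j) \<subseteq> G j" for j unfolding G_def by (intro closure_of_mono image_mono) auto
      qed
      show "G j \<noteq> {}" for j
      proof -
        have "z ` {j..} \<subseteq> topspace X\<^sub>n"
          unfolding topspace_X by (rule image_subsetI) (rule zS)
        then have "z j \<in> G j"
          unfolding G_def by (rule subsetD[OF closure_of_subset]) simp
        then show ?thesis by blast
      qed
    qed
    then obtain w where w: "\<And>j. w \<in> G j" by blast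
    have "w \<in> A"
    proof (rule A_memI)
      fix q assume q: "q \<ge> T"
      define j where "j = nat \<lceil>q + T'\<rceil>"
      have "G j \<subseteq> S q ` Y"
      proof (rule G_le)
        \<comment> \<open>Here a weakly closed image serves as a norm closed one, so it retains
          cluster points of the tail contained in it.\<close>
        show "closedin X\<^sub>n (S q ` Y)" using q T(1) by (intro closedin_X closedS) simp
        fix k assume "j \<le> k"
        then have "q + T' \<le> real k" unfolding j_def by linarith
        then have "z k \<in> S q ` (\<B> \<times> \<Sigma>)" using q T(1) by (intro ev) auto
        then show "z k \<in> S q ` Y" by (rule subsetD[OF image_mono[OF \<B>_subset_Y]])
      qed
      then show "w \<in> S q ` Y" using w by blast
    qed
    moreover have "G 0 \<subseteq> topspace X\<^sub>n - O'"
    proof (rule G_le)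
      show "closedin X\<^sub>n (topspace X\<^sub>n - O')" using O'(1) by (rule closedin_diff[OF closedin_topspace])
      show "z k \<in> topspace X\<^sub>n - O'" for k
        unfolding topspace_X using zS[of k] ty(3)[of k] by (simp add: z_def)
    qed
    ultimately show False using w[of 0] O'(2) by blast
  qed
  ultimately have "strong_global_attractor U \<mu> A"
    unfolding strong_global_attractor_def by blast
  then show thesis using A\<B> by (rule that)
qed

section \<open>Entropy of the attractor\<close>

lemma attractor_subset_trajectories:
  assumes "strong_global_attractor U \<mu> A" "A \<subseteq> \<B> \<times> \<Sigma>"
  shows "fst ` A \<subseteq> trajectory n ` (\<B> \<times> \<Sigma>)"
proof (rule image_subsetI)
  fix x assume x: "x \<in> A"
  have "0 \<le> real n * s" using s_pos by simp
  then have "S (real n * s) ` A = A" using assms(1) unfolding strong_global_attractor_def by blast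
  then obtain y where "y \<in> \<B> \<times> \<Sigma>" "x = S (real n * s) y" using x assms(2) by blast
  then show "fst x \<in> trajectory n ` (\<B> \<times> \<Sigma>)" by (simp add: trajectory_eq_S)
qed

lemma entropy_attractor:
  assumes A: "strong_global_attractor U \<mu> A" "A \<subseteq> \<B> \<times> \<Sigma>"
  obtains C1 where "C1 > 0" "\<And>\<epsilon>. 0 < \<epsilon> \<Longrightarrow> \<epsilon> \<le> r \<Longrightarrow>
    entropy UNIV dist \<epsilon> (fst ` A) \<le> C1 * log 2 (2 * r / \<epsilon>)
      + log 2 (real (hull_covering (\<epsilon> / (8 * error_const)) (2 * s * log 2 (2 * r / \<epsilon>))))"
proof -
  obtain P :: nat where P: "P \<ge> 1" "\<And>\<epsilon> n l. \<epsilon> > 0 \<Longrightarrow> real n * s \<le> l \<Longrightarrow>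
    \<exists>\<kappa>. \<kappa> ` (\<B> \<times> mhull \<mu>) \<subseteq> {..<hull_covering \<epsilon> l * P ^ n} \<and>
      (\<forall>x\<in>\<B> \<times> mhull \<mu>. \<forall>y\<in>\<B> \<times> mhull \<mu>. \<kappa> x = \<kappa> y \<longrightarrow>
        norm (trajectory n x - trajectory n y) \<le> 2 * r / 8 ^ n + 2 * error_const * \<epsilon>)"
    by (fact trajectory_colouring)
  have ec: "error_const \<ge> 1" by (simp add: error_const_def)
  \<comment> \<open>The factor 2 comes from n \<le> 2 l; the summand 1 keeps the constant positive
    when P = 1.\<close>
  define C1 where "C1 = 2 * log 2 (real P) + 1"
  have logP: "log 2 (real P) \<ge> 0" using P(1) by simp
  show thesis
  proof (rule that)
    show "C1 > 0" using logP by (simp add: C1_def)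
    fix \<epsilon> :: real assume \<epsilon>: "0 < \<epsilon>" "\<epsilon> \<le> r"
    define l where "l = log 2 (2 * r / \<epsilon>)"
    \<comment> \<open>Makes the additive error \<epsilon> / 4. With the geometric term, also at most
      \<epsilon> / 4, the diameters stay strictly below \<epsilon>, as open balls of that radius
      require.\<close>
    define \<epsilon>' where "\<epsilon>' = \<epsilon> / (8 * error_const)"
    define n where "n = nat \<lceil>l\<rceil>"
    define N where "N = hull_covering \<epsilon>' (2 * s * l)"
    have ge2: "2 * r / \<epsilon> \<ge> 2" using \<epsilon> by (simp add: field_simps)
    have l: "l \<ge> 1"
      unfolding l_def using ge2 by (subst le_log_iff) auto
    then have n: "l \<le> real n" "real n \<le> l + 1" "n \<ge> 1" unfolding n_def by linarith+
    have \<epsilon>': "\<epsilon>' > 0" "2 * error_const * \<epsilon>' = \<epsilon> / 4" using \<epsilon>(1) ec by (simp_all add: \<epsilon>'_def)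
    have "2 * r / \<epsilon> \<le> 2 ^ n"
    proof -
      have "2 * r / \<epsilon> = 2 powr l" unfolding l_def using ge2 by (subst powr_log_cancel) auto
      also have "\<dots> \<le> 2 powr real n" using n(1) by (rule powr_mono) simp
      also have "\<dots> = 2 ^ n" by (simp add: powr_realpow)
      finally show ?thesis .
    qed
    moreover have "(4::real) \<le> 4 ^ n" using power_increasing[of 1 n "4::real"] n(3) by simp
    \<comment> \<open>Writing 8^n as 2^n 4^n, the first factor absorbs the ratio 2 r / \<epsilon>
      and the second yields the margin 4.\<close>
    ultimately have "(2 * r / \<epsilon>) * 4 \<le> 2 ^ n * 4 ^ n" using ge2 by (intro mult_mono) auto
    also have "\<dots> = (8::real) ^ n" by (simp add: power_mult_distrib[symmetric])
    finally have "2 * r / 8 ^ n \<le> \<epsilon> / 4" using \<epsilon>(1) by (simp add: field_simps)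
    then have err: "2 * r / 8 ^ n + 2 * error_const * \<epsilon>' < \<epsilon>" using \<epsilon>(1) \<epsilon>'(2) by linarith
    \<comment> \<open>Rounding up costs at most 1, and l \<ge> 1 because \<epsilon> \<le> r; so n
      \<le> 2 l. This is the origin of the interval length 2 s l.\<close>
    have "real n * s \<le> (2 * l) * s" using n(2) l s_pos by (intro mult_right_mono) auto
    then have "real n * s \<le> 2 * s * l" by (simp add: mult_ac)
    from P(2)[OF \<epsilon>'(1) this, folded N_def] obtain \<kappa> where
      \<kappa>: "\<kappa> ` (\<B> \<times> \<Sigma>) \<subseteq> {..<N * P ^ n}"
        "\<forall>x\<in>\<B> \<times> \<Sigma>. \<forall>y\<in>\<B> \<times> \<Sigma>. \<kappa> x = \<kappa> y \<longrightarrow>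
          norm (trajectory n x - trajectory n y) \<le> 2 * r / 8 ^ n + 2 * error_const * \<epsilon>'"
      by (elim exE conjE) (rule that)
    \<comment> \<open>One actual datum shows that there is at least one colour, so the logarithm of
      the product may be split.\<close>
    have "(c, \<mu>) \<in> \<B> \<times> \<Sigma>" using ball(3) \<mu>_mhull by simp
    then have "\<kappa> (c, \<mu>) \<in> {..<N * P ^ n}" using \<kappa>(1) by blast
    then have NP: "N * P ^ n > 0" by (simp only: lessThan_iff)
    then have "N > 0" by simp
    have "covering_number UNIV dist \<epsilon> (fst ` A) \<le> N * P ^ n"
    proof (rule covering_number_le[OF Met_TC.Metric_space_axioms attractor_subset_trajectories[OF A] subset_UNIV \<kappa>(1)])
      fix x y assume xy: "x \<in> \<B> \<times> \<Sigma>" "y \<in> \<B> \<times> \<Sigma>" "\<kappa> x = \<kappa> y"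
      have "norm (trajectory n x - trajectory n y) \<le> 2 * r / 8 ^ n + 2 * error_const * \<epsilon>'"
        by (rule \<kappa>(2)[rule_format, OF xy])
      then show "dist (trajectory n x) (trajectory n y) < \<epsilon>" using err by (simp add: dist_norm)
    qed
    then have cn: "real (covering_number UNIV dist \<epsilon> (fst ` A)) \<le> real N * real P ^ n"
      by (metis of_nat_le_iff of_nat_mult of_nat_power)
    have "entropy UNIV dist \<epsilon> (fst ` A) \<le> log 2 (real N * real P ^ n)"
    \<comment> \<open>A covering number 0 is not excluded here. The convention that log 0 is 0 then
      leaves only nonnegativity of the right-hand side to be checked.\<close>
    proof (cases "covering_number UNIV dist \<epsilon> (fst ` A) = 0")
      case True
      have "1 \<le> real (N * P ^ n)" using NP by linarith
      then have "0 \<le> log 2 (real N * real P ^ n)" by simp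
      moreover have "log 2 (0::real) = 0" by (simp add: log_def)
      ultimately show ?thesis using True by (simp add: entropy_def)
    next
      case False
      then show ?thesis unfolding entropy_def using cn by (intro log_mono) auto
    qed
    also have "\<dots> = log 2 (real N) + real n * log 2 (real P)"
      using \<open>N > 0\<close> P(1) by (simp add: log_mult log_nat_power)
    also have "real n * log 2 (real P) \<le> (2 * l) * log 2 (real P)"
      using n(2) l logP by (intro mult_right_mono) auto
    also have "(2 * l) * log 2 (real P) \<le> C1 * l" using l by (simp add: C1_def algebra_simps)
    finally show "entropy UNIV dist \<epsilon> (fst ` A) \<le> C1 * log 2 (2 * r / \<epsilon>)
      + log 2 (real (hull_covering (\<epsilon> / (8 * error_const)) (2 * s * log 2 (2 * r / \<epsilon>))))"
      by (simp add: N_def \<epsilon>'_def l_def)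
  qed
qed

end

theorem theorem3p7:
  fixes \<mu> :: "real set \<Rightarrow> 'h::banach"
    and U :: "(real set \<Rightarrow> 'h) \<Rightarrow> real \<Rightarrow> real \<Rightarrow> 'e::banach \<Rightarrow> 'e"
    and Q :: "real \<Rightarrow> real"
    and \<alpha> Cstar s L C :: real
    and \<B> :: "'e set"
    and Pr :: "real \<Rightarrow> (real set \<Rightarrow> 'h) \<Rightarrow> (real set \<Rightarrow> 'h)"
    and J :: "'e \<Rightarrow>\<^sub>L 'w::banach"
  assumes reflexive: "reflexive_space TYPE('e)" "reflexive_space TYPE('h)"
    and una: "\<mu> \<in> Mb_una"
    and process: "\<And>\<nu>. \<nu> \<in> mhull \<mu> \<Longrightarrow> dynamical_process (U \<nu>)"
    and translation: "translation_identity U (mhull \<mu>)"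
    \<comment> \<open>(i)\<close>
    and dissipative_const: "\<alpha> > 0" "Cstar \<ge> 0" "mono_on {0..} Q"
    and dissipative: "\<And>t \<tau> \<nu> \<xi>. \<tau> \<le> t \<Longrightarrow> \<nu> \<in> mhull \<mu> \<Longrightarrow>
          norm (U \<nu> t \<tau> \<xi>) \<le> Q (norm \<xi>) * exp (- \<alpha> * (t - \<tau>)) + Cstar"
    \<comment> \<open>(ii)\<close>
    and weak_cont: "\<And>t \<tau>. \<tau> \<le> t \<Longrightarrow>
          continuous_map (prod_topology weak_topology (hull_top \<mu>)) weak_topology
            (\<lambda>(\<xi>, \<nu>). U \<nu> t \<tau> \<xi>)"
    \<comment> \<open>(iii)\<close>
    and ball: "\<exists>c r. r > 0 \<and> (\<B> = cball c r \<or> \<B> = ball c r)"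
    and absorbing: "uniformly_absorbing U (mhull \<mu>) \<B>"
    and s_pos: "s > 0"
    and invariant: "\<And>\<nu>. \<nu> \<in> mhull \<mu> \<Longrightarrow> U \<nu> s 0 ` \<B> \<subseteq> \<B>"
    \<comment> \<open>(iv)\<close>
    and embedding: "compact_embedding J"
    and Pr_una: "\<And>\<epsilon>. \<epsilon> > 0 \<Longrightarrow> Pr \<epsilon> ` mhull \<mu> \<subseteq> Mb_una"
    and Pr_shift: "\<And>\<epsilon> h \<nu>. \<epsilon> > 0 \<Longrightarrow> \<nu> \<in> mhull \<mu> \<Longrightarrow> Pr \<epsilon> (mshift h \<nu>) = mshift h (Pr \<epsilon> \<nu>)"
    and Pr_precompact: "\<And>\<epsilon>. \<epsilon> > 0 \<Longrightarrow> strong_loc_precompact (Pr \<epsilon> ` mhull \<mu>)"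
    and squeezing: "\<And>\<epsilon> \<xi>\<^sub>1 \<xi>\<^sub>2 \<nu>\<^sub>1 \<nu>\<^sub>2. \<epsilon> > 0 \<Longrightarrow> \<xi>\<^sub>1 \<in> \<B> \<Longrightarrow> \<xi>\<^sub>2 \<in> \<B> \<Longrightarrow>
          \<nu>\<^sub>1 \<in> mhull \<mu> \<Longrightarrow> \<nu>\<^sub>2 \<in> mhull \<mu> \<Longrightarrow>
          norm (U \<nu>\<^sub>1 s 0 \<xi>\<^sub>1 - U \<nu>\<^sub>2 s 0 \<xi>\<^sub>2)
            \<le> 1 / 16 * norm (\<xi>\<^sub>1 - \<xi>\<^sub>2) + L * norm (blinfun_apply J (\<xi>\<^sub>1 - \<xi>\<^sub>2)) + \<epsilon>
              + C * Mb_dist {0..s} (Pr \<epsilon> \<nu>\<^sub>1) (Pr \<epsilon> \<nu>\<^sub>2)"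
  shows "\<exists>\<A>. strong_uniform_attractor U \<mu> \<A> \<and>
    (\<exists>C1 K1 L1 R0. C1 > 0 \<and> K1 > 0 \<and> L1 > 0 \<and> R0 > 0 \<and>
      (\<forall>\<epsilon>. 0 < \<epsilon> \<and> \<epsilon> \<le> R0 \<longrightarrow>
        (let I = {0 .. L1 * log 2 (2 * R0 / \<epsilon>)} in
          entropy UNIV dist \<epsilon> \<A>
            \<le> C1 * log 2 (2 * R0 / \<epsilon>)
              + entropy (Mb I) (Mb_dist I) (\<epsilon> / K1) (mrestrict I ` Pr (\<epsilon> / K1) ` mhull \<mu>))))"
proof -
  obtain c r where cr: "r > 0" "\<B> = cball c r \<or> \<B> = ball c r" using ball by blast
  interpret squeezing_family \<mu> U s L C r c \<B> Pr J
  proof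
    show "\<B> \<subseteq> cball c r" using cr(2) ball_subset_cball by blast
    show "c \<in> \<B>" using cr by auto
  qed (fact reflexive una process translation weak_cont cr(1) absorbing s_pos invariant embedding
      Pr_una Pr_shift Pr_precompact squeezing)+
  obtain A where A: "strong_global_attractor U \<mu> A" "A \<subseteq> \<B> \<times> mhull \<mu>"
    by (fact strong_global_attractor_exists)
  obtain C1 where C1: "C1 > 0" "\<And>\<epsilon>. 0 < \<epsilon> \<Longrightarrow> \<epsilon> \<le> r \<Longrightarrow>
    entropy UNIV dist \<epsilon> (fst ` A) \<le> C1 * log 2 (2 * r / \<epsilon>)
      + log 2 (real (hull_covering (\<epsilon> / (8 * error_const)) (2 * s * log 2 (2 * r / \<epsilon>))))"
    by (fact entropy_attractor[OF A])
  have "strong_uniform_attractor U \<mu> (fst ` A)"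
    using A(1) unfolding strong_uniform_attractor_def by blast
  \<comment> \<open>The witnesses are \<open>K1 = 8 * error_const\<close>, \<open>L1 = 2 * s\<close>
    and \<open>R0 = r\<close>, the radius of the absorbing ball; none depends on \<epsilon>.\<close>
  moreover have "8 * error_const > 0" by (simp add: error_const_def)
  moreover have "2 * s > 0" using s_pos by simp
  moreover have "\<forall>\<epsilon>. 0 < \<epsilon> \<and> \<epsilon> \<le> r \<longrightarrow>
        (let I = {0 .. 2 * s * log 2 (2 * r / \<epsilon>)} in
          entropy UNIV dist \<epsilon> (fst ` A)
            \<le> C1 * log 2 (2 * r / \<epsilon>)
              + entropy (Mb I) (Mb_dist I) (\<epsilon> / (8 * error_const))
                  (mrestrict I ` Pr (\<epsilon> / (8 * error_const)) ` mhull \<mu>))"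
  proof (intro allI impI)
    fix \<epsilon> assume "0 < \<epsilon> \<and> \<epsilon> \<le> r"
    then show "let I = {0 .. 2 * s * log 2 (2 * r / \<epsilon>)} in
          entropy UNIV dist \<epsilon> (fst ` A)
            \<le> C1 * log 2 (2 * r / \<epsilon>)
              + entropy (Mb I) (Mb_dist I) (\<epsilon> / (8 * error_const))
                  (mrestrict I ` Pr (\<epsilon> / (8 * error_const)) ` mhull \<mu>)"
      using C1(2)[of \<epsilon>] unfolding Let_def entropy_def[of "Mb _"] by blast
  qed
  ultimately show ?thesis using C1(1) cr(1) by blast
qed

end
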